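(* Let $d\ge 1$ be an integer, $\lambda\in\mathbf{R}\setminus\{0\}$ and $\sigma>0$. Assume that either $\sigma$ is an integer, or that there exists an integer $r$ such that $2\sigma\ge r>d/2$. In either of the two cases: - $P(\xi)=c\cdot\xi$, $c\in\mathbf{R}^d$, or - $P$ is constant, for all $\delta>0$, there exists $u_0\in H^{d/2}(\mathbf{R}^d)$ with $\|u_0\|_{H^{d/2}(\mathbf{R}^d)}\le\delta$ such that the Cauchy problem $$ i\partial_t u+P(D)u=\lambda|u|^{2\sigma}u,\qquad u_{\mid t=0}=u_0,\qquad (t,x)\in\mathbf{R}_+\times\mathbf{R}^d,$$ has a unique solution $u\in C(\mathbf{R}_+;\mathcal{D}'(\mathbf{R}^d))$, and for any $t>0$, $u(t,\cdot)\notin H^{d/2}(\mathbf{R}^d)$.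
   Context: Here $P:\mathbf{R}^d\to\mathbf{R}$ is real-valued, $D=-i\nabla_x$, and $P(D)$ is the Fourier multiplier with symbol $P$ (so $P(D)=-ic\cdot\nabla$ in the first case, and multiplication by a real constant in the second). $H^{d/2}(\mathbf{R}^d)$ is the usual inhomogeneous $L^2$-based Sobolev space, and $\mathcal{D}'(\mathbf{R}^d)$ is the space of distributions on $\mathbf{R}^d$. *)

theory Defs
  imports "HOL-Analysis.Analysis"
begin

fun partials :: "'a::euclidean_space list \<Rightarrow> ('a \<Rightarrow> complex) \<Rightarrow> 'a \<Rightarrow> complex" where
  "partials [] f = f"
| "partials (b # bs) f = (\<lambda>x. frechet_derivative (partials bs f) (at x) b)"

definition multi_indices :: "nat \<Rightarrow> 'a::euclidean_space list set" where
  "multi_indices N = {bs. set bs \<subseteq> Basis \<and> length bs \<le> N}"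

definition smooth :: "('a::euclidean_space \<Rightarrow> complex) \<Rightarrow> bool" where
  "smooth f \<longleftrightarrow> (\<forall>bs. set bs \<subseteq> Basis \<longrightarrow> (\<forall>x. partials bs f differentiable (at x)))"

definition supp :: "('a::euclidean_space \<Rightarrow> complex) \<Rightarrow> 'a set" where
  "supp f = closure {x. f x \<noteq> 0}"

definition test_functions :: "'a::euclidean_space set \<Rightarrow> ('a \<Rightarrow> complex) set" where
  "test_functions \<Omega> = {\<phi>. smooth \<phi> \<and> compact (supp \<phi>) \<and> supp \<phi> \<subseteq> \<Omega>}"

text \<open>
  A functional is a total function on \<open>'a \<Rightarrow> complex\<close>; only its values on test functions
  (resp. on Schwartz functions, for tempered distributions) are meaningful, and equality of
  distributions means equality of these values. The embedding of tempered distributions into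
  distributions is then the identity on functionals.
\<close>

type_synonym 'a functional = "('a \<Rightarrow> complex) \<Rightarrow> complex"

definition linear_on_space :: "('a \<Rightarrow> complex) set \<Rightarrow> 'a functional \<Rightarrow> bool" where
  "linear_on_space V T \<longleftrightarrow>
     (\<forall>\<phi>\<in>V. \<forall>\<psi>\<in>V. T (\<lambda>x. \<phi> x + \<psi> x) = T \<phi> + T \<psi>) \<and>
     (\<forall>a. \<forall>\<phi>\<in>V. T (\<lambda>x. a * \<phi> x) = a * T \<phi>)"

definition distribution :: "'a::euclidean_space set \<Rightarrow> 'a functional \<Rightarrow> bool" where
  "distribution \<Omega> T \<longleftrightarrow> linear_on_space (test_functions \<Omega>) T \<and>
     (\<forall>K. compact K \<and> K \<subseteq> \<Omega> \<longrightarrow> (\<exists>C N. \<forall>\<phi>\<in>test_functions K.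
        cmod (T \<phi>) \<le> C * (\<Sum>bs\<in>multi_indices N. SUP x. cmod (partials bs \<phi> x))))"

definition dist_eq :: "'a::euclidean_space set \<Rightarrow> 'a functional \<Rightarrow> 'a functional \<Rightarrow> bool" where
  "dist_eq \<Omega> S T \<longleftrightarrow> (\<forall>\<phi>\<in>test_functions \<Omega>. S \<phi> = T \<phi>)"

definition locally_integrable :: "'a::euclidean_space set \<Rightarrow> ('a \<Rightarrow> complex) \<Rightarrow> bool" where
  "locally_integrable \<Omega> f \<longleftrightarrow> (\<forall>K. compact K \<and> K \<subseteq> \<Omega> \<longrightarrow> set_integrable lborel K f)"

definition regular_dist :: "('a::euclidean_space \<Rightarrow> complex) \<Rightarrow> 'a functional" where
  "regular_dist f = (\<lambda>\<phi>. LINT x|lborel. f x * \<phi> x)"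

text \<open>Unitary normalization, with frequency variable dual to \<open>D = -i\<nabla>\<close>.\<close>

definition fourier :: "('a::euclidean_space \<Rightarrow> complex) \<Rightarrow> 'a \<Rightarrow> complex" where
  "fourier f \<xi> = complex_of_real ((2 * pi) powr (- real DIM('a) / 2)) *
     (LINT x|lborel. exp (- \<i> * complex_of_real (x \<bullet> \<xi>)) * f x)"

definition inv_fourier :: "('a::euclidean_space \<Rightarrow> complex) \<Rightarrow> 'a \<Rightarrow> complex" where
  "inv_fourier g x = complex_of_real ((2 * pi) powr (- real DIM('a) / 2)) *
     (LINT \<xi>|lborel. exp (\<i> * complex_of_real (x \<bullet> \<xi>)) * g \<xi>)"

definition schwartz_functions :: "('a::euclidean_space \<Rightarrow> complex) set" where
  "schwartz_functions = {\<phi>. smooth \<phi> \<and>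
     (\<forall>bs N. set bs \<subseteq> Basis \<longrightarrow> bounded (range (\<lambda>x. (1 + norm x) ^ N * cmod (partials bs \<phi> x))))}"

definition tempered_distribution :: "'a::euclidean_space functional \<Rightarrow> bool" where
  "tempered_distribution T \<longleftrightarrow> linear_on_space schwartz_functions T \<and>
     (\<exists>C N. \<forall>\<phi>\<in>schwartz_functions. cmod (T \<phi>) \<le>
        C * (\<Sum>bs\<in>multi_indices N. SUP x. (1 + norm x) ^ N * cmod (partials bs \<phi> x)))"

definition dist_fourier :: "'a::euclidean_space functional \<Rightarrow> 'a functional" where
  "dist_fourier T = (\<lambda>\<phi>. T (fourier \<phi>))"

text \<open>The Fourier transform of \<open>T\<close> is the function \<open>g\<close> (which is then unique up to null sets).\<close>

definition fourier_is_function :: "'a::euclidean_space functional \<Rightarrow> ('a \<Rightarrow> complex) \<Rightarrow> bool" where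
  "fourier_is_function T g \<longleftrightarrow> g \<in> borel_measurable borel \<and>
     (\<forall>\<phi>\<in>schwartz_functions. integrable lborel (\<lambda>\<xi>. g \<xi> * \<phi> \<xi>) \<and>
        dist_fourier T \<phi> = regular_dist g \<phi>)"

definition sobolev_weighted_sq :: "real \<Rightarrow> ('a::euclidean_space \<Rightarrow> complex) \<Rightarrow> 'a \<Rightarrow> real" where
  "sobolev_weighted_sq s g \<xi> = (1 + (norm \<xi>)\<^sup>2) powr s * (cmod (g \<xi>))\<^sup>2"

definition sobolev_space :: "real \<Rightarrow> 'a::euclidean_space functional set" where
  "sobolev_space s = {T. tempered_distribution T \<and>
     (\<exists>g. fourier_is_function T g \<and> integrable lborel (sobolev_weighted_sq s g))}"

definition sobolev_norm :: "real \<Rightarrow> 'a::euclidean_space functional \<Rightarrow> real" where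
  "sobolev_norm s T =
     sqrt (LINT \<xi>|lborel. sobolev_weighted_sq s (SOME g. fourier_is_function T g) \<xi>)"

definition dist_in_sobolev :: "real \<Rightarrow> 'a::euclidean_space functional \<Rightarrow> bool" where
  "dist_in_sobolev s T \<longleftrightarrow> (\<exists>S\<in>sobolev_space s. dist_eq UNIV T S)"

definition fourier_multiplier ::
  "('a::euclidean_space \<Rightarrow> real) \<Rightarrow> ('a \<Rightarrow> complex) \<Rightarrow> 'a \<Rightarrow> complex" where
  "fourier_multiplier P \<phi> = inv_fourier (\<lambda>\<xi>. complex_of_real (P \<xi>) * fourier \<phi> \<xi>)"

definition spacetime :: "(real \<times> 'a::euclidean_space) set" where
  "spacetime = {p. 0 < fst p}"

definition dist_time_deriv :: "(real \<times> 'a::euclidean_space) functional \<Rightarrow> (real \<times> 'a) functional" where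
  "dist_time_deriv T = (\<lambda>\<phi>. - T (partials [(1, 0)] \<phi>))"

text \<open>
  \<open>P(D)\<close> acting in the space variable, by duality: the transpose of \<open>P(D)\<close> is \<open>P(-D)\<close>.
  This is meaningful on all distributions when \<open>P\<close> is a polynomial, since then \<open>P(-D)\<close>
  preserves test functions; for general \<open>P\<close> it need not be.
\<close>

definition dist_space_multiplier ::
  "('a::euclidean_space \<Rightarrow> real) \<Rightarrow> (real \<times> 'a) functional \<Rightarrow> (real \<times> 'a) functional" where
  "dist_space_multiplier P T =
     (\<lambda>\<phi>. T (\<lambda>(t, x). fourier_multiplier (\<lambda>\<xi>. P (- \<xi>)) (\<lambda>y. \<phi> (t, y)) x))"

definition nonlinearity :: "real \<Rightarrow> complex \<Rightarrow> complex" where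
  "nonlinearity \<sigma> z = complex_of_real (cmod z powr (2 * \<sigma>)) * z"

text \<open>
  \<open>u \<in> C(\<real>\<^sub>+; D')\<close>, where \<open>D'\<close> carries the weak-star topology. On a half-line this is the same
  as continuity for the strong topology, because both have the same convergent sequences.
  Values of \<open>u\<close> at negative times are irrelevant.
\<close>

definition continuous_curve_in_distributions :: "(real \<Rightarrow> 'a::euclidean_space functional) \<Rightarrow> bool" where
  "continuous_curve_in_distributions u \<longleftrightarrow>
     (\<forall>t\<ge>0. distribution UNIV (u t)) \<and>
     (\<forall>\<phi>\<in>test_functions UNIV. continuous_on {0..} (\<lambda>t. u t \<phi>))"

text \<open>
  For the power nonlinearity of \<open>u\<close> to be defined, \<open>u\<close> must be given by a function \<open>U\<close> on
  spacetime for which \<open>U\<close> and its nonlinearity are locally integrable; the equation then holds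
  in the sense of distributions on spacetime. No further regularity is required.
\<close>

definition solves_cauchy_problem ::
  "('a::euclidean_space \<Rightarrow> real) \<Rightarrow> real \<Rightarrow> real \<Rightarrow> 'a functional \<Rightarrow> (real \<Rightarrow> 'a functional) \<Rightarrow> bool" where
  "solves_cauchy_problem P lam \<sigma> u0 u \<longleftrightarrow>
     continuous_curve_in_distributions u \<and>
     dist_eq UNIV (u 0) u0 \<and>
     (\<exists>U :: real \<times> 'a \<Rightarrow> complex.
        locally_integrable spacetime U \<and>
        locally_integrable spacetime (\<lambda>p. nonlinearity \<sigma> (U p)) \<and>
        (AE t in lborel. 0 < t \<longrightarrow>
           locally_integrable UNIV (\<lambda>x. U (t, x)) \<and>
           dist_eq UNIV (u t) (regular_dist (\<lambda>x. U (t, x)))) \<and>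
        dist_eq spacetime
          (\<lambda>\<phi>. \<i> * dist_time_deriv (regular_dist U) \<phi> + dist_space_multiplier P (regular_dist U) \<phi>)
          (\<lambda>\<phi>. complex_of_real lam * regular_dist (\<lambda>p. nonlinearity \<sigma> (U p)) \<phi>))"

end

theory Submission
  imports Defs "HOL-Probability.Characteristic_Functions" "HOL-Probability.Sinc_Integral"
begin

text \<open>
  Along the characteristics of the transport operator the equation is an ordinary differential
  equation which preserves the modulus, so that with \<open>P(\<xi>) = a + c \<bullet> \<xi>\<close> the solution is
  \<open>u(t, x) = v exp (i t (a - \<lambda> |v|\<^bsup>2\<sigma>\<^esup>))\<close>, where \<open>v = u\<^sub>0(x + t c)\<close>. A distributional solution is
  given on almost every characteristic by this flow, because there its weak time derivative is
  locally integrable; continuity in time then identifies the initial value.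

  The space \<open>H\<^bsup>d/2\<^esup>\<close> just fails to embed into the bounded functions: averaging dilates of a bump at
  separated scales gives plateaus of height \<open>1\<close> and arbitrarily small norm. The datum \<open>u\<^sub>0\<close> is a
  locally finite sum, over far apart places, of plateaus of heights \<open>M\<^sub>k\<close> tending to infinity, each
  carrying a rescaled copy of a fixed bump \<open>\<beta>\<close> with amplitude \<open>a\<^sub>k = (k + 1) M\<^sub>k\<^bsup>-2\<sigma>\<^esup>\<close>. The
  rotation of the phase at time \<open>t\<close> turns this perturbation into one of amplitude about
  \<open>2 \<sigma> |\<lambda>| t M\<^sub>k\<^bsup>2\<sigma>\<^esup> a\<^sub>k\<close>, which is of order \<open>k\<close>. Taking \<open>\<beta>\<close> with enough vanishing moments, its
  rescaled copies are bounded in \<open>H\<^bsup>-d/2\<^esup>\<close>, and pairing \<open>u(t)\<close> with them shows that \<open>u(t)\<close> is not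
  in \<open>H\<^bsup>d/2\<^esup>\<close>.
\<close>

section \<open>Smooth functions and test functions\<close>

text \<open>Uniqueness is claimed among solutions that are only locally integrable, so every
  statement on a characteristic holds off a null set, and this set depends on the test function in
  time. Hence only countably many of these functions are used, with derivatives given by bumps of
  rational endpoints corrected to mean zero; they still determine a function up to a constant. For
  the loss of regularity, the width of a plateau of small norm cannot be prescribed: it comes out of
  the averaging and depends on \<open>M k\<close>. All estimates for the bump are therefore uniform
  in its scale \<open>r k\<close>, which is possible in the critical space because energies do not
  grow under contraction. Two features of \<beta> do the detection: its mean is zero, so the height
  \<open>M k\<close> drops out of the pairing, and the integral of its square is positive, so the
  linear term of the phase survives. The bound \<open>M k \<ge> (real k + 1)\<^sup>2\<close> keeps
  the quadratic remainder of the phase, multiplied by \<open>M k\<close>, bounded.\<close>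

abbreviation pderivative :: "('a::euclidean_space \<Rightarrow> complex) \<Rightarrow> 'a \<Rightarrow> 'a \<Rightarrow> complex" where
  "pderivative f b \<equiv> \<lambda>x. frechet_derivative f (at x) b"

text \<open>\<open>partials\<close> puts the newest derivative outermost, whereas here the innermost
  one is peeled off first. That turns closure under sums, products and affine maps into inductions
  on the order with the function left arbitrary. \<open>Ck n\<close> asks for no continuity of the
  top derivatives; over all \<open>n\<close> this still amounts to smoothness.\<close>

fun Ck :: "nat \<Rightarrow> ('a::euclidean_space \<Rightarrow> complex) \<Rightarrow> bool" where
  "Ck 0 f \<longleftrightarrow> True"
| "Ck (Suc n) f \<longleftrightarrow> (\<forall>x. f differentiable (at x)) \<and> (\<forall>b\<in>Basis. Ck n (pderivative f b))"

lemma partials_snoc: "partials (bs @ [b]) f = partials bs (pderivative f b)"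
  by (induction bs) auto

lemma Ck_imp_partials_differentiable:
  "Ck (Suc n) f \<Longrightarrow> set bs \<subseteq> Basis \<Longrightarrow> length bs \<le> n \<Longrightarrow> partials bs f differentiable (at x)"
proof (induction bs arbitrary: n f rule: rev_induct)
  case (snoc b bs)
  then obtain m where n: "n = Suc m" by (cases n) auto
  show ?case
    unfolding partials_snoc by (rule snoc.IH[of m]) (use snoc.prems n in auto)
qed auto

lemma smooth_iff_Ck: "smooth f \<longleftrightarrow> (\<forall>n. Ck n f)"
proof
  assume "smooth f"
  then show "\<forall>n. Ck n f"
  proof (intro allI)
    fix n assume "smooth f" then show "Ck n f"
    proof (induction n arbitrary: f)
      case (Suc n)
      have "f differentiable (at x)" for x
        using Suc.prems unfolding smooth_def by (metis empty_iff list.set(1) partials.simps(1) subsetI)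
      moreover have "smooth (pderivative f b)" if "b \<in> Basis" for b
        unfolding smooth_def
      proof (intro allI impI)
        fix bs x assume "set bs \<subseteq> (Basis :: 'a set)"
        then have "set (bs @ [b]) \<subseteq> Basis" using that by auto
        then show "partials bs (pderivative f b) differentiable at x"
          using Suc.prems unfolding smooth_def partials_snoc[symmetric] by blast
      qed
      ultimately show ?case using Suc.IH by auto
    qed auto
  qed
next
  assume "\<forall>n. Ck n f"
  then show "smooth f"
    unfolding smooth_def using Ck_imp_partials_differentiable by blast
qed

lemma Ck_SucI:
  assumes "\<And>x. (f has_derivative f' x) (at x)" "\<And>b. b \<in> Basis \<Longrightarrow> Ck n (\<lambda>x. f' x b)"
  shows "Ck (Suc n) f"
proof -
  have "frechet_derivative f (at x) = f' x" for x
    using frechet_derivative_at[OF assms(1)] by simp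
  then show ?thesis using assms by (auto simp: differentiable_def)
qed

lemma Ck_SucD: "Ck (Suc n) f \<Longrightarrow> (f has_derivative frechet_derivative f (at x)) (at x)"
  by (simp add: frechet_derivative_works)

lemma Ck_mono: "Ck (Suc n) f \<Longrightarrow> Ck n f"
  by (induction n arbitrary: f) auto

lemma Ck_const [simp]: "Ck n (\<lambda>x. c)"
  by (induction n arbitrary: c) (auto simp: frechet_derivative_const)

lemma Ck_add: "Ck n f \<Longrightarrow> Ck n g \<Longrightarrow> Ck n (\<lambda>x. f x + g x)"
proof (induction n arbitrary: f g)
  case (Suc n)
  show ?case
    by (rule Ck_SucI[OF has_derivative_add[OF Ck_SucD[OF Suc.prems(1)] Ck_SucD[OF Suc.prems(2)]]])
       (use Suc in auto)
qed auto

lemma Ck_mult: "Ck n f \<Longrightarrow> Ck n g \<Longrightarrow> Ck n (\<lambda>x. f x * g x)"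
proof (induction n arbitrary: f g)
  case (Suc n)
  have "Ck n (\<lambda>x. f x * pderivative g b x + pderivative f b x * g x)" if "b \<in> Basis" for b
    using Suc.prems that by (intro Ck_add Suc.IH) (auto intro: Ck_mono simp del: Ck.simps simp: Ck.simps(2)[of n])
  then show ?case
    by (rule Ck_SucI[OF has_derivative_mult[OF Ck_SucD[OF Suc.prems(1)] Ck_SucD[OF Suc.prems(2)]]])
qed auto

lemma Ck_sum: "(\<And>i. i \<in> I \<Longrightarrow> Ck n (f i)) \<Longrightarrow> Ck n (\<lambda>x. \<Sum>i\<in>I. f i x)"
  by (induction I rule: infinite_finite_induct) (auto intro: Ck_add)

lemma Ck_inverse:
  assumes "Ck n f" "\<And>x. f x \<noteq> 0"
  shows "Ck n (\<lambda>x. inverse (f x))"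
  using assms(1)
proof (induction n)
  case (Suc n)
  have d: "((\<lambda>x. inverse (f x)) has_derivative (\<lambda>h. - (inverse (f x) * frechet_derivative f (at x) h * inverse (f x)))) (at x)" for x
    by (rule Deriv.has_derivative_inverse[OF _ Ck_SucD[OF Suc.prems]]) (use assms in auto)
  \<comment> \<open>The derivative of the inverse contains the inverse itself, but at one order
    less.\<close>
  have "Ck n (\<lambda>x. (-1) * (inverse (f x) * frechet_derivative f (at x) b * inverse (f x)))" if "b \<in> Basis" for b
    using Suc.prems Suc.IH[OF Ck_mono[OF Suc.prems]] that by (intro Ck_mult) auto
  then show ?case by (intro Ck_SucI[OF d]) auto
qed auto

lemma linear_sum_Basis: "linear L \<Longrightarrow> L v = (\<Sum>c\<in>Basis. (v \<bullet> c) *\<^sub>R L c)"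
proof -
  assume "linear L"
  then have "L (\<Sum>c\<in>Basis. (v \<bullet> c) *\<^sub>R c) = (\<Sum>c\<in>Basis. (v \<bullet> c) *\<^sub>R L c)"
    by (simp add: linear_sum linear_scale)
  then show ?thesis by (simp add: euclidean_representation)
qed

lemma frechet_derivative_sum_Basis:
  assumes "f differentiable (at x)"
  shows "frechet_derivative f (at x) v = (\<Sum>c\<in>Basis. of_real (v \<bullet> c) * frechet_derivative f (at x) c)"
  using linear_sum_Basis[OF linear_frechet_derivative[OF assms], of v] by (simp add: scaleR_conv_of_real)

lemma Ck_affine:
  fixes f :: "'b::euclidean_space \<Rightarrow> complex" and L :: "'a::euclidean_space \<Rightarrow> 'b"
  assumes "Ck n f" and L: "linear L"
  shows "Ck n (\<lambda>x. f (p + L x))"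
  using assms(1)
proof (induction n arbitrary: f)
  case (Suc n)
  have "((\<lambda>x. p + L x) has_derivative L) (at x)" for x
    using L by (auto intro!: derivative_eq_intros linear_imp_has_derivative)
  from has_derivative_compose[OF this Ck_SucD[OF Suc.prems]]
  have d: "((\<lambda>x. f (p + L x)) has_derivative (\<lambda>h. frechet_derivative f (at (p + L x)) (L h))) (at x)" for x .
  show ?case
  proof (rule Ck_SucI[OF d])
    fix b :: 'a assume "b \<in> Basis"
    \<comment> \<open>\<open>L b\<close> need not be a basis vector, while \<open>Ck\<close> speaks
      of basis directions only.\<close>
    have "(\<lambda>x. frechet_derivative f (at (p + L x)) (L b)) =
       (\<lambda>x. \<Sum>c\<in>Basis. of_real (L b \<bullet> c) * frechet_derivative f (at (p + L x)) c)"
      using Suc.prems by (intro ext frechet_derivative_sum_Basis) auto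
    moreover have "Ck n (\<lambda>x. \<Sum>c\<in>Basis. of_real (L b \<bullet> c) * frechet_derivative f (at (p + L x)) c)"
      using Suc by (auto intro!: Ck_sum Ck_mult)
    ultimately show "Ck n (\<lambda>x. frechet_derivative f (at (p + L x)) (L b))" by simp
  qed
qed auto

section \<open>Closure properties and derivatives of smooth functions\<close>

lemma smooth_const [simp]: "smooth (\<lambda>x. c)"
  and smooth_add: "smooth f \<Longrightarrow> smooth g \<Longrightarrow> smooth (\<lambda>x. f x + g x)"
  and smooth_mult: "smooth f \<Longrightarrow> smooth g \<Longrightarrow> smooth (\<lambda>x. f x * g x)"
  and smooth_sum: "(\<And>i. i \<in> I \<Longrightarrow> smooth (F i)) \<Longrightarrow> smooth (\<lambda>x. \<Sum>i\<in>I. F i x)"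
  and smooth_inverse: "smooth f \<Longrightarrow> (\<And>x. f x \<noteq> 0) \<Longrightarrow> smooth (\<lambda>x. inverse (f x))"
  unfolding smooth_iff_Ck by (auto intro: Ck_add Ck_mult Ck_inverse Ck_sum)

lemma smooth_prod: "(\<And>i. i \<in> I \<Longrightarrow> smooth (F i)) \<Longrightarrow> smooth (\<lambda>x. \<Prod>i\<in>I. F i x)"
  by (induction I rule: infinite_finite_induct) (auto intro: smooth_mult)

lemma smooth_affine: "smooth f \<Longrightarrow> linear L \<Longrightarrow> smooth (\<lambda>x. f (p + L x))"
  unfolding smooth_iff_Ck by (auto intro: Ck_affine)

lemma smooth_linear: "smooth f \<Longrightarrow> linear L \<Longrightarrow> smooth (\<lambda>x. f (L x))"
  using smooth_affine[of f L 0] by simp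

lemma smooth_derivI:
  assumes "\<And>x. (f has_derivative f' x) (at x)" "\<And>b. b \<in> Basis \<Longrightarrow> smooth (\<lambda>x. f' x b)"
  shows "smooth f"
  unfolding smooth_iff_Ck
proof
  fix n show "Ck n f"
    by (cases n) (use assms smooth_iff_Ck in \<open>auto intro!: Ck_SucI simp del: Ck.simps(2)\<close>)
qed

lemma smooth_differentiable: "smooth f \<Longrightarrow> f differentiable (at x)"
  unfolding smooth_iff_Ck by (metis Ck.simps(2))

lemma smooth_has_derivative: "smooth f \<Longrightarrow> (f has_derivative frechet_derivative f (at x)) (at x)"
  using smooth_differentiable frechet_derivative_works by blast

lemma smooth_continuous: "smooth f \<Longrightarrow> continuous_on S f"
  by (meson continuous_at_imp_continuous_on differentiable_imp_continuous_within smooth_differentiable)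

lemma smooth_measurable: "smooth f \<Longrightarrow> f \<in> borel_measurable borel"
  by (simp add: borel_measurable_continuous_onI smooth_continuous)

lemma smooth_pderivative:
  assumes "smooth f" shows "smooth (pderivative f v)"
proof -
  have "smooth (pderivative f b)" if "b \<in> Basis" for b
    using assms that unfolding smooth_iff_Ck by (metis Ck.simps(2))
  then have "smooth (\<lambda>x. \<Sum>c\<in>Basis. of_real (v \<bullet> c) * frechet_derivative f (at x) c)"
    by (intro smooth_sum smooth_mult smooth_const)
  moreover have "pderivative f v = (\<lambda>x. \<Sum>c\<in>Basis. of_real (v \<bullet> c) * frechet_derivative f (at x) c)"
    by (intro ext frechet_derivative_sum_Basis smooth_differentiable assms)
  ultimately show ?thesis by simp
qed

lemma smooth_of_real: "smooth (of_real :: real \<Rightarrow> complex)"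
  by (rule smooth_derivI[where f' = "\<lambda>_. of_real"])
     (auto intro!: linear_imp_has_derivative linear_of_real)

lemma smooth_inner: "smooth (\<lambda>x. complex_of_real (x \<bullet> v))"
  by (rule smooth_linear[OF smooth_of_real]) (auto intro!: linearI simp: inner_simps)

lemma vector_derivative_pderivative:
  fixes f :: "real \<Rightarrow> complex"
  assumes "\<And>x. (f has_vector_derivative f' x) (at x)"
  shows "pderivative f 1 = f'"
proof
  fix x
  have "frechet_derivative f (at x) = (\<lambda>h. h *\<^sub>R f' x)"
    using frechet_derivative_at[OF assms[of x, unfolded has_vector_derivative_def]] by simp
  then show "frechet_derivative f (at x) 1 = f' x" by simp
qed

lemma smooth_pderivative_has_vector_derivative:
  fixes f :: "real \<Rightarrow> complex"
  assumes "smooth f"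
  shows "(f has_vector_derivative pderivative f 1 x) (at x)"
proof -
  have "frechet_derivative f (at x) h = h *\<^sub>R frechet_derivative f (at x) 1" for h
    using linear_scale[OF linear_frechet_derivative[OF smooth_differentiable[OF assms]], of x h 1] by simp
  then have eq: "frechet_derivative f (at x) = (\<lambda>h. h *\<^sub>R frechet_derivative f (at x) 1)"
    by (rule ext)
  show ?thesis
    unfolding has_vector_derivative_def eq[symmetric] by (rule smooth_has_derivative[OF assms])
qed

lemma smooth_vector_derivI:
  fixes f :: "real \<Rightarrow> complex"
  assumes "\<And>x. (f has_vector_derivative f' x) (at x)" "smooth f'"
  shows "smooth f"
  by (rule smooth_derivI[OF assms(1)[unfolded has_vector_derivative_def]]) (use assms in auto)

section \<open>The flat exponential and its smoothness\<close>

definition flat_exp :: "nat \<Rightarrow> real \<Rightarrow> real" where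
  "flat_exp k x = (if 0 < x then exp (- 1 / x) / x ^ k else 0)"

lemma flat_exp_at_right: "((\<lambda>x. exp (- 1 / x) / x ^ k) \<longlongrightarrow> 0) (at_right (0::real))"
proof -
  have "((\<lambda>x::real. (inverse x) ^ k / exp (inverse x)) \<longlongrightarrow> 0) (at_right 0)"
    by (rule filterlim_compose[OF tendsto_power_div_exp_0 filterlim_inverse_at_top_right])
  then show ?thesis
    by (rule Lim_transform_eventually)
       (auto simp: eventually_at_filter field_simps exp_minus power_inverse inverse_eq_divide power_one_over)
qed

text \<open>The powers of \<open>x\<close> in the denominator close the family under differentiation
  up to linear combinations, so smoothness of all members follows by a single induction on the
  order.\<close>

lemma flat_exp_DERIV:
  "(flat_exp k has_field_derivative flat_exp (k + 2) x - of_nat k * flat_exp (k + 1) x) (at x)"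
proof -
  consider "x > 0" | "x < 0" | "x = 0" by linarith
  then show ?thesis
  proof cases
    case 1
    have p: "real k * x ^ (k - 1) = real k * x ^ k / x" using 1 by (cases k) auto
    have "((\<lambda>x. exp (- 1 / x) / x ^ k) has_field_derivative
       (exp (- 1 / x) * (1 / x^2) * x ^ k - exp (- 1 / x) * (real k * x ^ (k - 1))) / (x ^ k * x ^ k)) (at x)"
      using 1 by (auto intro!: derivative_eq_intros simp: power2_eq_square)
    then have "((\<lambda>x. exp (- 1 / x) / x ^ k) has_field_derivative flat_exp (k + 2) x - of_nat k * flat_exp (k + 1) x) (at x)"
      by (rule DERIV_cong) (unfold p, use 1 in \<open>simp add: flat_exp_def field_simps power2_eq_square\<close>)
    then show ?thesis
      by (rule has_field_derivative_transform_within_open[where S = "{0<..}"]) (use 1 in \<open>auto simp: flat_exp_def\<close>)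
  next
    case 2
    have "((\<lambda>x. 0) has_field_derivative flat_exp (k + 2) x - of_nat k * flat_exp (k + 1) x) (at x)"
      using 2 by (auto simp: flat_exp_def)
    then show ?thesis
      by (rule has_field_derivative_transform_within_open[where S = "{..<0}"]) (use 2 in \<open>auto simp: flat_exp_def\<close>)
  next
    case 3
    have "((\<lambda>h. (flat_exp k (0 + h) - flat_exp k 0) / h) \<longlongrightarrow> 0) (at 0)"
    proof (rule filterlim_split_at)
      show "((\<lambda>h. (flat_exp k (0 + h) - flat_exp k 0) / h) \<longlongrightarrow> 0) (at_left 0)"
        by (rule Lim_transform_eventually[OF tendsto_const]) (auto simp: eventually_at_filter flat_exp_def)
      \<comment> \<open>To the right of 0 the difference quotient of \<open>flat_exp k\<close> is
        \<open>flat_exp (Suc k)\<close>.\<close>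
      show "((\<lambda>h. (flat_exp k (0 + h) - flat_exp k 0) / h) \<longlongrightarrow> 0) (at_right 0)"
        by (rule Lim_transform_eventually[OF flat_exp_at_right[of "Suc k"]])
           (auto simp: eventually_at_filter flat_exp_def)
    qed
    then show ?thesis unfolding 3 DERIV_def by (simp add: flat_exp_def)
  qed
qed

lemma smooth_flat_exp: "smooth (\<lambda>x. complex_of_real (flat_exp k x))"
proof -
  have "Ck n (\<lambda>x. complex_of_real (flat_exp k x))" for n
  proof (induction n arbitrary: k)
    case (Suc n)
    have "((\<lambda>x. complex_of_real (flat_exp k x)) has_vector_derivative
      of_real (flat_exp (k + 2) x - of_nat k * flat_exp (k + 1) x)) (at x)" for x
      using flat_exp_DERIV by (intro has_vector_derivative_of_real)
        (simp add: has_real_derivative_iff_has_vector_derivative)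
    note d = this[unfolded has_vector_derivative_def]
    have "Ck n (\<lambda>x. complex_of_real (flat_exp (k + 2) x) + of_real (- of_nat k) * of_real (flat_exp (k + 1) x))"
      by (intro Ck_add Ck_mult Suc Ck_const)
    then show ?case by (intro Ck_SucI[OF d]) auto
  qed auto
  then show ?thesis by (simp add: smooth_iff_Ck)
qed

lemma flat_exp_nonneg: "0 \<le> flat_exp k x" and flat_exp_zero: "x \<le> 0 \<Longrightarrow> flat_exp k x = 0"
  and flat_exp_pos: "0 < x \<Longrightarrow> 0 < flat_exp k x" and flat_exp_le_1: "flat_exp 0 x \<le> 1"
  by (auto simp: flat_exp_def)

text \<open>Steepening the variable turns the flat function into the indicator of the positive
  half-line, the one-dimensional ingredient of \<open>box_bump\<close>.\<close>

lemma flat_exp_scaled_tendsto: "(\<lambda>n. flat_exp 0 (real n * x)) \<longlonglongrightarrow> (if 0 < x then 1 else 0)"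
proof (cases "0 < x")
  case True
  have "(\<lambda>n. exp (- inverse x * inverse (real n))) \<longlonglongrightarrow> exp (- inverse x * 0)"
    by (intro tendsto_intros lim_inverse_n)
  then have "(\<lambda>n. flat_exp 0 (real n * x)) \<longlonglongrightarrow> exp (- inverse x * 0)"
    by (rule Lim_transform_eventually)
       (use True in \<open>auto simp: flat_exp_def eventually_at_top_linorder field_simps intro!: exI[of _ 1]\<close>)
  then show ?thesis using True by simp
qed (simp add: flat_exp_zero mult_nonneg_nonpos)

section \<open>Supports and test functions\<close>

lemma supp_subset: "closed K \<Longrightarrow> (\<And>x. x \<notin> K \<Longrightarrow> f x = 0) \<Longrightarrow> supp f \<subseteq> K"
  unfolding supp_def by (rule closure_minimal) auto

lemma supp_zero: "x \<notin> supp f \<Longrightarrow> f x = 0"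
  using closure_subset[of "{x. f x \<noteq> 0}"] unfolding supp_def by blast

lemma test_functionsI:
  assumes "smooth f" "compact K" "K \<subseteq> \<Omega>" "\<And>x. x \<notin> K \<Longrightarrow> f x = 0"
  shows "f \<in> test_functions \<Omega>"
proof -
  have "supp f \<subseteq> K" using assms by (intro supp_subset compact_imp_closed) auto
  moreover have "closed (supp f)" unfolding supp_def by simp
  ultimately show ?thesis
    using assms compact_Int_closed[of K "supp f"] unfolding test_functions_def
    by (simp add: inf.absorb2 subset_trans)
qed

lemma test_functionsE:
  assumes "f \<in> test_functions \<Omega>"
  obtains K where "smooth f" "compact K" "K \<subseteq> \<Omega>" "\<And>x. x \<notin> K \<Longrightarrow> f x = 0"
  by (rule that[of "supp f"]) (use assms supp_zero in \<open>auto simp: test_functions_def\<close>)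

lemma test_functions_smooth: "f \<in> test_functions \<Omega> \<Longrightarrow> smooth f"
  by (auto simp: test_functions_def)

lemma test_functions_mono: "A \<subseteq> B \<Longrightarrow> f \<in> test_functions A \<Longrightarrow> f \<in> test_functions B"
  by (auto simp: test_functions_def)

lemma test_functions_mult:
  assumes "f \<in> test_functions \<Omega>" "smooth g" shows "(\<lambda>x. g x * f x) \<in> test_functions \<Omega>"
proof -
  obtain K where "smooth f" "compact K" "K \<subseteq> \<Omega>" "\<And>x. x \<notin> K \<Longrightarrow> f x = 0"
    using test_functionsE[OF assms(1)] by metis
  then show ?thesis by (intro test_functionsI[where K = K]) (auto intro: smooth_mult assms)
qed

lemma test_functions_add:
  assumes "f \<in> test_functions \<Omega>" "g \<in> test_functions \<Omega>"
  shows "(\<lambda>x. f x + g x) \<in> test_functions \<Omega>"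
proof -
  obtain K L where "compact K" "K \<subseteq> \<Omega>" "\<And>x. x \<notin> K \<Longrightarrow> f x = 0"
    "compact L" "L \<subseteq> \<Omega>" "\<And>x. x \<notin> L \<Longrightarrow> g x = 0" "smooth f" "smooth g"
    using test_functionsE[OF assms(1)] test_functionsE[OF assms(2)] by metis
  then show ?thesis by (intro test_functionsI[where K = "K \<union> L"]) (auto intro: smooth_add)
qed

lemma pderivative_zero_outside:
  assumes "closed K" "\<And>x. x \<notin> K \<Longrightarrow> f x = 0" "x \<notin> K"
  shows "frechet_derivative f (at x) v = 0"
proof -
  have "((\<lambda>x. 0) has_derivative (\<lambda>h. 0)) (at x)" by simp
  from this have "(f has_derivative (\<lambda>h. 0)) (at x)"
    by (rule has_derivative_transform_within_open[of _ _ _ _ "- K"]) (use assms in auto)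
  from frechet_derivative_at[OF this] show ?thesis by metis
qed

lemma test_functions_pderivative:
  assumes "f \<in> test_functions \<Omega>" shows "pderivative f v \<in> test_functions \<Omega>"
proof -
  obtain K where "smooth f" "compact K" "K \<subseteq> \<Omega>" "\<And>x. x \<notin> K \<Longrightarrow> f x = 0"
    using test_functionsE[OF assms(1)] by metis
  then show ?thesis
    by (intro test_functionsI[where K = K] smooth_pderivative pderivative_zero_outside[of K])
       (auto simp: compact_imp_closed)
qed

lemma partials_test_functions:
  "f \<in> test_functions \<Omega> \<Longrightarrow> partials bs f \<in> test_functions \<Omega>"
  by (induction bs) (auto intro: test_functions_pderivative)

lemma test_functions_bounded:
  assumes "f \<in> test_functions \<Omega>" obtains B where "B > 0" "\<And>x. cmod (f x) \<le> B"
proof -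
  obtain K where K: "smooth f" "compact K" "K \<subseteq> \<Omega>" "\<And>x. x \<notin> K \<Longrightarrow> f x = 0"
    using test_functionsE[OF assms(1)] by metis
  have "compact (f ` K)" using K smooth_continuous compact_continuous_image by blast
  then obtain B where B: "B > 0" "\<And>y. y \<in> f ` K \<Longrightarrow> norm y \<le> B"
    using compact_imp_bounded bounded_pos by metis
  show ?thesis
    by (rule that[of B]) (use B K in \<open>auto, metis image_eqI norm_zero order_less_imp_le\<close>)
qed

lemma test_functions_affine:
  fixes L :: "'a::euclidean_space \<Rightarrow> 'a"
  assumes f: "f \<in> test_functions UNIV" and c: "c \<noteq> 0"
  shows "(\<lambda>x. f (p + c *\<^sub>R x)) \<in> test_functions UNIV"
proof -
  obtain K where K: "smooth f" "compact K" "\<And>x. x \<notin> K \<Longrightarrow> f x = 0"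
    using test_functionsE[OF f] by metis
  show ?thesis
  proof (rule test_functionsI[where K = "(\<lambda>y. inverse c *\<^sub>R (y - p)) ` K"])
    show "smooth (\<lambda>x. f (p + c *\<^sub>R x))"
      by (rule smooth_affine[OF K(1)]) simp
    show "compact ((\<lambda>y. inverse c *\<^sub>R (y - p)) ` K)"
      by (intro compact_continuous_image continuous_intros K)
    fix x assume "x \<notin> (\<lambda>y. inverse c *\<^sub>R (y - p)) ` K"
    then have "p + c *\<^sub>R x \<notin> K" using c by force
    then show "f (p + c *\<^sub>R x) = 0" using K by auto
  qed auto
qed

section \<open>Bumps on boxes and smooth plateaus\<close>

definition box_bump :: "nat \<Rightarrow> 'a::euclidean_space \<Rightarrow> 'a \<Rightarrow> 'a \<Rightarrow> real" where
  "box_bump n a b x =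
     (\<Prod>i\<in>Basis. flat_exp 0 (real n * (x \<bullet> i - a \<bullet> i)) * flat_exp 0 (real n * (b \<bullet> i - x \<bullet> i)))"

lemma smooth_flat_exp_affine: "smooth (\<lambda>x. complex_of_real (flat_exp k (p + x \<bullet> v)))"
  by (rule smooth_affine[OF smooth_flat_exp]) (auto intro!: linearI simp: inner_simps)

lemma smooth_box_bump: "smooth (\<lambda>x. complex_of_real (box_bump n a b x))"
proof -
  have "smooth (\<lambda>x. \<Prod>i\<in>Basis. complex_of_real (flat_exp 0 (- real n * (a \<bullet> i) + x \<bullet> (real n *\<^sub>R i))) *
           complex_of_real (flat_exp 0 (real n * (b \<bullet> i) + x \<bullet> (- real n *\<^sub>R i))))"
    by (intro smooth_prod smooth_mult smooth_flat_exp_affine)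
  then show ?thesis by (simp add: box_bump_def algebra_simps of_real_prod)
qed

lemma box_bump_zero: "x \<notin> box a b \<Longrightarrow> box_bump n a b x = 0"
proof -
  assume "x \<notin> box a b"
  then obtain i where "i \<in> Basis" "x \<bullet> i - a \<bullet> i \<le> 0 \<or> b \<bullet> i - x \<bullet> i \<le> 0"
    by (force simp: mem_box not_less)
  then show ?thesis
    unfolding box_bump_def by (intro prod_zero) (auto simp: flat_exp_zero mult_nonneg_nonpos intro!: bexI[of _ i])
qed

lemma box_bump_nonneg: "0 \<le> box_bump n a b x"
  unfolding box_bump_def by (intro prod_nonneg mult_nonneg_nonneg flat_exp_nonneg ballI)

lemma box_bump_le_1: "box_bump n a b x \<le> 1"
  unfolding box_bump_def by (intro prod_le_1 conjI mult_nonneg_nonneg mult_le_one flat_exp_nonneg flat_exp_le_1)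

lemma box_bump_pos: "x \<in> box a b \<Longrightarrow> 0 < n \<Longrightarrow> 0 < box_bump n a b x"
  unfolding box_bump_def mem_box by (intro prod_pos mult_pos_pos flat_exp_pos ballI) auto

text \<open>Together with the uniform bound \<open>box_bump_le_1\<close> this makes integrals over
  boxes limits of pairings with test functions.\<close>

lemma box_bump_tendsto: "(\<lambda>n. box_bump n a b x) \<longlonglongrightarrow> indicator (box a b) x"
proof (cases "x \<in> box a b")
  case True
  have "(\<Prod>i\<in>Basis. (if 0 < x \<bullet> i - a \<bullet> i then 1 else 0) * (if 0 < b \<bullet> i - x \<bullet> i then 1 else 0)) = (1::real)"
    using True by (intro prod.neutral) (auto simp: mem_box)
  moreover have "(\<lambda>n. box_bump n a b x) \<longlonglongrightarrow>
    (\<Prod>i\<in>Basis. (if 0 < x \<bullet> i - a \<bullet> i then 1 else 0) * (if 0 < b \<bullet> i - x \<bullet> i then 1 else 0))"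
    unfolding box_bump_def by (intro tendsto_prod tendsto_mult flat_exp_scaled_tendsto)
  ultimately show ?thesis using True by simp
qed (simp add: box_bump_zero)

lemma test_functions_box_bump:
  "cbox a b \<subseteq> \<Omega> \<Longrightarrow> (\<lambda>x. complex_of_real (box_bump n a b x)) \<in> test_functions \<Omega>"
  by (rule test_functionsI[where K = "cbox a b"])
     (auto intro!: smooth_box_bump box_bump_zero dest: subsetD[OF box_subset_cbox])

text \<open>The usual smooth cut-off, equal to 1 up to 1 and to 0 from 2 on. The denominator is
  positive since \<open>2 - x\<close> and \<open>x - 1\<close> are never both non-positive.\<close>

definition plateau1 :: "real \<Rightarrow> real" where
  "plateau1 x = flat_exp 0 (2 - x) / (flat_exp 0 (2 - x) + flat_exp 0 (x - 1))"

definition plateau :: "'a::euclidean_space \<Rightarrow> real" where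
  "plateau x = (\<Prod>i\<in>Basis. plateau1 (x \<bullet> i) * plateau1 (- (x \<bullet> i)))"

lemma plateau1_denominator: "flat_exp 0 (2 - x) + flat_exp 0 (x - 1) > 0"
proof (cases "x < 2")
  case True
  then show ?thesis by (intro add_pos_nonneg flat_exp_pos flat_exp_nonneg) auto
next
  case False
  then show ?thesis by (intro add_nonneg_pos flat_exp_pos flat_exp_nonneg) auto
qed

lemma smooth_plateau1: "smooth (\<lambda>x. complex_of_real (plateau1 x))"
proof -
  have "smooth (\<lambda>x::real. complex_of_real (flat_exp 0 (2 + x \<bullet> (-1))) *
      inverse (complex_of_real (flat_exp 0 (2 + x \<bullet> (-1))) + complex_of_real (flat_exp 0 (- 1 + x \<bullet> 1))))"
  proof (intro smooth_mult smooth_inverse smooth_add smooth_flat_exp_affine)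
    fix x :: real
    have "complex_of_real (flat_exp 0 (2 - x) + flat_exp 0 (x - 1)) \<noteq> 0"
      unfolding of_real_eq_0_iff using plateau1_denominator[of x] by simp
    then show "complex_of_real (flat_exp 0 (2 + x \<bullet> - 1)) + complex_of_real (flat_exp 0 (- 1 + x \<bullet> 1)) \<noteq> 0"
      by simp
  qed
  then show ?thesis by (simp add: plateau1_def divide_inverse)
qed

lemma smooth_plateau: "smooth (\<lambda>x. complex_of_real (plateau x))"
proof -
  have "smooth (\<lambda>x. complex_of_real (plateau1 (x \<bullet> v)))" for v :: 'a
    by (rule smooth_linear[OF smooth_plateau1]) (auto intro!: linearI simp: inner_simps)
  then have "smooth (\<lambda>x::'a. \<Prod>i\<in>Basis. complex_of_real (plateau1 (x \<bullet> i)) * complex_of_real (plateau1 (x \<bullet> (- i))))"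
    by (intro smooth_prod smooth_mult)
  then show ?thesis by (simp add: plateau_def of_real_prod)
qed

lemma plateau_eq_1: "x \<in> cbox (- One) One \<Longrightarrow> plateau x = 1"
proof -
  have "plateau1 y = 1" if "y \<le> 1" for y
    using that plateau1_denominator[of y] by (simp add: plateau1_def flat_exp_zero)
  then show "x \<in> cbox (- One) One \<Longrightarrow> plateau x = 1"
    unfolding plateau_def by (intro prod.neutral) (force simp: mem_box)
qed

lemma plateau_eq_0:
  assumes "x \<notin> cbox (- 2 *\<^sub>R One) (2 *\<^sub>R One)" shows "plateau x = 0"
proof -
  obtain i where "i \<in> Basis" "x \<bullet> i \<le> - 2 \<or> x \<bullet> i \<ge> 2"
    using assms by (force simp: mem_box not_le)
  then show ?thesis
    unfolding plateau_def by (intro prod_zero) (auto simp: plateau1_def flat_exp_zero intro!: bexI[of _ i])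
qed

lemma test_functions_plateau: "(\<lambda>x. complex_of_real (plateau x)) \<in> test_functions UNIV"
  by (rule test_functionsI[where K = "cbox (- 2 *\<^sub>R One) (2 *\<^sub>R One)"])
     (auto intro: smooth_plateau plateau_eq_0)

section \<open>Integration against test functions\<close>

lemma lborel_affine_integral:
  fixes f :: "'a::euclidean_space \<Rightarrow> 'b::{banach, second_countable_topology}"
  assumes c: "c \<noteq> 0" and [measurable]: "f \<in> borel_measurable borel"
  shows "(LINT x|lborel. f (t + c *\<^sub>R x)) = inverse (\<bar>c\<bar> ^ DIM('a)) *\<^sub>R (LINT x|lborel. f x)"
    and "integrable lborel (\<lambda>x. f (t + c *\<^sub>R x)) \<longleftrightarrow> integrable lborel f"
proof -
  have "(LINT x|lborel. f x) = \<bar>c\<bar> ^ DIM('a) *\<^sub>R (LINT x|lborel. f (t + c *\<^sub>R x))"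
    by (subst lborel_affine[OF c, of t]) (simp add: integral_density integral_distr)
  then show "(LINT x|lborel. f (t + c *\<^sub>R x)) = inverse (\<bar>c\<bar> ^ DIM('a)) *\<^sub>R (LINT x|lborel. f x)"
    using c by simp
  have "integrable lborel f \<longleftrightarrow> integrable lborel (\<lambda>x. \<bar>c\<bar> ^ DIM('a) *\<^sub>R f (t + c *\<^sub>R x))"
    by (subst lborel_affine[OF c, of t]) (simp add: integrable_density integrable_distr_eq)
  moreover have "integrable lborel (\<lambda>x. f (t + c *\<^sub>R x))"
    if "integrable lborel (\<lambda>x. \<bar>c\<bar> ^ DIM('a) *\<^sub>R f (t + c *\<^sub>R x))"
    using integrable_scaleR_right[of "inverse (\<bar>c\<bar> ^ DIM('a))", OF that] c by simp
  ultimately show "integrable lborel (\<lambda>x. f (t + c *\<^sub>R x)) \<longleftrightarrow> integrable lborel f"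
    using integrable_scaleR_right[of "\<bar>c\<bar> ^ DIM('a)" lborel "\<lambda>x. f (t + c *\<^sub>R x)"] by blast
qed

lemma nn_integral_lborel_affine:
  fixes f :: "'a::euclidean_space \<Rightarrow> ennreal"
  assumes c: "c \<noteq> 0" and [measurable]: "f \<in> borel_measurable borel"
  shows "(\<integral>\<^sup>+x. f x \<partial>lborel) = ennreal (\<bar>c\<bar> ^ DIM('a)) * (\<integral>\<^sup>+x. f (t + c *\<^sub>R x) \<partial>lborel)"
  by (subst lborel_affine[OF c, of t])
     (simp add: nn_integral_density nn_integral_distr nn_integral_cmult)

lemma lborel_translate_integral:
  fixes f :: "'a::euclidean_space \<Rightarrow> 'b::{banach, second_countable_topology}"
  assumes "f \<in> borel_measurable borel"
  shows "(LINT x|lborel. f (t + x)) = (LINT x|lborel. f x)"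
    and "integrable lborel (\<lambda>x. f (t + x)) \<longleftrightarrow> integrable lborel f"
  using lborel_affine_integral[of 1 f t] assms by simp_all

lemma integrable_zero_outside_compact:
  fixes f :: "'a::euclidean_space \<Rightarrow> 'b::{banach, second_countable_topology}"
  assumes "f \<in> borel_measurable borel" "compact K" "\<And>x. x \<notin> K \<Longrightarrow> f x = 0" "\<And>x. x \<in> K \<Longrightarrow> norm (f x) \<le> B"
  shows "integrable lborel f"
  by (rule integrableI_bounded_set[where A = K and B = B])
     (use assms emeasure_compact_finite in \<open>auto simp: compact_imp_closed borel_closed\<close>)

lemma test_functions_measurable: "f \<in> test_functions \<Omega> \<Longrightarrow> f \<in> borel_measurable borel"
  by (simp add: smooth_measurable test_functions_smooth)

lemma test_functions_integrable:
  assumes "f \<in> test_functions \<Omega>" shows "integrable lborel f"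
proof -
  obtain K where "smooth f" "compact K" "K \<subseteq> \<Omega>" "\<And>x. x \<notin> K \<Longrightarrow> f x = 0"
    using test_functionsE[OF assms] by metis
  moreover obtain B where "\<And>x. cmod (f x) \<le> B" using test_functions_bounded[OF assms] by metis
  ultimately show ?thesis
    by (intro integrable_zero_outside_compact[of f K B]) (auto intro: smooth_measurable)
qed

lemma smooth_along_line:
  assumes "smooth f"
  shows "((\<lambda>s::real. f (x + s *\<^sub>R v)) has_vector_derivative pderivative f v (x + s *\<^sub>R v)) (at s)"
proof -
  have "((\<lambda>s. f (x + s *\<^sub>R v)) has_derivative (\<lambda>h. frechet_derivative f (at (x + s *\<^sub>R v)) (h *\<^sub>R v))) (at s)"
    by (rule has_derivative_compose[OF _ smooth_has_derivative[OF assms]])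
       (auto intro!: derivative_eq_intros)
  then show ?thesis
    unfolding has_vector_derivative_def
    by (simp add: linear_scale[OF linear_frechet_derivative[OF smooth_differentiable[OF assms]]])
qed

text \<open>Difference quotients in the direction \<open>v\<close> have integral 0 by translation
  invariance of Lebesgue measure; dominated convergence carries this over to the derivative, without
  splitting off a coordinate.\<close>

lemma test_functions_integral_pderivative:
  assumes f: "f \<in> test_functions UNIV"
  shows "(LINT x|lborel. pderivative f v x) = 0"
proof -
  obtain K where K: "smooth f" "compact K" "\<And>x. x \<notin> K \<Longrightarrow> f x = 0"
    using test_functionsE[OF f] by metis
  obtain B where B: "\<And>x. cmod (pderivative f v x) \<le> B" "B > 0"
    using test_functions_bounded[OF test_functions_pderivative[OF f]] by metis
  \<comment> \<open>All points from which some step \<open>s *\<^sub>R v\<close> with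
    \<open>s\<close> between 0 and 1 can reach \<open>K\<close>. The difference quotients with steps
    \<open>h n \<le> 1\<close> vanish outside.\<close>
  define K' where "K' = (\<lambda>(x, s). x - s *\<^sub>R v) ` (K \<times> {0..1::real})"
  have K': "compact K'" unfolding K'_def case_prod_beta
    by (intro compact_continuous_image continuous_intros compact_Times K) auto
  have memK': "x + s *\<^sub>R v \<in> K \<Longrightarrow> s \<in> {0..1} \<Longrightarrow> x \<in> K'" for x s
    unfolding K'_def by (intro image_eqI[of _ _ "(x + s *\<^sub>R v, s)"]) auto
  have [measurable]: "f \<in> borel_measurable borel" using f by (rule test_functions_measurable)
  define h where "h n = inverse (real (Suc n))" for n
  have h: "0 < h n" "h n \<le> 1" for n by (auto simp: h_def field_simps)
  define q where "q n x = inverse (h n) *\<^sub>R (f (x + h n *\<^sub>R v) - f x)" for n x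
  have bound: "norm (q n x) \<le> B * indicator K' x" for n x
  proof (cases "x \<in> K'")
    case True
    have "\<exists>s\<in>{0<..<h n}. norm (f (x + h n *\<^sub>R v) - f (x + 0 *\<^sub>R v)) \<le> norm ((h n - 0) *\<^sub>R pderivative f v (x + s *\<^sub>R v))"
      using smooth_along_line[OF K(1), of x v, unfolded has_vector_derivative_def] h
      by (intro mvt_general) (auto intro!: continuous_at_imp_continuous_on has_derivative_continuous)
    then obtain s where "norm (f (x + h n *\<^sub>R v) - f x) \<le> h n * norm (pderivative f v (x + s *\<^sub>R v))"
      using h[of n] by auto
    also have "\<dots> \<le> h n * B" using B h[of n] by (intro mult_left_mono) auto
    finally have "inverse (h n) * norm (f (x + h n *\<^sub>R v) - f x) \<le> B" using h[of n] by (simp add: field_simps)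
    then show ?thesis using True h[of n] by (simp add: q_def)
  next
    case False
    then have "x \<notin> K" "x + h n *\<^sub>R v \<notin> K"
      using memK'[of x 0] memK'[of x "h n"] h[of n] by auto
    then show ?thesis using False by (simp add: q_def K)
  qed
  have lim: "(\<lambda>n. q n x) \<longlonglongrightarrow> pderivative f v x" for x
  proof -
    have "((\<lambda>s. (1 / norm (s - 0)) *\<^sub>R (f (x + s *\<^sub>R v) - (f (x + 0 *\<^sub>R v) + (s - 0) *\<^sub>R pderivative f v (x + 0 *\<^sub>R v)))) \<longlongrightarrow> 0) (at 0)"
      using smooth_along_line[OF K(1), of x v 0] unfolding has_vector_derivative_def has_derivative_at2 by blast
    then have "((\<lambda>s. (f (x + s *\<^sub>R v) - f x) /\<^sub>R s - pderivative f v x) \<longlongrightarrow> 0) (at 0)"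
      apply (rule Lim_null_comparison[rotated, OF tendsto_norm_zero])
      apply (rule eventually_at_filter[THEN iffD2], rule always_eventually, intro allI impI)
      subgoal for s
      proof -
        assume "s \<noteq> 0"
        then have "(f (x + s *\<^sub>R v) - f x) /\<^sub>R s - pderivative f v x
           = (1 / s) *\<^sub>R (f (x + s *\<^sub>R v) - (f x + s *\<^sub>R pderivative f v x))"
          by (simp add: algebra_simps inverse_eq_divide)
        then show ?thesis by simp
      qed
      done
    then have "((\<lambda>s. (f (x + s *\<^sub>R v) - f x) /\<^sub>R s) \<longlongrightarrow> pderivative f v x) (at 0)"
      by (rule LIM_zero_cancel)
    moreover have "filterlim h (at 0) sequentially"
      unfolding h_def filterlim_at using LIMSEQ_inverse_real_of_nat by auto
    ultimately show ?thesis unfolding q_def by (rule filterlim_compose)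
  qed
  have "(\<lambda>n. LINT x|lborel. q n x) \<longlonglongrightarrow> (LINT x|lborel. pderivative f v x)"
  proof (rule integral_dominated_convergence[where w = "\<lambda>x. B * indicator K' x"])
    show "integrable lborel (\<lambda>x. B * indicator K' x)"
      using K' by (intro integrable_mult_right integrable_real_indicator)
        (use emeasure_compact_finite[OF K'] in \<open>auto simp: compact_imp_closed borel_closed less_top\<close>)
  qed (use lim bound in \<open>auto simp: q_def intro: test_functions_measurable[OF test_functions_pderivative[OF f]]\<close>)
  moreover have "(LINT x|lborel. q n x) = 0" for n
    unfolding q_def
    using lborel_translate_integral[of f "h n *\<^sub>R v"] test_functions_integrable[OF f]
    by (simp add: add.commute)
  ultimately show ?thesis by (simp add: LIMSEQ_const_iff)
qed

lemma pderivative_mult: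
  assumes "smooth f" "smooth g"
  shows "pderivative (\<lambda>x. f x * g x) v = (\<lambda>x. f x * pderivative g v x + pderivative f v x * g x)"
proof
  fix x
  have "((\<lambda>x. f x * g x) has_derivative (\<lambda>h. f x * frechet_derivative g (at x) h + frechet_derivative f (at x) h * g x)) (at x)"
    by (intro has_derivative_mult smooth_has_derivative assms)
  from frechet_derivative_at[OF this, THEN fun_cong, of v]
  show "pderivative (\<lambda>x. f x * g x) v x = f x * pderivative g v x + pderivative f v x * g x" by simp
qed

lemma test_functions_integral_by_parts:
  assumes f: "f \<in> test_functions UNIV" and g: "smooth g"
  shows "(LINT x|lborel. g x * pderivative f v x) = - (LINT x|lborel. pderivative g v x * f x)"
proof -
  have "integrable lborel (\<lambda>x. g x * pderivative f v x)"
    by (rule test_functions_integrable[OF test_functions_mult[OF test_functions_pderivative[OF f] g]])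
  moreover have "integrable lborel (\<lambda>x. pderivative g v x * f x)"
    by (rule test_functions_integrable[OF test_functions_mult[OF f smooth_pderivative[OF g]]])
  moreover have "(LINT x|lborel. g x * pderivative f v x + pderivative g v x * f x) = 0"
    using test_functions_integral_pderivative[OF test_functions_mult[OF f g], of v]
      pderivative_mult[OF g test_functions_smooth[OF f], of v] by simp
  ultimately show ?thesis by (simp add: eq_neg_iff_add_eq_0)
qed

section \<open>The fundamental lemma of the calculus of variations\<close>

lemma set_integral_zero_on_boxes:
  fixes h :: "'a::euclidean_space \<Rightarrow> 'b::{banach, second_countable_topology}"
  assumes h: "integrable lborel h" and box: "\<And>a b. (LINT x:box a b|lborel. h x) = 0"
    and A: "A \<in> sets borel"
  shows "(LINT x:A|lborel. h x) = 0"
proof -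
  have [measurable]: "h \<in> borel_measurable borel" using borel_measurable_integrable[OF h] by simp
  have si: "set_integrable lborel A h" if "A \<in> sets borel" for A
    unfolding set_integrable_def using h that by (intro integrable_mult_indicator) auto
  \<comment> \<open>Passing to complements needs the total integral, obtained by exhausting the
    space with boxes.\<close>
  have all: "(LINT x|lborel. h x) = 0"
  proof -
    have "(\<lambda>n. LINT x:box (- real n *\<^sub>R One) (real n *\<^sub>R One)|lborel. h x) \<longlonglongrightarrow> (LINT x|lborel. h x)"
      unfolding set_lebesgue_integral_def
    proof (rule integral_dominated_convergence[where w = "\<lambda>x. norm (h x)"])
      show "AE x in lborel. (\<lambda>n. indicator (box (- real n *\<^sub>R One) (real n *\<^sub>R One)) x *\<^sub>R h x) \<longlonglongrightarrow> h x"
      proof (intro AE_I2)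
        fix x :: 'a
        obtain N :: nat where N: "norm x < real N" using reals_Archimedean2 by blast
        have "x \<in> box (- real n *\<^sub>R One) (real n *\<^sub>R One)" if "n \<ge> N" for n
        proof -
          have "\<bar>x \<bullet> i\<bar> < real n" if "i \<in> Basis" for i
            using Basis_le_norm[OF that, of x] N \<open>n \<ge> N\<close> by (auto intro: le_less_trans)
          then show ?thesis by (auto simp: mem_box abs_less_iff) (metis minus_less_iff)
        qed
        then have "eventually (\<lambda>n. h x = indicator (box (- real n *\<^sub>R One) (real n *\<^sub>R One)) x *\<^sub>R h x) sequentially"
          by (intro eventually_sequentiallyI[of N]) auto
        then show "(\<lambda>n. indicator (box (- real n *\<^sub>R One) (real n *\<^sub>R One)) x *\<^sub>R h x) \<longlonglongrightarrow> h x"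
          by (rule Lim_transform_eventually[OF tendsto_const])
      qed
    qed (use h in \<open>auto simp: indicator_def\<close>)
    then show ?thesis unfolding box by (simp add: LIMSEQ_const_iff)
  qed
  have A': "A \<in> sigma_sets UNIV (range (\<lambda>(a, b). box a b))"
    using A unfolding borel_eq_box by simp
  \<comment> \<open>Open boxes are stable under intersection and generate the Borel sets, so
    Dynkin's induction applies.\<close>
  have stable: "Int_stable (range (\<lambda>(a, b). box a b :: 'a set))"
    by (auto simp: Int_stable_def box_Int_box)
  show ?thesis
  proof (rule sigma_sets_induct_disjoint[OF stable _ A'])
    show "range (\<lambda>(a, b). box a b :: 'a set) \<subseteq> Pow UNIV" by simp
    show "(LINT x:A|lborel. h x) = 0" if "A \<in> range (\<lambda>(a, b). box a b)" for A
      using that box by auto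
    show "(LINT x:{}|lborel. h x) = 0" by (simp add: set_lebesgue_integral_def)
    show "(LINT x:UNIV - A|lborel. h x) = 0"
      if "A \<in> sigma_sets UNIV (range (\<lambda>(a, b). box a b))" "(LINT x:A|lborel. h x) = 0" for A
    proof -
      have A: "A \<in> sets borel" using that unfolding borel_eq_box by simp
      have "(LINT x:UNIV - A|lborel. h x) = (LINT x|lborel. h x - indicator A x *\<^sub>R h x)"
        unfolding set_lebesgue_integral_def by (intro Bochner_Integration.integral_cong) (auto simp: indicator_def)
      also have "\<dots> = 0"
        using si[OF A] h all that(2) unfolding set_integrable_def set_lebesgue_integral_def
        by (subst Bochner_Integration.integral_diff) auto
      finally show ?thesis .
    qed
    show "(LINT x:(\<Union>i::nat. B i)|lborel. h x) = 0"
      if "disjoint_family B" "range B \<subseteq> sigma_sets UNIV (range (\<lambda>(a, b). box a b))"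
        "\<And>i. (LINT x:B i|lborel. h x) = 0" for B
    proof -
      have B: "B i \<in> sets borel" for i using that(2) unfolding borel_eq_box by auto
      then have U: "(\<Union>i. B i) \<in> sets borel" by auto
      show ?thesis
        using that B si[OF U]
        by (subst lebesgue_integral_countable_add) (auto simp: disjoint_family_on_def)
    qed
  qed
qed

text \<open>The real and the imaginary part are each determined almost everywhere by their integrals
  over Borel sets.\<close>

lemma AE_zero_if_box_integrals_zero:
  fixes h :: "'a::euclidean_space \<Rightarrow> complex"
  assumes h: "integrable lborel h" and box: "\<And>a b. (LINT x:box a b|lborel. h x) = 0"
  shows "AE x in lborel. h x = 0"
proof -
  have z: "(LINT x:A|lborel. h x) = 0" if "A \<in> sets lborel" for A
    using set_integral_zero_on_boxes[OF h box] that by simp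
  have i: "integrable lborel (\<lambda>x. indicat_real A x *\<^sub>R h x)" if "A \<in> sets lborel" for A
    using h that by (intro integrable_mult_indicator) auto
  have "AE x in lborel. Re (h x) = 0"
    using h z i integral_Re[OF i] by (intro density_unique_real) (auto simp: set_lebesgue_integral_def)
  moreover have "AE x in lborel. Im (h x) = 0"
    using h z i integral_Im[OF i] by (intro density_unique_real) (auto simp: set_lebesgue_integral_def)
  ultimately show ?thesis by eventually_elim (simp add: complex_eq_iff)
qed

text \<open>An open set is a countable union of closed boxes, and on each of them the function cut
  off to the open box is integrable. The cut-off inherits vanishing box integrals because boxes
  intersect in boxes, and the frontier is null.\<close>

lemma AE_zero_if_local_box_integrals_zero:
  fixes h :: "'a::euclidean_space \<Rightarrow> complex"
  assumes "open \<Omega>" and hint: "\<And>a b. cbox a b \<subseteq> \<Omega> \<Longrightarrow> set_integrable lborel (cbox a b) h"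
    and hzero: "\<And>a b. cbox a b \<subseteq> \<Omega> \<Longrightarrow> (LINT x:box a b|lborel. h x) = 0"
  shows "AE x in lborel. x \<in> \<Omega> \<longrightarrow> h x = 0"
proof -
  have one: "AE x in lborel. x \<in> cbox p q \<longrightarrow> h x = 0" if pq: "cbox p q \<subseteq> \<Omega>" for p q
  proof -
    have "negligible (cbox p q - box p q)" by (rule negligible_frontier_interval)
    then have "AE x in lebesgue. x \<notin> cbox p q - box p q"
      unfolding negligible_iff_null_sets by (rule AE_not_in)
    then have nb: "AE x in lborel. x \<notin> cbox p q - box p q"
      by (subst (asm) AE_completion_iff) auto
    have "AE x in lborel. indicat_real (box p q) x *\<^sub>R h x = 0"
    proof (rule AE_zero_if_box_integrals_zero)
      have "set_integrable lborel (box p q) h"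
        by (rule set_integrable_subset[OF hint[OF pq]]) (auto simp: box_subset_cbox)
      then show "integrable lborel (\<lambda>x. indicat_real (box p q) x *\<^sub>R h x)"
        by (simp add: set_integrable_def)
      fix a b :: 'a
      define a' b' where "a' = (\<Sum>i\<in>Basis. max (a \<bullet> i) (p \<bullet> i) *\<^sub>R i)"
        and "b' = (\<Sum>i\<in>Basis. min (b \<bullet> i) (q \<bullet> i) *\<^sub>R i)"
      have eq: "box a b \<inter> box p q = box a' b'" unfolding a'_def b'_def by (rule box_Int_box)
      have "cbox a' b' \<subseteq> cbox p q" unfolding a'_def b'_def by (auto simp: mem_box)
      with pq have "(LINT x:box a' b'|lborel. h x) = 0" by (intro hzero) auto
      moreover have "(LINT x:box a b|lborel. indicat_real (box p q) x *\<^sub>R h x) = (LINT x:box a' b'|lborel. h x)"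
        unfolding eq[symmetric] set_lebesgue_integral_def
        by (intro Bochner_Integration.integral_cong) (auto simp: indicator_def)
      ultimately show "(LINT x:box a b|lborel. indicat_real (box p q) x *\<^sub>R h x) = 0" by simp
    qed
    with nb show ?thesis by eventually_elim (auto simp: indicator_def split: if_splits)
  qed
  obtain D where D: "countable D" "D \<subseteq> Pow \<Omega>" "\<And>X. X \<in> D \<Longrightarrow> \<exists>a b. X = cbox a b" "\<Union>D = \<Omega>"
    apply (rule open_countable_Union_open_cbox[OF \<open>open \<Omega>\<close>])
    subgoal premises p for D using p(1)[OF p(2-5)] .
    done
  have "AE x in lborel. x \<in> X \<longrightarrow> h x = 0" if "X \<in> D" for X
    using D(2,3) that one by blast
  then have "AE x in lborel. \<forall>X\<in>D. x \<in> X \<longrightarrow> h x = 0"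
    by (subst AE_ball_countable[OF D(1)]) auto
  then show ?thesis using D(4) by (auto elim!: eventually_mono)
qed

lemma box_integral_limit:
  fixes h :: "'a::euclidean_space \<Rightarrow> complex"
  assumes h: "set_integrable lborel (cbox a b) h"
  shows "(\<lambda>n. LINT x|lborel. h x * complex_of_real (box_bump n a b x)) \<longlonglongrightarrow> (LINT x:box a b|lborel. h x)"
proof -
  define k where "k x = indicat_real (cbox a b) x *\<^sub>R h x" for x
  have k: "integrable lborel k" using h by (simp add: k_def[abs_def] set_integrable_def)
  have eq: "h x * complex_of_real (box_bump n a b x) = k x * complex_of_real (box_bump n a b x)" for n x
    using box_bump_zero[of x a b n] subsetD[OF box_subset_cbox, of x a b] by (auto simp: k_def indicator_def)
  have [measurable]: "(\<lambda>x. complex_of_real (box_bump n a b x)) \<in> borel_measurable borel" for n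
    by (intro smooth_measurable smooth_box_bump)
  have [measurable]: "k \<in> borel_measurable borel" using borel_measurable_integrable[OF k] by simp
  have "(\<lambda>n. LINT x|lborel. k x * complex_of_real (box_bump n a b x)) \<longlonglongrightarrow> (LINT x|lborel. k x * complex_of_real (indicator (box a b) x))"
  proof (rule integral_dominated_convergence[where w = "\<lambda>x. norm (k x)"])
    show "AE x in lborel. (\<lambda>n. k x * complex_of_real (box_bump n a b x)) \<longlonglongrightarrow> k x * complex_of_real (indicator (box a b) x)"
      by (intro AE_I2 tendsto_mult tendsto_const tendsto_of_real box_bump_tendsto)
    show "AE x in lborel. norm (k x * complex_of_real (box_bump n a b x)) \<le> norm (k x)" for n
      by (auto simp: norm_mult intro!: mult_left_le box_bump_le_1 simp: box_bump_nonneg)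
  qed (use k in auto)
  moreover have "k x * complex_of_real (indicator (box a b) x) = indicator (box a b) x *\<^sub>R h x" for x
    using subsetD[OF box_subset_cbox, of x a b] by (auto simp: k_def indicator_def)
  ultimately show ?thesis unfolding set_lebesgue_integral_def eq by simp
qed

text \<open>Testing is required against the explicit family \<open>box_bump\<close> alone; this is
  what later allows a countable family on the half-line.\<close>

lemma fundamental_lemma:
  fixes h :: "'a::euclidean_space \<Rightarrow> complex"
  assumes "open \<Omega>" and hint: "\<And>a b. cbox a b \<subseteq> \<Omega> \<Longrightarrow> set_integrable lborel (cbox a b) h"
    and hzero: "\<And>n a b. cbox a b \<subseteq> \<Omega> \<Longrightarrow> (LINT x|lborel. h x * complex_of_real (box_bump n a b x)) = 0"
  shows "AE x in lborel. x \<in> \<Omega> \<longrightarrow> h x = 0"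
proof (rule AE_zero_if_local_box_integrals_zero[OF assms(1) hint])
  fix a b assume "cbox a b \<subseteq> \<Omega>"
  then show "(LINT x:box a b|lborel. h x) = 0"
    using box_integral_limit[OF hint, of a b] hzero by (simp add: LIMSEQ_const_iff)
qed

lemma dilated_plateau_eq_1:
  assumes "\<And>i. i \<in> Basis \<Longrightarrow> \<bar>x \<bullet> i\<bar> \<le> R" "R > 0" shows "plateau (inverse R *\<^sub>R x) = 1"
proof (rule plateau_eq_1)
  have "- 1 \<le> inverse R * (x \<bullet> i) \<and> inverse R * (x \<bullet> i) \<le> 1" if "i \<in> Basis" for i
    using assms(1)[OF that] \<open>R > 0\<close> by (simp add: field_simps abs_le_iff)
  then show "inverse R *\<^sub>R x \<in> cbox (- One) One"
    by (simp add: mem_box)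
qed

lemma exists_test_function_one_on:
  assumes "bounded (K :: 'a::euclidean_space set)"
  obtains \<phi> where "\<phi> \<in> test_functions UNIV" "\<And>x. x \<in> K \<Longrightarrow> \<phi> x = 1"
proof -
  obtain R where R: "R > 0" "\<And>x. x \<in> K \<Longrightarrow> norm x \<le> R" using assms bounded_pos by metis
  have "plateau (inverse R *\<^sub>R x) = 1" if "x \<in> K" for x
    using R that Basis_le_norm[of _ x] by (intro dilated_plateau_eq_1) (auto intro: order_trans)
  then show ?thesis
    using test_functions_affine[OF test_functions_plateau, of "inverse R" 0] R
    by (intro that[of "\<lambda>x. complex_of_real (plateau (0 + inverse R *\<^sub>R x))"]) auto
qed

text \<open>A test function equal to 1 on a box provides the integrability of \<open>g - h\<close>
  on that box, after which the fundamental lemma applies to the difference.\<close>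

lemma AE_eq_if_equal_integrals:
  fixes g h :: "'a::euclidean_space \<Rightarrow> complex"
  assumes g: "\<And>\<phi>. \<phi> \<in> test_functions UNIV \<Longrightarrow> integrable lborel (\<lambda>x. g x * \<phi> x)"
    and h: "\<And>\<phi>. \<phi> \<in> test_functions UNIV \<Longrightarrow> integrable lborel (\<lambda>x. h x * \<phi> x)"
    and eq: "\<And>\<phi>. \<phi> \<in> test_functions UNIV \<Longrightarrow> (LINT x|lborel. g x * \<phi> x) = (LINT x|lborel. h x * \<phi> x)"
  shows "AE x in lborel. g x = h x"
proof -
  have "AE x in lborel. x \<in> UNIV \<longrightarrow> g x - h x = 0"
  proof (rule fundamental_lemma)
    fix a b :: 'a
    obtain \<phi> where \<phi>: "\<phi> \<in> test_functions UNIV" "\<And>x. x \<in> cbox a b \<Longrightarrow> \<phi> x = 1"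
      using exists_test_function_one_on[OF bounded_cbox, of a b] by metis
    have "integrable lborel (\<lambda>x. indicat_real (cbox a b) x *\<^sub>R (g x * \<phi> x - h x * \<phi> x))"
      using g[OF \<phi>(1)] h[OF \<phi>(1)] by (intro integrable_mult_indicator) auto
    moreover have "(\<lambda>x. indicat_real (cbox a b) x *\<^sub>R (g x * \<phi> x - h x * \<phi> x)) = (\<lambda>x. indicat_real (cbox a b) x *\<^sub>R (g x - h x))"
      using \<phi>(2) by (intro ext) (auto simp: indicator_def)
    ultimately show "set_integrable lborel (cbox a b) (\<lambda>x. g x - h x)"
      by (simp add: set_integrable_def)
  next
    fix n and a b :: 'a
    have t: "(\<lambda>x. complex_of_real (box_bump n a b x)) \<in> test_functions UNIV"
      by (rule test_functions_box_bump) auto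
    show "(LINT x|lborel. (g x - h x) * complex_of_real (box_bump n a b x)) = 0"
      using g[OF t] h[OF t] eq[OF t] by (simp add: left_diff_distrib)
  qed simp
  then show ?thesis by simp
qed

section \<open>Products over the coordinates and integrability at infinity\<close>

lemma lborel_integral_prod_Basis:
  fixes f :: "'a::euclidean_space \<Rightarrow> real \<Rightarrow> complex"
  assumes f: "\<And>b. b \<in> Basis \<Longrightarrow> integrable lborel (f b)"
  shows "integrable lborel (\<lambda>x::'a. \<Prod>b\<in>Basis. f b (x \<bullet> b))"
    and "(LINT x|lborel. (\<Prod>b\<in>Basis. f b (x \<bullet> b))) = (\<Prod>b\<in>Basis. (LINT t|lborel. f b t))"
proof -
  interpret product_sigma_finite "\<lambda>_. lborel :: real measure" ..
  have [measurable]: "f b \<in> borel_measurable borel" if "b \<in> Basis" for b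
    using borel_measurable_integrable[OF f[OF that]] by simp
  have m: "(\<lambda>x::'a. \<Prod>b\<in>Basis. f b (x \<bullet> b)) \<in> borel_measurable borel" by measurable
  have T: "(\<lambda>g. \<Sum>b\<in>Basis. g b *\<^sub>R b) \<in> measurable (\<Pi>\<^sub>M b\<in>(Basis :: 'a set). lborel) borel" by measurable
  have eq: "(\<Prod>b\<in>Basis. f b ((\<Sum>c\<in>Basis. g c *\<^sub>R c) \<bullet> b)) = (\<Prod>b\<in>(Basis :: 'a set). f b (g b))" for g
    by (intro prod.cong refl) simp
  show "integrable lborel (\<lambda>x::'a. \<Prod>b\<in>Basis. f b (x \<bullet> b))"
    by (subst lborel_eq, subst integrable_distr_eq[OF T m], unfold eq)
       (rule product_integrable_prod[OF finite_Basis f])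
  show "(LINT x|lborel. (\<Prod>b\<in>Basis. f b (x \<bullet> b))) = (\<Prod>b\<in>Basis. (LINT t|lborel. f b t))"
    by (subst lborel_eq, subst integral_distr[OF T m], unfold eq)
       (rule product_integral_prod[OF finite_Basis f])
qed

text \<open>The exponent is twice the dimension so that each coordinate receives one factor
  \<open>(1 + norm x)\<^sup>2\<close>, which dominates
  \<open>1 + (x \<bullet> b)\<^sup>2\<close>.\<close>

lemma integrable_polynomial_decay:
  "integrable lborel (\<lambda>x::'a::euclidean_space. inverse ((1 + norm x) ^ (2 * DIM('a))))"
proof -
  have "integrable lborel (\<lambda>t::real. complex_of_real (inverse (1 + t\<^sup>2)))"
    using integrable_inverse_1_plus_square by (intro integrable_of_real) (simp add: set_integrable_def)
  then have "integrable lborel (\<lambda>x::'a. \<Prod>b\<in>Basis. complex_of_real (inverse (1 + (x \<bullet> b)\<^sup>2)))"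
    by (intro lborel_integral_prod_Basis)
  then show ?thesis
  proof (rule Bochner_Integration.integrable_bound)
    show "AE x::'a in lborel. norm (inverse ((1 + norm x) ^ (2 * DIM('a)))) \<le> norm (\<Prod>b\<in>Basis. complex_of_real (inverse (1 + (x \<bullet> b)\<^sup>2)))"
    proof (intro AE_I2)
      fix x :: 'a
      have "(\<Prod>b\<in>(Basis::'a set). inverse ((1 + norm x) ^ 2)) \<le> (\<Prod>b\<in>Basis. inverse (1 + (x \<bullet> b)\<^sup>2))"
      proof (intro prod_mono conjI)
        fix b :: 'a assume "b \<in> Basis"
        then have "(x \<bullet> b)\<^sup>2 \<le> (norm x)\<^sup>2" using Basis_le_norm[of b x] abs_le_square_iff[of "x \<bullet> b" "norm x"] by simp
        then have "1 + (x \<bullet> b)\<^sup>2 \<le> (1 + norm x)\<^sup>2" by (simp add: power2_sum add_increasing2)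
        then show "inverse ((1 + norm x) ^ 2) \<le> inverse (1 + (x \<bullet> b)\<^sup>2)"
          by (intro le_imp_inverse_le) (auto intro: add_pos_nonneg)
      qed simp
      also have "(\<Prod>b\<in>(Basis::'a set). inverse ((1 + norm x) ^ 2)) = norm (inverse ((1 + norm x) ^ (2 * DIM('a))))"
        by (simp add: power_mult power_inverse)
      also have "(\<Prod>b\<in>Basis. inverse (1 + (x \<bullet> b)\<^sup>2)) = norm (\<Prod>b\<in>Basis. complex_of_real (inverse (1 + (x \<bullet> b)\<^sup>2)))"
        unfolding prod_norm[symmetric] norm_of_real by (intro prod.cong refl abs_of_nonneg[symmetric]) simp
      finally show "norm (inverse ((1 + norm x) ^ (2 * DIM('a)))) \<le> norm (\<Prod>b\<in>Basis. complex_of_real (inverse (1 + (x \<bullet> b)\<^sup>2)))" .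
    qed
  qed simp
qed

section \<open>The Fourier transform of test functions\<close>

lemma exp_inner_has_derivative:
  "((\<lambda>x. exp (c * complex_of_real (x \<bullet> v))) has_derivative (\<lambda>h. c * of_real (h \<bullet> v) * exp (c * of_real (x \<bullet> v)))) (at x)"
proof -
  have "((\<lambda>x. c * complex_of_real (x \<bullet> v)) has_derivative (\<lambda>h. c * of_real (h \<bullet> v))) (at x)"
    by (intro has_derivative_mult_right has_derivative_of_real has_derivative_inner_left has_derivative_ident)
  from has_derivative_compose[OF this DERIV_exp[unfolded has_field_derivative_def]]
  show ?thesis by (simp add: mult_ac)
qed

lemma smooth_exp_inner: "smooth (\<lambda>x. exp (c * complex_of_real (x \<bullet> v)))"
proof -
  have "Ck n (\<lambda>x. exp (c * complex_of_real (x \<bullet> v)))" for n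
  proof (induction n)
    case (Suc n)
    then show ?case
      by (intro Ck_SucI[OF exp_inner_has_derivative] Ck_mult Ck_const)
  qed simp
  then show ?thesis by (simp add: smooth_iff_Ck)
qed

lemma pderivative_exp_inner:
  "frechet_derivative (\<lambda>x. exp (c * complex_of_real (x \<bullet> v))) (at x) w = c * of_real (w \<bullet> v) * exp (c * of_real (x \<bullet> v))"
  by (rule frechet_derivative_at[OF exp_inner_has_derivative, THEN fun_cong, symmetric])

lemma norm_exp_i [simp]: "cmod (exp (- (\<i> * complex_of_real t))) = 1" "cmod (exp (\<i> * complex_of_real t)) = 1"
  by (simp_all add: norm_exp_i_times)

definition fourier_const :: "'a::euclidean_space itself \<Rightarrow> real" where
  "fourier_const _ = (2 * pi) powr (- real DIM('a) / 2)"

lemma fourier_const_pos: "fourier_const TYPE('a::euclidean_space) > 0"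
  by (simp add: fourier_const_def)

lemma fourier_eq: "fourier (f :: 'a::euclidean_space \<Rightarrow> complex) \<xi> = complex_of_real (fourier_const TYPE('a)) *
     (LINT x|lborel. exp (- \<i> * complex_of_real (x \<bullet> \<xi>)) * f x)"
  unfolding fourier_def fourier_const_def ..

lemma integrable_exp_mult:
  assumes "integrable lborel (f :: 'a::euclidean_space \<Rightarrow> complex)"
  shows "integrable lborel (\<lambda>x. exp (- \<i> * complex_of_real (x \<bullet> \<xi>)) * f x)"
proof -
  have [measurable]: "f \<in> borel_measurable borel" using borel_measurable_integrable[OF assms] by simp
  show ?thesis
    by (rule Bochner_Integration.integrable_bound[OF assms]) (auto simp: norm_mult)
qed

lemma fourier_add:
  assumes "integrable lborel f" "integrable lborel g"
  shows "fourier (\<lambda>x. f x + g x) \<xi> = fourier f \<xi> + fourier g \<xi>"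
  using integrable_exp_mult[OF assms(1)] integrable_exp_mult[OF assms(2)]
  by (simp add: fourier_eq distrib_left)

lemma fourier_cmult: "fourier (\<lambda>x. c * f x) \<xi> = c * fourier f \<xi>"
  unfolding fourier_eq by (simp add: mult.left_commute)

lemma fourier_norm_le:
  "cmod (fourier (f :: 'a::euclidean_space \<Rightarrow> complex) \<xi>) \<le> fourier_const TYPE('a) * (LINT x|lborel. cmod (f x))"
proof -
  have "cmod (LINT x|lborel. exp (- \<i> * complex_of_real (x \<bullet> \<xi>)) * f x) \<le> (LINT x|lborel. cmod (f x))"
    using integral_norm_bound[of lborel "\<lambda>x. exp (- \<i> * complex_of_real (x \<bullet> \<xi>)) * f x"] by (simp add: norm_mult)
  then show ?thesis
    using fourier_const_pos[where 'a='a] by (simp add: fourier_eq norm_mult)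
qed

lemma fourier_measurable [measurable]:
  assumes [measurable]: "(f :: 'a::euclidean_space \<Rightarrow> complex) \<in> borel_measurable borel"
  shows "fourier f \<in> borel_measurable borel"
  unfolding fourier_eq[abs_def] by measurable

lemma inv_fourier_eq_fourier: "inv_fourier f x = fourier f (- x)"
  unfolding inv_fourier_def fourier_def by (simp add: inner_commute)

text \<open>One formula for translations, dilations and, with \<open>e = -1\<close>, the reflection
  that relates \<open>inv_fourier\<close> to \<open>fourier\<close>.\<close>

lemma fourier_affine:
  fixes f :: "'a::euclidean_space \<Rightarrow> complex"
  assumes "f \<in> borel_measurable borel" and "e \<noteq> 0"
  shows "fourier (\<lambda>x. f (inverse e *\<^sub>R (x - p))) \<xi> = of_real (\<bar>e\<bar> ^ DIM('a)) * exp (- \<i> * of_real (p \<bullet> \<xi>)) * fourier f (e *\<^sub>R \<xi>)"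
proof -
  have [measurable]: "f \<in> borel_measurable borel" by fact
  have "(LINT x|lborel. exp (- \<i> * complex_of_real (x \<bullet> \<xi>)) * f (inverse e *\<^sub>R (x - p)))
    = (LINT x|lborel. exp (- \<i> * of_real (p \<bullet> \<xi>)) * (exp (- \<i> * complex_of_real ((inverse e *\<^sub>R (x - p)) \<bullet> (e *\<^sub>R \<xi>))) * f (inverse e *\<^sub>R (x - p))))"
    using \<open>e \<noteq> 0\<close> by (intro Bochner_Integration.integral_cong refl)
      (simp add: mult.assoc[symmetric] mult_exp_exp inner_diff_left algebra_simps)
  also have "\<dots> = exp (- \<i> * of_real (p \<bullet> \<xi>)) * (LINT x|lborel. (\<lambda>z. exp (- \<i> * complex_of_real (z \<bullet> (e *\<^sub>R \<xi>))) * f z) (- inverse e *\<^sub>R p + inverse e *\<^sub>R x))"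
    by (simp add: scaleR_diff_right)
  also have "\<dots> = exp (- \<i> * of_real (p \<bullet> \<xi>)) * (\<bar>e\<bar> ^ DIM('a) *\<^sub>R (LINT z|lborel. exp (- \<i> * complex_of_real (z \<bullet> (e *\<^sub>R \<xi>))) * f z))"
    using \<open>e \<noteq> 0\<close> by (subst lborel_affine_integral(1)) (auto simp: power_inverse)
  finally show ?thesis unfolding fourier_eq by (simp add: scaleR_conv_of_real)
qed

lemma inv_fourier_eq_fourier_reflect:
  assumes "f \<in> borel_measurable borel"
  shows "inv_fourier f = fourier (\<lambda>x. f (- x))"
  using fourier_affine[OF assms, of "-1" 0] by (intro ext) (simp add: inv_fourier_eq_fourier)

lemma test_functions_reflect: "f \<in> test_functions UNIV \<Longrightarrow> (\<lambda>x. f (- x)) \<in> test_functions UNIV"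
  using test_functions_affine[of f "-1" 0] by simp

lemma fourier_pderivative:
  assumes f: "f \<in> test_functions UNIV"
  shows "fourier (pderivative f v) \<xi> = \<i> * of_real (v \<bullet> \<xi>) * fourier f \<xi>"
proof -
  have "(LINT x|lborel. exp (- \<i> * complex_of_real (x \<bullet> \<xi>)) * pderivative f v x)
      = - (LINT x|lborel. (- \<i> * of_real (v \<bullet> \<xi>) * exp (- \<i> * of_real (x \<bullet> \<xi>))) * f x)"
    by (subst test_functions_integral_by_parts[OF f smooth_exp_inner])
       (simp only: pderivative_exp_inner)
  also have "\<dots> = \<i> * of_real (v \<bullet> \<xi>) * (LINT x|lborel. exp (- \<i> * of_real (x \<bullet> \<xi>)) * f x)"
    by (simp add: mult.assoc)
  finally show ?thesis unfolding fourier_eq by (simp add: mult_ac)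
qed

section \<open>Smoothness and rapid decay of the Fourier transform\<close>

lemma test_functions_coord:
  "f \<in> test_functions UNIV \<Longrightarrow> (\<lambda>x. c * of_real (x \<bullet> v) * f x) \<in> test_functions UNIV"
  by (intro test_functions_mult smooth_mult smooth_const smooth_inner)

lemma exp_i_second_order: "cmod (exp (\<i> * of_real t) - 1 - \<i> * of_real t) \<le> t\<^sup>2"
proof -
  have "cmod (exp (\<i> * of_real t) - 1 - \<i> * of_real t) \<le> t\<^sup>2 / 2"
    using iexp_approx1[of t 1] by (simp add: numeral_2_eq_2 algebra_simps)
  also have "\<dots> \<le> t\<^sup>2" by simp
  finally show ?thesis .
qed

text \<open>The second-order bound on the exponential, integrated against \<open>f\<close>, leaves a
  remainder of at most \<open>C * (norm h)\<^sup>2\<close>, where the second moment in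
  \<open>C\<close> is finite by compactness of the support.\<close>

lemma fourier_has_derivative:
  fixes f :: "'a::euclidean_space \<Rightarrow> complex"
  assumes f: "f \<in> test_functions UNIV"
  shows "(fourier f has_derivative (\<lambda>h. fourier (\<lambda>x. - \<i> * of_real (x \<bullet> h) * f x) \<xi>)) (at \<xi>)"
proof -
  let ?L = "\<lambda>h. fourier (\<lambda>x. - \<i> * of_real (x \<bullet> h) * f x) \<xi>"
  let ?N = "fourier_const TYPE('a)"
  have [measurable]: "f \<in> borel_measurable borel" using f by (rule test_functions_measurable)
  note int = test_functions_integrable[OF test_functions_coord[OF f]]
  have lin: "linear ?L"
  proof (rule linearI)
    fix h k
    show "?L (h + k) = ?L h + ?L k"
      using fourier_add[OF int int, of "-\<i>" h "- \<i>" k] by (simp add: inner_add_right algebra_simps)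
    fix r
    show "?L (r *\<^sub>R h) = r *\<^sub>R ?L h"
      unfolding scaleR_conv_of_real fourier_cmult[symmetric] by (simp add: mult_ac)
  qed
  define C where "C = ?N * (LINT x|lborel. (norm x)\<^sup>2 * cmod (f x))"
  have int2: "integrable lborel (\<lambda>x. (norm x)\<^sup>2 * cmod (f x))"
  proof -
    obtain K where K: "compact K" "\<And>x. x \<notin> K \<Longrightarrow> f x = 0"
      using test_functionsE[OF f] by metis
    obtain R where R: "\<And>x. x \<in> K \<Longrightarrow> norm x \<le> R" using K(1) compact_imp_bounded bounded_iff by metis
    obtain B where B: "B > 0" "\<And>x. cmod (f x) \<le> B" using test_functions_bounded[OF f] by metis
    show ?thesis
    proof (rule integrable_zero_outside_compact[OF _ K(1)])
      show "norm ((norm x)\<^sup>2 * cmod (f x)) \<le> R\<^sup>2 * B" if "x \<in> K" for x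
        using R[OF that] B by (auto intro!: mult_mono power_mono simp: abs_mult)
    qed (use K in auto)
  qed
  show ?thesis
  proof (rule has_derivativeI_sandwich[where e = 1 and H = "\<lambda>y. C * norm (y - \<xi>)"])
    show "bounded_linear ?L" using lin linear_conv_bounded_linear by blast
    show "((\<lambda>y. C * norm (y - \<xi>)) \<longlongrightarrow> 0) (at \<xi>)"
      by (rule tendsto_eq_intros | simp)+
    fix y assume "y \<noteq> \<xi>"
    define h where "h = y - \<xi>"
    have y: "y = \<xi> + h" by (simp add: h_def)
    have "fourier f y - fourier f \<xi> - ?L h = of_real ?N *
      (LINT x|lborel. exp (- \<i> * of_real (x \<bullet> y)) * f x - exp (- \<i> * of_real (x \<bullet> \<xi>)) * f x
        - exp (- \<i> * of_real (x \<bullet> \<xi>)) * (- \<i> * of_real (x \<bullet> h) * f x))"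
      unfolding fourier_eq using integrable_exp_mult[OF test_functions_integrable[OF f]] integrable_exp_mult[OF int]
      by (simp add: algebra_simps)
    then have "cmod (fourier f y - fourier f \<xi> - ?L h) = ?N * cmod
      (LINT x|lborel. exp (- \<i> * of_real (x \<bullet> y)) * f x - exp (- \<i> * of_real (x \<bullet> \<xi>)) * f x
        - exp (- \<i> * of_real (x \<bullet> \<xi>)) * (- \<i> * of_real (x \<bullet> h) * f x))"
      using fourier_const_pos[where 'a='a] by (simp add: norm_mult)
    also have "\<dots> \<le> ?N * (LINT x|lborel. (norm h)\<^sup>2 * ((norm x)\<^sup>2 * cmod (f x)))"
    proof (intro mult_left_mono Bochner_Integration.integral_norm_bound_integral)
      fix x
      have "exp (- \<i> * of_real (x \<bullet> y)) * f x - exp (- \<i> * of_real (x \<bullet> \<xi>)) * f x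
        - exp (- \<i> * of_real (x \<bullet> \<xi>)) * (- \<i> * of_real (x \<bullet> h) * f x)
        = exp (- \<i> * of_real (x \<bullet> \<xi>)) * f x * (exp (\<i> * of_real (- (x \<bullet> h))) - 1 - \<i> * of_real (- (x \<bullet> h)))"
        unfolding y by (simp add: inner_add_right exp_add algebra_simps exp_diff exp_minus divide_inverse)
      then have "cmod (exp (- \<i> * of_real (x \<bullet> y)) * f x - exp (- \<i> * of_real (x \<bullet> \<xi>)) * f x
        - exp (- \<i> * of_real (x \<bullet> \<xi>)) * (- \<i> * of_real (x \<bullet> h) * f x))
        = cmod (f x) * cmod (exp (\<i> * of_real (- (x \<bullet> h))) - 1 - \<i> * of_real (- (x \<bullet> h)))"
        by (simp add: norm_mult)
      also have "\<dots> \<le> cmod (f x) * (- (x \<bullet> h))\<^sup>2"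
        by (intro mult_left_mono exp_i_second_order) auto
      also have "\<dots> \<le> cmod (f x) * (norm x * norm h)\<^sup>2"
        using Cauchy_Schwarz_ineq2[of x h] by (intro mult_left_mono) (auto simp: abs_le_square_iff[symmetric])
      finally show "cmod (exp (- \<i> * of_real (x \<bullet> y)) * f x - exp (- \<i> * of_real (x \<bullet> \<xi>)) * f x
        - exp (- \<i> * of_real (x \<bullet> \<xi>)) * (- \<i> * of_real (x \<bullet> h) * f x)) \<le> (norm h)\<^sup>2 * ((norm x)\<^sup>2 * cmod (f x))"
        by (simp add: power_mult_distrib mult_ac)
    qed (use int2 integrable_exp_mult[OF test_functions_integrable[OF f]] integrable_exp_mult[OF int] fourier_const_pos[where 'a='a] in auto)
    also have "\<dots> = C * norm h * norm h"
      unfolding C_def integral_mult_right_zero by (simp add: power2_eq_square[of "norm h"])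
    finally have "cmod (fourier f y - fourier f \<xi> - ?L h) \<le> C * norm h * norm h" .
    then show "cmod (fourier f y - fourier f \<xi> - ?L (y - \<xi>)) / norm (y - \<xi>) \<le> C * norm (y - \<xi>)"
      using \<open>y \<noteq> \<xi>\<close> by (simp add: h_def field_simps)
  qed simp
qed

lemma smooth_fourier:
  assumes "f \<in> test_functions UNIV" shows "smooth (fourier f)"
proof -
  have "Ck n (fourier f)" if "f \<in> test_functions UNIV" for n and f :: "'a \<Rightarrow> complex"
    using that
  proof (induction n arbitrary: f)
    case (Suc n)
    show ?case
      by (rule Ck_SucI[OF fourier_has_derivative[OF Suc.prems]]) (rule Suc.IH[OF test_functions_coord[OF Suc.prems]])
  qed simp
  then show ?thesis using assms by (simp add: smooth_iff_Ck)
qed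

text \<open>Reduces all Schwartz seminorms of \<open>fourier f\<close> to the decay of Fourier
  transforms of other test functions.\<close>

lemma partials_fourier:
  assumes "f \<in> test_functions UNIV"
  obtains g where "g \<in> test_functions UNIV" "partials bs (fourier f) = fourier g"
proof -
  have "\<exists>g\<in>test_functions UNIV. partials bs (fourier f) = fourier g"
  proof (induction bs)
    case (Cons b bs)
    then obtain g where g: "g \<in> test_functions UNIV" "partials bs (fourier f) = fourier g" by blast
    have "pderivative (fourier g) b = fourier (\<lambda>x. - \<i> * of_real (x \<bullet> b) * g x)"
      by (rule ext) (rule frechet_derivative_at[OF fourier_has_derivative[OF g(1)], THEN fun_cong, symmetric])
    then show ?case
      using test_functions_coord[OF g(1), of "- \<i>" b] g(2) by auto
  qed (use assms in auto)
  then show ?thesis using that by blast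
qed

text \<open>A factor \<open>norm \<xi>\<close> is at most the sum of the
  \<open>\<bar>\<xi> \<bullet> b\<bar>\<close>, and each of these is traded for a derivative of
  \<open>f\<close>.\<close>

lemma fourier_decay:
  assumes "f \<in> test_functions (UNIV :: 'a::euclidean_space set)"
  obtains C where "C > 0" "\<And>\<xi>. (1 + norm \<xi>) ^ m * cmod (fourier f \<xi>) \<le> C"
proof -
  have "\<exists>C. \<forall>\<xi>. (1 + norm \<xi>) ^ m * cmod (fourier f \<xi>) \<le> C" using assms
  proof (induction m arbitrary: f)
    case 0
    show ?case using fourier_norm_le[of f] by auto
  next
    case (Suc m)
    obtain C where C: "\<And>\<xi>. (1 + norm \<xi>) ^ m * cmod (fourier f \<xi>) \<le> C" using Suc by blast
    have "\<forall>b. \<exists>D. \<forall>\<xi>. (1 + norm \<xi>) ^ m * cmod (fourier (pderivative f b) \<xi>) \<le> D"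
      using Suc.IH[OF test_functions_pderivative[OF Suc.prems]] by blast
    then obtain D where D: "\<And>b \<xi>. (1 + norm \<xi>) ^ m * cmod (fourier (pderivative f b) \<xi>) \<le> D b" by metis
    show ?case
    proof (intro exI allI)
      fix \<xi> :: 'a
      have "(1 + norm \<xi>) ^ Suc m * cmod (fourier f \<xi>) = (1 + norm \<xi>) ^ m * cmod (fourier f \<xi>) * (1 + norm \<xi>)" by simp
      also have "\<dots> \<le> (1 + norm \<xi>) ^ m * cmod (fourier f \<xi>) * (1 + (\<Sum>b\<in>Basis. \<bar>\<xi> \<bullet> b\<bar>))"
        using norm_le_l1[of \<xi>] by (intro mult_left_mono) auto
      also have "\<dots> = (1 + norm \<xi>) ^ m * cmod (fourier f \<xi>) + (\<Sum>b\<in>Basis. (1 + norm \<xi>) ^ m * cmod (fourier (pderivative f b) \<xi>))"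
        by (simp add: distrib_left sum_distrib_left fourier_pderivative[OF Suc.prems] norm_mult inner_commute mult_ac)
      also have "\<dots> \<le> C + (\<Sum>b\<in>Basis. D b)" by (intro add_mono sum_mono C D)
      finally show "(1 + norm \<xi>) ^ Suc m * cmod (fourier f \<xi>) \<le> C + (\<Sum>b\<in>Basis. D b)" .
    qed
  qed
  then obtain C where C: "\<forall>\<xi>. (1 + norm \<xi>) ^ m * cmod (fourier f \<xi>) \<le> C" by blast
  show ?thesis by (rule that[of "max C 1"]) (use C in \<open>auto intro: le_max_iff_disj[THEN iffD2]\<close>)
qed

lemma fourier_schwartz:
  assumes "f \<in> test_functions UNIV" shows "fourier f \<in> schwartz_functions"
proof -
  have "bounded (range (\<lambda>x. (1 + norm x) ^ N * cmod (partials bs (fourier f) x)))" for bs N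
  proof -
    obtain g where g: "g \<in> test_functions UNIV" "partials bs (fourier f) = fourier g"
      using partials_fourier[OF assms] by metis
    obtain C where "\<And>\<xi>. (1 + norm \<xi>) ^ N * cmod (fourier g \<xi>) \<le> C" using fourier_decay[OF g(1)] by metis
    then show ?thesis unfolding g(2) bounded_iff by (intro exI[of _ C]) auto
  qed
  then show ?thesis unfolding schwartz_functions_def using smooth_fourier[OF assms] by blast
qed

lemma integrable_if_decay:
  fixes g :: "'a::euclidean_space \<Rightarrow> complex"
  assumes [measurable]: "g \<in> borel_measurable borel" and "\<And>x. (1 + norm x) ^ (2 * DIM('a)) * cmod (g x) \<le> C"
  shows "integrable lborel g"
proof (rule Bochner_Integration.integrable_bound)
  show "integrable lborel (\<lambda>x::'a. C * inverse ((1 + norm x) ^ (2 * DIM('a))))"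
    by (intro integrable_mult_right integrable_polynomial_decay)
  show "AE x in lborel. cmod (g x) \<le> norm (C * inverse ((1 + norm x) ^ (2 * DIM('a))))"
  proof (intro AE_I2)
    fix x :: 'a
    have "(1 + norm x) ^ (2 * DIM('a)) > 0" by (simp add: add_pos_nonneg)
    then have "cmod (g x) \<le> C * inverse ((1 + norm x) ^ (2 * DIM('a)))"
      using assms(2)[of x] by (simp add: field_simps)
    then show "cmod (g x) \<le> norm (C * inverse ((1 + norm x) ^ (2 * DIM('a))))" by simp
  qed
qed simp

lemma schwartz_integrable:
  assumes "\<phi> \<in> schwartz_functions" shows "integrable lborel \<phi>"
proof -
  have s: "smooth \<phi>" and bs: "\<And>bs N. set bs \<subseteq> Basis \<Longrightarrow> bounded (range (\<lambda>x. (1 + norm x) ^ N * cmod (partials bs \<phi> x)))"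
    using assms unfolding schwartz_functions_def by auto
  obtain C where "\<And>x. norm ((1 + norm x) ^ (2 * DIM('a)) * cmod (\<phi> x)) \<le> C"
    using bs[of "[]" "2 * DIM('a)"] unfolding bounded_iff by auto
  then have "(1 + norm x) ^ (2 * DIM('a)) * cmod (\<phi> x) \<le> C" for x
    unfolding real_norm_def using abs_le_D1 by blast
  then show ?thesis using smooth_measurable[OF s] by (intro integrable_if_decay)
qed

lemma test_functions_schwartz:
  assumes "\<phi> \<in> test_functions UNIV" shows "\<phi> \<in> schwartz_functions"
proof -
  have "bounded (range (\<lambda>x. (1 + norm x) ^ N * cmod (partials bs \<phi> x)))" for bs N
  proof -
    let ?p = "partials bs \<phi>"
    have p: "?p \<in> test_functions UNIV" using partials_test_functions[OF assms] .
    obtain K where K: "compact K" "\<And>x. x \<notin> K \<Longrightarrow> ?p x = 0" using test_functionsE[OF p] by metis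
    obtain R where R: "\<And>x. x \<in> K \<Longrightarrow> norm x \<le> R" using K(1) compact_imp_bounded bounded_iff by metis
    obtain B where B: "B > 0" "\<And>x. cmod (?p x) \<le> B" using test_functions_bounded[OF p] by metis
    have "norm ((1 + norm x) ^ N * cmod (?p x)) \<le> \<bar>1 + R\<bar> ^ N * B" for x
    proof (cases "x \<in> K")
      case True
      have "(1 + norm x) ^ N \<le> \<bar>1 + R\<bar> ^ N" using R[OF True] by (intro power_mono) auto
      then show ?thesis using B by (auto simp: abs_mult intro!: mult_mono)
    qed (use K B in auto)
    then show ?thesis unfolding bounded_iff by blast
  qed
  then show ?thesis unfolding schwartz_functions_def using test_functions_smooth[OF assms] by blast
qed


section \<open>Duality, the Gaussian and Fourier inversion\<close>

lemma integrable_pair_mult: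
  fixes f :: "'a::euclidean_space \<Rightarrow> complex" and g :: "'b::euclidean_space \<Rightarrow> complex"
  assumes f: "integrable lborel f" and g: "integrable lborel g"
  shows "integrable (lborel \<Otimes>\<^sub>M lborel) (\<lambda>(x, y). f x * g y)"
proof -
  have [measurable]: "f \<in> borel_measurable borel" "g \<in> borel_measurable borel"
    using borel_measurable_integrable[OF f] borel_measurable_integrable[OF g] by simp_all
  show ?thesis
    by (rule lborel_pair.Fubini_integrable) (use f g in \<open>auto simp: norm_mult\<close>)
qed

text \<open>The kernel is symmetric in its two variables and of modulus 1, so Fubini applies as soon
  as both functions are integrable.\<close>

lemma fourier_duality:
  fixes f g :: "'a::euclidean_space \<Rightarrow> complex"
  assumes f: "integrable lborel f" and g: "integrable lborel g"
  shows "(LINT x|lborel. f x * fourier g x) = (LINT x|lborel. fourier f x * g x)"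
proof -
  have [measurable]: "f \<in> borel_measurable borel" "g \<in> borel_measurable borel"
    using borel_measurable_integrable[OF f] borel_measurable_integrable[OF g] by simp_all
  have int: "integrable (lborel \<Otimes>\<^sub>M lborel) (\<lambda>(x, y). f x * (exp (- \<i> * complex_of_real (y \<bullet> x)) * g y))"
    by (rule Bochner_Integration.integrable_bound[OF integrable_pair_mult[OF f g]])
       (auto simp: norm_mult split_beta)
  have "(LINT x|lborel. f x * fourier g x) = of_real (fourier_const TYPE('a)) *
      (LINT x|lborel. (LINT y|lborel. f x * (exp (- \<i> * complex_of_real (y \<bullet> x)) * g y)))"
    unfolding fourier_eq by (simp add: mult.left_commute[of _ "complex_of_real (fourier_const TYPE('a))"])
  also have "(LINT x|lborel. (LINT y|lborel. f x * (exp (- \<i> * complex_of_real (y \<bullet> x)) * g y)))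
     = (LINT y|lborel. (LINT x|lborel. f x * (exp (- \<i> * complex_of_real (y \<bullet> x)) * g y)))"
    using lborel_pair.Fubini_integral[OF int] by simp
  also have "\<dots> = (LINT y|lborel. (LINT x|lborel. exp (- \<i> * complex_of_real (x \<bullet> y)) * f x) * g y)"
    by (intro Bochner_Integration.integral_cong refl)
       (subst integral_mult_left_zero[symmetric], simp add: inner_commute mult_ac)
  finally show ?thesis unfolding fourier_eq by (simp add: mult.assoc)
qed

definition gauss :: "'a::euclidean_space \<Rightarrow> complex" where
  "gauss x = complex_of_real (exp (- (norm x)\<^sup>2 / 2))"

lemma gauss_measurable [measurable]: "gauss \<in> borel_measurable borel"
  unfolding gauss_def[abs_def] by measurable

text \<open>This is the known characteristic function of the standard normal distribution, cleared
  of the constant factor in its density.\<close>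

lemma gauss_real: "integrable lborel (\<lambda>t::real. exp (\<i> * of_real (w * t)) * of_real (exp (- t\<^sup>2 / 2)))"
    "(LINT t|lborel. exp (\<i> * of_real (w * t)) * complex_of_real (exp (- t\<^sup>2 / 2)))
       = of_real (sqrt (2 * pi) * exp (- w\<^sup>2 / 2))"
proof -
  have sd: "std_normal_density t = exp (- t\<^sup>2 / 2) / sqrt (2 * pi)" for t
    by (simp add: std_normal_density_def)
  have "integrable lborel (\<lambda>t. sqrt (2 * pi) * std_normal_density t)"
    using integrable_normal_density[of 1 0] by (intro integrable_mult_right) auto
  then have "integrable lborel (\<lambda>t::real. exp (- t\<^sup>2 / 2))" by (simp add: sd)
  then show "integrable lborel (\<lambda>t::real. exp (\<i> * of_real (w * t)) * complex_of_real (exp (- t\<^sup>2 / 2)))"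
    by (rule Bochner_Integration.integrable_bound) (auto simp: norm_mult simp flip: of_real_mult)
  have "char std_normal_distribution w = of_real (exp (- w\<^sup>2 / 2))"
    using char_std_normal_distribution by (simp add: fun_eq_iff)
  then have "(LINT t|lborel. std_normal_density t *\<^sub>R exp (\<i> * of_real (w * t))) = complex_of_real (exp (- w\<^sup>2 / 2))"
    unfolding char_def by (subst (asm) integral_density) auto
  moreover have "std_normal_density t *\<^sub>R exp (\<i> * of_real (w * t)) =
     of_real (inverse (sqrt (2 * pi))) * (exp (\<i> * of_real (w * t)) * complex_of_real (exp (- t\<^sup>2 / 2)))" for t
    unfolding sd scaleR_conv_of_real by (simp add: field_simps)
  ultimately have "of_real (inverse (sqrt (2 * pi))) * (LINT t|lborel. exp (\<i> * of_real (w * t)) * complex_of_real (exp (- t\<^sup>2 / 2)))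
     = complex_of_real (exp (- w\<^sup>2 / 2))"
    by (metis (no_types, lifting) Bochner_Integration.integral_cong integral_mult_right_zero)
  then show "(LINT t|lborel. exp (\<i> * of_real (w * t)) * complex_of_real (exp (- t\<^sup>2 / 2)))
       = of_real (sqrt (2 * pi) * exp (- w\<^sup>2 / 2))"
    by (simp add: field_simps)
qed

lemma gauss_prod: "gauss x = (\<Prod>b\<in>Basis. of_real (exp (- (x \<bullet> b)\<^sup>2 / 2)))"
proof -
  have "(norm x)\<^sup>2 = (\<Sum>b\<in>Basis. (x \<bullet> b)\<^sup>2)"
    unfolding power2_norm_eq_inner euclidean_inner[of x x] by (simp add: power2_eq_square)
  then show ?thesis
    unfolding gauss_def of_real_prod[symmetric]
    by (simp add: exp_sum[symmetric] sum_negf sum_divide_distrib)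
qed

lemma gauss_integrable: "integrable lborel (gauss :: 'a::euclidean_space \<Rightarrow> complex)"
  unfolding gauss_prod[abs_def] using gauss_real(1)[of 0]
  by (intro lborel_integral_prod_Basis(1)[where f = "\<lambda>_ t. of_real (exp (- t\<^sup>2 / 2))"]) simp

lemma fourier_gauss: "fourier gauss (\<xi>::'a::euclidean_space) = gauss \<xi>"
proof -
  have "exp (- \<i> * complex_of_real (x \<bullet> \<xi>)) * gauss x =
     (\<Prod>b\<in>Basis. exp (\<i> * of_real (- (\<xi> \<bullet> b) * (x \<bullet> b))) * of_real (exp (- (x \<bullet> b)\<^sup>2 / 2)))" for x :: 'a
  proof -
    have "exp (- \<i> * complex_of_real (x \<bullet> \<xi>)) = (\<Prod>b\<in>Basis. exp (\<i> * of_real (- (\<xi> \<bullet> b) * (x \<bullet> b))))"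
      unfolding euclidean_inner[of x \<xi>] exp_sum[OF finite_Basis, symmetric]
      by (simp add: sum_distrib_left sum_negf mult_ac)
    then show ?thesis by (simp add: gauss_prod prod.distrib)
  qed
  then have "fourier gauss \<xi> = of_real (fourier_const TYPE('a)) * (\<Prod>b\<in>(Basis::'a set). of_real (sqrt (2 * pi) * exp (- (\<xi> \<bullet> b)\<^sup>2 / 2)))"
    unfolding fourier_eq
    by (simp only: lborel_integral_prod_Basis(2)[OF gauss_real(1), where 'a='a] gauss_real(2)) simp
  also have "\<dots> = of_real (fourier_const TYPE('a) * sqrt (2 * pi) ^ DIM('a)) * gauss \<xi>"
    by (simp add: gauss_prod prod.distrib)
  also have "fourier_const TYPE('a) * sqrt (2 * pi) ^ DIM('a) = 1"
    by (simp add: fourier_const_def powr_half_sqrt[symmetric] powr_realpow[symmetric] powr_powr powr_add[symmetric])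
  finally show ?thesis by simp
qed

text \<open>The damping factor of the inversion integral is transformed into an approximate identity
  around \<open>x\<close> of width \<open>e\<close>.\<close>

lemma fourier_scaled_gauss:
  assumes "e > 0"
  shows "fourier (\<lambda>\<xi>. exp (\<i> * of_real (x \<bullet> \<xi>)) * gauss (e *\<^sub>R \<xi>)) y =
    of_real (inverse e ^ DIM('a)) * gauss (inverse e *\<^sub>R (y - x :: 'a::euclidean_space))"
proof -
  have "fourier (\<lambda>\<xi>. exp (\<i> * of_real (x \<bullet> \<xi>)) * gauss (e *\<^sub>R \<xi>)) y = fourier (\<lambda>\<xi>. gauss (inverse (inverse e) *\<^sub>R (\<xi> - 0))) (y - x)"
  proof -
    have "exp (- \<i> * complex_of_real (\<xi> \<bullet> y)) * exp (\<i> * of_real (x \<bullet> \<xi>)) = exp (- \<i> * complex_of_real (\<xi> \<bullet> (y - x)))" for \<xi>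
      unfolding mult_exp_exp by (simp add: inner_diff_right inner_commute algebra_simps)
    then show ?thesis unfolding fourier_eq mult.assoc[symmetric] by simp
  qed
  also have "\<dots> = of_real (inverse e ^ DIM('a)) * gauss (inverse e *\<^sub>R (y - x))"
    using assms by (subst fourier_affine) (auto simp: fourier_gauss)
  finally show ?thesis .
qed

text \<open>Inversion by Gaussian regularisation.\<close>

lemma fourier_inversion:
  fixes f :: "'a::euclidean_space \<Rightarrow> complex"
  assumes cont: "continuous_on UNIV f" and f: "integrable lborel f" and bound: "\<And>x. cmod (f x) \<le> B"
    and F: "integrable lborel (fourier f)"
  shows "inv_fourier (fourier f) x = f x"
proof -
  have [measurable]: "f \<in> borel_measurable borel" using cont by (rule borel_measurable_continuous_onI)
  define e where "e n = inverse (real (Suc n))" for n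
  have e: "e n > 0" for n by (simp add: e_def)
  have e0: "e \<longlonglongrightarrow> 0" unfolding e_def by (rule LIMSEQ_inverse_real_of_nat)
  have gauss_le: "cmod (gauss z) \<le> 1" for z :: 'a by (simp add: gauss_def)
  have gauss_cont: "continuous_on UNIV (gauss :: 'a \<Rightarrow> complex)"
    unfolding gauss_def[abs_def] by (intro continuous_intros) auto
  \<comment> \<open>The damped inversion integral. Its limit is computed twice: with the damping
    removed under the integral, and, after moving the transform by duality, as a Gaussian average of
    \<open>f\<close> around \<open>x\<close>.\<close>
  define A where "A n = (LINT \<xi>|lborel. fourier f \<xi> * (exp (\<i> * of_real (x \<bullet> \<xi>)) * gauss (e n *\<^sub>R \<xi>)))" for n
  have "A \<longlonglongrightarrow> (LINT \<xi>|lborel. fourier f \<xi> * exp (\<i> * of_real (x \<bullet> \<xi>)))"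
    unfolding A_def
  proof (rule integral_dominated_convergence[where w = "\<lambda>\<xi>. cmod (fourier f \<xi>)"])
    show "AE \<xi> in lborel. (\<lambda>n. fourier f \<xi> * (exp (\<i> * of_real (x \<bullet> \<xi>)) * gauss (e n *\<^sub>R \<xi>))) \<longlonglongrightarrow> fourier f \<xi> * exp (\<i> * of_real (x \<bullet> \<xi>))"
    proof (intro AE_I2)
      fix \<xi> :: 'a
      have "(\<lambda>n. gauss (e n *\<^sub>R \<xi>)) \<longlonglongrightarrow> gauss (0 *\<^sub>R \<xi>)"
        by (rule continuous_on_tendsto_compose[OF gauss_cont tendsto_scaleR[OF e0 tendsto_const]]) auto
      then have "(\<lambda>n. fourier f \<xi> * (exp (\<i> * of_real (x \<bullet> \<xi>)) * gauss (e n *\<^sub>R \<xi>))) \<longlonglongrightarrow> fourier f \<xi> * (exp (\<i> * of_real (x \<bullet> \<xi>)) * gauss (0 *\<^sub>R \<xi>))"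
        by (intro tendsto_mult tendsto_const)
      then show "(\<lambda>n. fourier f \<xi> * (exp (\<i> * of_real (x \<bullet> \<xi>)) * gauss (e n *\<^sub>R \<xi>))) \<longlonglongrightarrow> fourier f \<xi> * exp (\<i> * of_real (x \<bullet> \<xi>))"
        by (simp add: gauss_def)
    qed
    show "AE \<xi> in lborel. cmod (fourier f \<xi> * (exp (\<i> * of_real (x \<bullet> \<xi>)) * gauss (e n *\<^sub>R \<xi>))) \<le> cmod (fourier f \<xi>)" for n
      using gauss_le by (auto simp: norm_mult intro!: mult_left_le)
  qed (use F in \<open>auto intro!: integrable_norm\<close>)
  moreover have "A n = (LINT z|lborel. f (x + e n *\<^sub>R z) * gauss z)" for n
  proof -
    have g: "integrable lborel (\<lambda>\<xi>. exp (\<i> * of_real (x \<bullet> \<xi>)) * gauss (e n *\<^sub>R \<xi>))"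
    proof (rule Bochner_Integration.integrable_bound)
      show "integrable lborel (\<lambda>\<xi>::'a. gauss (0 + e n *\<^sub>R \<xi>))"
        using e[of n] gauss_integrable by (subst lborel_affine_integral(2)) auto
    qed (auto simp: norm_mult)
    have "A n = (LINT y|lborel. f y * (of_real (inverse (e n) ^ DIM('a)) * gauss (inverse (e n) *\<^sub>R (y - x))))"
      unfolding A_def fourier_duality[OF f g, symmetric] fourier_scaled_gauss[OF e] ..
    also have "\<dots> = of_real (inverse (e n) ^ DIM('a)) * (LINT y|lborel. f y * gauss (inverse (e n) *\<^sub>R (y - x)))"
      by (subst integral_mult_right_zero[symmetric]) (simp only: mult.left_commute)
    also have "(LINT y|lborel. f y * gauss (inverse (e n) *\<^sub>R (y - x))) =
       (e n) ^ DIM('a) *\<^sub>R (LINT z|lborel. f (x + e n *\<^sub>R z) * gauss (inverse (e n) *\<^sub>R (x + e n *\<^sub>R z - x)))"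
      using e[of n] by (subst lborel_affine_integral(1)[of "e n" _ x]) auto
    finally show ?thesis using e[of n] by (simp add: scaleR_conv_of_real power_inverse)
  qed
  moreover have "(\<lambda>n. LINT z|lborel. f (x + e n *\<^sub>R z) * gauss z) \<longlonglongrightarrow> (LINT z::'a|lborel. f x * gauss z)"
  proof (rule integral_dominated_convergence[where w = "\<lambda>z::'a. B * cmod (gauss z)"])
    show "AE z in lborel. (\<lambda>n. f (x + e n *\<^sub>R z) * gauss z) \<longlonglongrightarrow> f x * gauss z"
    proof (intro AE_I2 tendsto_mult tendsto_const)
      fix z
      have "(\<lambda>n. f (x + e n *\<^sub>R z)) \<longlonglongrightarrow> f (x + 0 *\<^sub>R z)"
        by (rule continuous_on_tendsto_compose[OF cont]) (auto intro!: tendsto_eq_intros e0)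
      then show "(\<lambda>n. f (x + e n *\<^sub>R z)) \<longlonglongrightarrow> f x" by simp
    qed
    show "AE z in lborel. cmod (f (x + e n *\<^sub>R z) * gauss z) \<le> B * cmod (gauss z)" for n
      using bound by (auto simp: norm_mult intro!: mult_right_mono)
  qed (auto intro!: integrable_norm gauss_integrable integrable_mult_right)
  ultimately have "(LINT \<xi>|lborel. fourier f \<xi> * exp (\<i> * of_real (x \<bullet> \<xi>))) = f x * (LINT z::'a|lborel. gauss z)"
    using LIMSEQ_unique by (metis (no_types, lifting) LIMSEQ_unique ext integral_mult_right_zero)
  \<comment> \<open>Evaluating \<open>fourier_gauss\<close> at 0 gives the total mass of the
    Gaussian.\<close>
  moreover have "of_real (fourier_const TYPE('a)) * (LINT z::'a|lborel. gauss z) = 1"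
    using fourier_gauss[of "0::'a"] by (simp add: fourier_eq gauss_def)
  ultimately show ?thesis
    unfolding inv_fourier_eq_fourier fourier_eq[of "fourier f"]
    by (simp add: inner_commute mult_ac)
qed

lemma inv_fourier_fourier:
  assumes "f \<in> test_functions UNIV" shows "inv_fourier (fourier f) = f"
proof
  obtain B where "\<And>x. cmod (f x) \<le> B" using test_functions_bounded[OF assms] by metis
  then show "inv_fourier (fourier f) x = f x" for x
    using assms by (intro fourier_inversion schwartz_integrable[OF fourier_schwartz])
      (auto intro: test_functions_integrable smooth_continuous test_functions_smooth)
qed

lemma inv_fourier_schwartz:
  "f \<in> test_functions UNIV \<Longrightarrow> inv_fourier f \<in> schwartz_functions"
  by (simp add: inv_fourier_eq_fourier_reflect test_functions_measurable fourier_schwartz test_functions_reflect)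

text \<open>The inverse transform is the transform of the reflected function, so this is the other
  inversion formula applied to the reflection.\<close>

lemma fourier_inv_fourier:
  assumes f: "f \<in> test_functions UNIV" shows "fourier (inv_fourier f) = f"
proof
  fix x
  have "fourier (inv_fourier f) x = inv_fourier (fourier (\<lambda>x. f (- x))) (- x)"
    unfolding inv_fourier_eq_fourier[of _ "- x"] inv_fourier_eq_fourier_reflect[OF test_functions_measurable[OF f]]
    by simp
  also have "\<dots> = f x" using inv_fourier_fourier[OF test_functions_reflect[OF f]] by simp
  finally show "fourier (inv_fourier f) x = f x" .
qed

text \<open>An affine symbol covers both cases at once: \<open>a = 0\<close> is transport and
  \<open>c = 0\<close> is multiplication by a constant.\<close>

lemma fourier_multiplier_affine_symbol:
  assumes f: "f \<in> test_functions UNIV"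
  shows "fourier_multiplier (\<lambda>\<xi>. a + c \<bullet> \<xi>) f = (\<lambda>x. of_real a * f x - \<i> * pderivative f c x)"
proof -
  have t: "(\<lambda>x. of_real a * f x) \<in> test_functions UNIV" "(\<lambda>x. - \<i> * pderivative f c x) \<in> test_functions UNIV"
    by (rule test_functions_mult[OF _ smooth_const], fact f)
       (rule test_functions_mult[OF test_functions_pderivative[OF f] smooth_const])
  have "fourier (\<lambda>x. of_real a * f x + - \<i> * pderivative f c x) \<xi> = of_real (a + c \<bullet> \<xi>) * fourier f \<xi>" for \<xi>
    unfolding fourier_add[OF t[THEN test_functions_integrable]] fourier_cmult fourier_pderivative[OF f]
    by (simp add: algebra_simps)
  then have "fourier_multiplier (\<lambda>\<xi>. a + c \<bullet> \<xi>) f = inv_fourier (fourier (\<lambda>x. of_real a * f x + - \<i> * pderivative f c x))"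
    unfolding fourier_multiplier_def by presburger
  also have "\<dots> = (\<lambda>x. of_real a * f x + - \<i> * pderivative f c x)"
    by (rule inv_fourier_fourier[OF test_functions_add[OF t]])
  finally show ?thesis by simp
qed

section \<open>The explicit solution\<close>

text \<open>Here \<open>y\<close> labels a characteristic and \<open>y - t *\<^sub>R c\<close> is
  its position at time \<open>t\<close>. The map straightens the transport and preserves Lebesgue
  measure.\<close>

definition shear :: "'a::euclidean_space \<Rightarrow> real \<times> 'a \<Rightarrow> real \<times> 'a" where
  "shear c = (\<lambda>(t, y). (t, y - t *\<^sub>R c))"

lemma shear_measurable [measurable]: "shear c \<in> borel_measurable borel"
  unfolding shear_def borel_prod[symmetric] by measurable

lemma shear_continuous: "continuous_on A (shear c)"
  unfolding shear_def case_prod_beta by (intro continuous_intros)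

lemma nn_integral_lborel_shear:
  fixes f :: "real \<times> 'a::euclidean_space \<Rightarrow> ennreal"
  assumes [measurable]: "f \<in> borel_measurable borel"
  shows "(\<integral>\<^sup>+p. f (shear c p) \<partial>lborel) = (\<integral>\<^sup>+p. f p \<partial>lborel)"
proof -
  have "(\<integral>\<^sup>+p. f (shear c p) \<partial>lborel) = (\<integral>\<^sup>+t. (\<integral>\<^sup>+y. f (t, - (t *\<^sub>R c) + 1 *\<^sub>R y) \<partial>lborel) \<partial>lborel)"
  proof -
    have "(\<lambda>p. f (shear c p)) \<in> borel_measurable (lborel \<Otimes>\<^sub>M lborel)"
      unfolding lborel_prod by measurable
    from lborel.nn_integral_fst[OF this, symmetric] show ?thesis
      by (simp add: lborel_prod) (simp add: shear_def)
  qed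
  also have "\<dots> = (\<integral>\<^sup>+t. (\<integral>\<^sup>+y. f (t, y) \<partial>lborel) \<partial>lborel)"
  proof (rule nn_integral_cong)
    fix t :: real
    have "Pair t \<in> borel_measurable (borel :: 'a measure)"
      by (intro borel_measurable_continuous_onI continuous_intros)
    from measurable_compose[OF this assms]
    show "(\<integral>\<^sup>+y. f (t, - (t *\<^sub>R c) + 1 *\<^sub>R y) \<partial>lborel) = (\<integral>\<^sup>+y. f (t, y) \<partial>lborel)"
      using nn_integral_lborel_affine[of 1 "\<lambda>y. f (t, y)" "- (t *\<^sub>R c)"] by simp
  qed
  also have "\<dots> = (\<integral>\<^sup>+p. f p \<partial>lborel)"
  proof -
    have "f \<in> borel_measurable (lborel \<Otimes>\<^sub>M lborel)" unfolding lborel_prod by measurable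
    from lborel.nn_integral_fst[OF this] show ?thesis by (simp add: lborel_prod)
  qed
  finally show ?thesis .
qed

lemma lborel_distr_shear: "distr lborel borel (shear c) = (lborel :: (real \<times> 'a::euclidean_space) measure)"
proof (rule measure_eqI)
  fix A assume "A \<in> sets (distr lborel borel (shear c))"
  then have [measurable]: "A \<in> sets borel" by simp
  have "emeasure (distr lborel borel (shear c)) A = (\<integral>\<^sup>+p. indicator A p \<partial>distr lborel borel (shear c))"
    by simp
  also have "\<dots> = (\<integral>\<^sup>+p. indicator A (shear c p) \<partial>lborel)"
    by (subst nn_integral_distr) auto
  also have "\<dots> = (\<integral>\<^sup>+p. indicator A p \<partial>lborel)"
    by (rule nn_integral_lborel_shear) measurable
  finally show "emeasure (distr lborel borel (shear c)) A = emeasure lborel A" by simp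
qed simp

lemma lborel_integral_shear:
  fixes f :: "real \<times> 'a::euclidean_space \<Rightarrow> complex"
  assumes [measurable]: "f \<in> borel_measurable borel"
  shows "(LINT p|lborel. f (shear c p)) = (LINT p|lborel. f p)"
    and "integrable lborel (\<lambda>p. f (shear c p)) \<longleftrightarrow> integrable lborel f"
  using integral_distr[of "shear c" lborel borel f] integrable_distr_eq[of "shear c" lborel borel f]
  by (simp_all add: lborel_distr_shear)

lemma shear_inverse: "shear (- c) (shear c p) = p" "shear c (shear (- c) p) = p"
  by (auto simp: shear_def split: prod.split)

section \<open>Distributions given by integrable functions\<close>

lemma cmod_le_SUP:
  assumes "\<And>x. cmod (\<phi> x) \<le> B" shows "cmod (\<phi> x) \<le> (SUP x. cmod (\<phi> x))"
  by (rule cSUP_upper) (use assms in \<open>auto intro!: bdd_aboveI2\<close>)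

lemma integrable_mult_bounded:
  fixes f \<phi> :: "'a::euclidean_space \<Rightarrow> complex"
  assumes f: "integrable lborel f" and [measurable]: "\<phi> \<in> borel_measurable borel" and B: "\<And>x. cmod (\<phi> x) \<le> B"
  shows "integrable lborel (\<lambda>x. f x * \<phi> x)"
proof -
  have [measurable]: "f \<in> borel_measurable borel" using borel_measurable_integrable[OF f] by simp
  show ?thesis
  proof (rule Bochner_Integration.integrable_bound)
    show "integrable lborel (\<lambda>x. f x * of_real B)" using f by simp
    show "AE x in lborel. cmod (f x * \<phi> x) \<le> cmod (f x * of_real B)"
    proof (intro AE_I2)
      fix x
      have "cmod (\<phi> x) \<le> \<bar>B\<bar>" using B[of x] by simp
      then show "cmod (f x * \<phi> x) \<le> cmod (f x * of_real B)" by (simp add: norm_mult mult_left_mono)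
    qed
  qed simp
qed

lemma multi_indices_0: "multi_indices 0 = {[]}"
  by (auto simp: multi_indices_def)

text \<open>With \<open>V\<close> left open, the same estimate of order zero serves distributions
  and tempered distributions.\<close>

lemma regular_dist_bounds:
  fixes f :: "'a::euclidean_space \<Rightarrow> complex"
  assumes f: "integrable lborel f"
    and V: "\<And>\<phi>. \<phi> \<in> V \<Longrightarrow> \<phi> \<in> borel_measurable borel" "\<And>\<phi>. \<phi> \<in> V \<Longrightarrow> \<exists>B. \<forall>x. cmod (\<phi> x) \<le> B"
  shows "linear_on_space V (regular_dist f)"
    and "\<And>\<phi>. \<phi> \<in> V \<Longrightarrow> cmod (regular_dist f \<phi>) \<le> (LINT x|lborel. cmod (f x)) * (SUP x. cmod (\<phi> x))"
proof -
  have int: "integrable lborel (\<lambda>x. f x * \<phi> x)" if "\<phi> \<in> V" for \<phi>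
    using integrable_mult_bounded[OF f V(1)[OF that]] V(2)[OF that] by blast
  show "linear_on_space V (regular_dist f)"
    unfolding linear_on_space_def regular_dist_def using int
    by (auto simp: distrib_left mult.left_commute)
  fix \<phi> assume \<phi>: "\<phi> \<in> V"
  then obtain B where B: "\<And>x. cmod (\<phi> x) \<le> B" using V(2) by blast
  have "cmod (regular_dist f \<phi>) \<le> (LINT x|lborel. cmod (f x) * (SUP x. cmod (\<phi> x)))"
    unfolding regular_dist_def
    by (intro Bochner_Integration.integral_norm_bound_integral int[OF \<phi>])
       (use f in \<open>auto simp: norm_mult intro!: mult_left_mono cmod_le_SUP[OF B]\<close>)
  then show "cmod (regular_dist f \<phi>) \<le> (LINT x|lborel. cmod (f x)) * (SUP x. cmod (\<phi> x))" by simp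
qed

lemma schwartz_bounded:
  assumes "\<phi> \<in> schwartz_functions" shows "\<exists>B. \<forall>x. cmod (\<phi> x) \<le> B"
proof -
  have bs: "\<And>bs N. set bs \<subseteq> Basis \<Longrightarrow> bounded (range (\<lambda>x. (1 + norm x) ^ N * cmod (partials bs \<phi> x)))"
    using assms unfolding schwartz_functions_def by auto
  show ?thesis using bs[of "[]" 0] unfolding bounded_iff by auto
qed

lemma schwartz_measurable: "\<phi> \<in> schwartz_functions \<Longrightarrow> \<phi> \<in> borel_measurable borel"
  using smooth_measurable by (auto simp: schwartz_functions_def)

lemma test_functions_bounded': "\<phi> \<in> test_functions \<Omega> \<Longrightarrow> \<exists>B. \<forall>x. cmod (\<phi> x) \<le> B"
  using test_functions_bounded by metis

lemma distribution_regular_dist: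
  assumes "integrable lborel f" shows "distribution UNIV (regular_dist f)"
  unfolding distribution_def
proof (intro conjI allI impI)
  show "linear_on_space (test_functions UNIV) (regular_dist f)"
    by (intro regular_dist_bounds assms test_functions_measurable test_functions_bounded')
  fix K :: "'a set"
  have "cmod (regular_dist f \<phi>) \<le> (LINT x|lborel. cmod (f x)) * (SUP x. cmod (\<phi> x))" if "\<phi> \<in> test_functions K" for \<phi>
    using that by (intro regular_dist_bounds(2)[where V = "test_functions K"] assms test_functions_measurable test_functions_bounded')
  then show "\<exists>C N. \<forall>\<phi>\<in>test_functions K. cmod (regular_dist f \<phi>) \<le> C * (\<Sum>bs\<in>multi_indices N. SUP x. cmod (partials bs \<phi> x))"
    by (intro exI[of _ "LINT x|lborel. cmod (f x)"] exI[of _ 0]) (simp add: multi_indices_0)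
qed

lemma tempered_regular_dist:
  assumes "integrable lborel f" shows "tempered_distribution (regular_dist f)"
  unfolding tempered_distribution_def
proof (intro conjI)
  show "linear_on_space schwartz_functions (regular_dist f)"
    by (intro regular_dist_bounds assms schwartz_measurable schwartz_bounded)
  have "cmod (regular_dist f \<phi>) \<le> (LINT x|lborel. cmod (f x)) * (SUP x. cmod (\<phi> x))" if "\<phi> \<in> schwartz_functions" for \<phi>
    using that by (intro regular_dist_bounds(2)[where V = schwartz_functions] assms schwartz_measurable schwartz_bounded)
  then show "\<exists>C N. \<forall>\<phi>\<in>schwartz_functions. cmod (regular_dist f \<phi>) \<le> C * (\<Sum>bs\<in>multi_indices N. SUP x. (1 + norm x) ^ N * cmod (partials bs \<phi> x))"
    by (intro exI[of _ "LINT x|lborel. cmod (f x)"] exI[of _ 0]) (simp add: multi_indices_0)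
qed

section \<open>The flow on the values and its weak continuity in time\<close>

definition evolve :: "real \<Rightarrow> real \<Rightarrow> real \<Rightarrow> real \<Rightarrow> complex \<Rightarrow> complex" where
  "evolve a lam \<sigma> t z = z * exp (\<i> * of_real ((a - lam * cmod z powr (2 * \<sigma>)) * t))"

lemma cmod_evolve [simp]: "cmod (evolve a lam \<sigma> t z) = cmod z"
  by (simp add: evolve_def norm_mult)

lemma evolve_0 [simp]: "evolve a lam \<sigma> 0 z = z"
  by (simp add: evolve_def)

lemma evolve_measurable [measurable]:
  assumes [measurable]: "f \<in> borel_measurable M" "g \<in> borel_measurable M"
  shows "(\<lambda>x. evolve a lam \<sigma> (f x) (g x)) \<in> borel_measurable M"
  unfolding evolve_def by measurable

lemma compact_translates:
  fixes c :: "'a::real_normed_vector"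
  assumes "compact K"
  shows "compact ((\<lambda>(x, t). x + t *\<^sub>R c) ` (K \<times> {-T..T}))"
  unfolding case_prod_beta
  by (intro compact_continuous_image compact_Times assms) (auto intro!: continuous_intros)

text \<open>The translation is placed on the test function, which is continuous, so \<open>b\<close>
  may be merely locally integrable. Along a convergent sequence of times the shifted supports stay
  in one compact set \<open>K'\<close>, which yields the dominating function.\<close>

lemma evolve_weak_continuous:
  fixes b \<phi> :: "'a::euclidean_space \<Rightarrow> complex"
  assumes [measurable]: "b \<in> borel_measurable borel" and b: "locally_integrable UNIV b"
    and \<phi>: "\<phi> \<in> test_functions UNIV"
  shows "continuous_on A (\<lambda>t. LINT y|lborel. evolve a lam \<sigma> t (b y) * \<phi> (y - t *\<^sub>R c))"
  unfolding continuous_on_sequentially comp_def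
proof (intro allI ballI impI, elim conjE)
  fix s :: "nat \<Rightarrow> real" and t assume s: "s \<longlonglongrightarrow> t"
  have [measurable]: "\<phi> \<in> borel_measurable borel" using \<phi> by (rule test_functions_measurable)
  obtain K where K: "smooth \<phi>" "compact K" "\<And>x. x \<notin> K \<Longrightarrow> \<phi> x = 0" using test_functionsE[OF \<phi>] by metis
  obtain B where B: "\<And>x. cmod (\<phi> x) \<le> B" using test_functions_bounded[OF \<phi>] by metis
  obtain T where T: "\<And>n. \<bar>s n\<bar> \<le> T"
    using convergent_imp_bounded[OF s] unfolding bounded_iff by auto
  define K' where "K' = (\<lambda>(x, t). x + t *\<^sub>R c) ` (K \<times> {-T..T})"
  have K': "compact K'" unfolding K'_def by (rule compact_translates[OF K(2)])
  have mem: "y \<in> K'" if "y - s n *\<^sub>R c \<in> K" for y n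
    unfolding K'_def using that T[of n] by (intro image_eqI[of _ _ "(y - s n *\<^sub>R c, s n)"]) auto
  show "(\<lambda>n. LINT y|lborel. evolve a lam \<sigma> (s n) (b y) * \<phi> (y - s n *\<^sub>R c))
     \<longlonglongrightarrow> (LINT y|lborel. evolve a lam \<sigma> t (b y) * \<phi> (y - t *\<^sub>R c))"
  proof (rule integral_dominated_convergence[where w = "\<lambda>y. norm (indicat_real K' y *\<^sub>R b y) * B"])
    show "AE y in lborel. (\<lambda>n. evolve a lam \<sigma> (s n) (b y) * \<phi> (y - s n *\<^sub>R c)) \<longlonglongrightarrow> evolve a lam \<sigma> t (b y) * \<phi> (y - t *\<^sub>R c)"
    proof (intro AE_I2 tendsto_mult)
      fix y
      show "(\<lambda>n. evolve a lam \<sigma> (s n) (b y)) \<longlonglongrightarrow> evolve a lam \<sigma> t (b y)"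
        unfolding evolve_def by (intro tendsto_intros s)
      show "(\<lambda>n. \<phi> (y - s n *\<^sub>R c)) \<longlonglongrightarrow> \<phi> (y - t *\<^sub>R c)"
        by (rule continuous_on_tendsto_compose[OF smooth_continuous[OF K(1), of UNIV]])
           (auto intro!: tendsto_diff tendsto_scaleR s)
    qed
    show "AE y in lborel. cmod (evolve a lam \<sigma> (s n) (b y) * \<phi> (y - s n *\<^sub>R c)) \<le> norm (indicat_real K' y *\<^sub>R b y) * B" for n
    proof (intro AE_I2)
      fix y show "cmod (evolve a lam \<sigma> (s n) (b y) * \<phi> (y - s n *\<^sub>R c)) \<le> norm (indicat_real K' y *\<^sub>R b y) * B"
      proof (cases "y \<in> K'")
        case True
        then show ?thesis using B[of "y - s n *\<^sub>R c"] by (auto simp: norm_mult intro: mult_left_mono)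
      next
        case False
        then have "\<phi> (y - s n *\<^sub>R c) = 0" using mem[of y n] by (intro K(3)) auto
        then show ?thesis using False by simp
      qed
    qed
    show "integrable lborel (\<lambda>y. norm (indicat_real K' y *\<^sub>R b y) * B)"
      using b K' unfolding locally_integrable_def set_integrable_def by (intro integrable_mult_left integrable_norm) auto
  qed auto
qed

section \<open>Local integrability and slices of test functions\<close>

lemma integrable_imp_locally_integrable:
  assumes "integrable lborel f" shows "locally_integrable \<Omega> f"
  unfolding locally_integrable_def set_integrable_def
  using assms by (auto intro!: integrable_mult_indicator simp: compact_imp_closed borel_closed)

lemma locally_integrable_if_locally_bounded:
  assumes "f \<in> borel_measurable borel" "\<And>K. compact K \<Longrightarrow> K \<subseteq> \<Omega> \<Longrightarrow> \<exists>B. \<forall>p\<in>K. cmod (f p) \<le> B"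
  shows "locally_integrable \<Omega> f"
  unfolding locally_integrable_def set_integrable_def
proof (intro allI impI, elim conjE)
  fix K assume K: "compact K" "K \<subseteq> \<Omega>"
  obtain B where B: "\<And>p. p \<in> K \<Longrightarrow> cmod (f p) \<le> B" using assms(2)[OF K] by blast
  have [measurable]: "K \<in> sets borel" using K(1) by (simp add: compact_imp_closed borel_closed)
  have [measurable]: "f \<in> borel_measurable borel" by fact
  show "integrable lborel (\<lambda>x. indicat_real K x *\<^sub>R f x)"
    by (rule integrable_zero_outside_compact[of _ K B]) (use B K(1) in auto)
qed

lemma locally_integrable_mult_test:
  assumes f: "locally_integrable \<Omega> f" and \<phi>: "\<phi> \<in> test_functions \<Omega>"
  shows "integrable lborel (\<lambda>x. f x * \<phi> x)"
proof -
  obtain K where K: "compact K" "K \<subseteq> \<Omega>" "\<And>x. x \<notin> K \<Longrightarrow> \<phi> x = 0" using test_functionsE[OF \<phi>] by metis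
  obtain B where B: "\<And>x. cmod (\<phi> x) \<le> B" using test_functions_bounded[OF \<phi>] by metis
  have "integrable lborel (\<lambda>x. (indicat_real K x *\<^sub>R f x) * \<phi> x)"
    using f K unfolding locally_integrable_def set_integrable_def
    by (intro integrable_mult_bounded[OF _ test_functions_measurable[OF \<phi>] B]) auto
  moreover have "(\<lambda>x. (indicat_real K x *\<^sub>R f x) * \<phi> x) = (\<lambda>x. f x * \<phi> x)"
    using K(3) by (auto simp: indicator_def)
  ultimately show ?thesis by simp
qed

lemma test_functions_slice_space:
  assumes "\<phi> \<in> test_functions (UNIV :: (real \<times> 'a::euclidean_space) set)"
  shows "(\<lambda>y. \<phi> (t, y)) \<in> test_functions UNIV"
proof -
  obtain K where K: "smooth \<phi>" "compact K" "\<And>x. x \<notin> K \<Longrightarrow> \<phi> x = 0" using test_functionsE[OF assms] by metis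
  show ?thesis
  proof (rule test_functionsI[where K = "snd ` K"])
    have "smooth (\<lambda>y. \<phi> ((t, 0) + (0, y)))"
      by (rule smooth_affine[OF K(1)]) (auto intro!: linearI)
    then show "smooth (\<lambda>y. \<phi> (t, y))" by simp
    show "compact (snd ` K)" by (intro compact_continuous_image continuous_intros K)
    show "\<phi> (t, y) = 0" if "y \<notin> snd ` K" for y
      using that by (intro K(3)) force
  qed simp
qed

lemma test_functions_slice_characteristic:
  assumes "\<phi> \<in> test_functions (UNIV :: (real \<times> 'a::euclidean_space) set)"
  shows "(\<lambda>t. \<phi> (t, y - t *\<^sub>R c)) \<in> test_functions UNIV"
    and "frechet_derivative (\<lambda>t. \<phi> (t, y - t *\<^sub>R c)) (at t) 1 = frechet_derivative \<phi> (at (t, y - t *\<^sub>R c)) (1, - c)"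
proof -
  obtain K where K: "smooth \<phi>" "compact K" "\<And>x. x \<notin> K \<Longrightarrow> \<phi> x = 0" using test_functionsE[OF assms] by metis
  show "(\<lambda>t. \<phi> (t, y - t *\<^sub>R c)) \<in> test_functions UNIV"
  proof (rule test_functionsI[where K = "fst ` K"])
    have "smooth (\<lambda>t. \<phi> ((0, y) + t *\<^sub>R (1, - c)))"
      by (rule smooth_affine[OF K(1)]) (auto intro!: linearI simp: algebra_simps)
    then show "smooth (\<lambda>t. \<phi> (t, y - t *\<^sub>R c))" by simp
    show "compact (fst ` K)" by (intro compact_continuous_image continuous_intros K)
    show "\<phi> (t, y - t *\<^sub>R c) = 0" if "t \<notin> fst ` K" for t
      using that by (intro K(3)) force
  qed simp
  have "((\<lambda>t. \<phi> ((0, y) + t *\<^sub>R (1, - c))) has_vector_derivative pderivative \<phi> (1, - c) ((0, y) + t *\<^sub>R (1, - c))) (at t)" for t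
    by (rule smooth_along_line[OF K(1)])
  then have "((\<lambda>t. \<phi> (t, y - t *\<^sub>R c)) has_vector_derivative pderivative \<phi> (1, - c) (t, y - t *\<^sub>R c)) (at t)" for t
    by simp
  from vector_derivative_pderivative[OF this, THEN fun_cong]
  show "frechet_derivative (\<lambda>t. \<phi> (t, y - t *\<^sub>R c)) (at t) 1 = frechet_derivative \<phi> (at (t, y - t *\<^sub>R c)) (1, - c)" .
qed

lemma pderivative_slice_space:
  assumes "smooth \<phi>"
  shows "frechet_derivative (\<lambda>y. \<phi> (t, y)) (at x) v = frechet_derivative \<phi> (at (t, x)) (0, v)"
proof -
  have "((\<lambda>y. (t, y)) has_derivative (\<lambda>h. (0, h))) (at x)"
    by (auto intro!: derivative_eq_intros)
  from has_derivative_compose[OF this smooth_has_derivative[OF assms]]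
  have "((\<lambda>y. \<phi> (t, y)) has_derivative (\<lambda>h. frechet_derivative \<phi> (at (t, x)) (0, h))) (at x)" .
  from frechet_derivative_at[OF this, THEN fun_cong, of v] show ?thesis by simp
qed

text \<open>The transpose of \<open>i \<partial>\<^sub>t + P(D)\<close>, a derivative along the characteristics.\<close>

lemma transposed_operator:
  assumes "\<phi> \<in> test_functions (UNIV :: (real \<times> 'a::euclidean_space) set)"
  shows "- \<i> * frechet_derivative \<phi> (at p) (1, 0)
      + (case p of (t, x) \<Rightarrow> fourier_multiplier (\<lambda>\<xi>. a + c \<bullet> (- \<xi>)) (\<lambda>y. \<phi> (t, y)) x)
    = - \<i> * frechet_derivative \<phi> (at p) (1, - c) + of_real a * \<phi> p"
proof (cases p)
  case (Pair t x)
  have s: "smooth \<phi>" using assms by (rule test_functions_smooth)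
  have "fourier_multiplier (\<lambda>\<xi>. a + (- c) \<bullet> \<xi>) (\<lambda>y. \<phi> (t, y)) x
     = of_real a * \<phi> (t, x) - \<i> * frechet_derivative \<phi> (at (t, x)) (0, - c)"
    using fourier_multiplier_affine_symbol[OF test_functions_slice_space[OF assms], of a "- c" t]
    by (simp add: pderivative_slice_space[OF s])
  moreover have "frechet_derivative \<phi> (at (t, x)) (1, - c) = frechet_derivative \<phi> (at (t, x)) (1, 0) + frechet_derivative \<phi> (at (t, x)) (0, - c)"
    using linear_add[OF linear_frechet_derivative[OF smooth_differentiable[OF s]], of "(t, x)" "(1, 0)" "(0, - c)"] by simp
  ultimately show ?thesis using Pair by (simp add: algebra_simps)
qed

text \<open>The modulus is constant along the flow, so the nonlinear term acts as multiplication by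
  a fixed number and the phase \<open>g\<close> is a pure exponential of frequency \<kappa>. The
  integrand is then a constant multiple of the derivative of the product of \<open>g\<close> and
  \<psi>.\<close>

lemma evolve_solves_along_characteristic:
  assumes "\<psi> \<in> test_functions (UNIV :: real set)"
  shows "(LINT t|lborel. evolve a lam \<sigma> t z * (- \<i> * frechet_derivative \<psi> (at t) 1 + of_real a * \<psi> t)
    - of_real lam * (nonlinearity \<sigma> (evolve a lam \<sigma> t z) * \<psi> t)) = 0"
proof -
  define \<kappa> where "\<kappa> = a - lam * cmod z powr (2 * \<sigma>)"
  define g where "g t = exp (\<i> * complex_of_real \<kappa> * of_real (t \<bullet> 1))" for t :: real
  have g: "smooth g" unfolding g_def[abs_def] by (rule smooth_exp_inner)
  have g': "frechet_derivative g (at t) 1 = \<i> * of_real \<kappa> * g t" for t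
    unfolding g_def[abs_def] by (subst pderivative_exp_inner) simp
  have N: "nonlinearity \<sigma> (evolve a lam \<sigma> t z) = of_real (cmod z powr (2 * \<sigma>)) * evolve a lam \<sigma> t z" for t
    by (simp add: nonlinearity_def)
  have ev: "evolve a lam \<sigma> t z = z * g t" for t
    by (simp add: evolve_def g_def \<kappa>_def mult_ac)
  have "evolve a lam \<sigma> t z * (- \<i> * frechet_derivative \<psi> (at t) 1 + of_real a * \<psi> t)
    - of_real lam * (nonlinearity \<sigma> (evolve a lam \<sigma> t z) * \<psi> t)
    = - \<i> * z * (g t * frechet_derivative \<psi> (at t) 1 + frechet_derivative g (at t) 1 * \<psi> t)" for t
    unfolding N unfolding g' ev by (simp add: \<kappa>_def algebra_simps)
  moreover have "integrable lborel (\<lambda>t. g t * frechet_derivative \<psi> (at t) 1)" "integrable lborel (\<lambda>t. frechet_derivative g (at t) 1 * \<psi> t)"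
    by (auto intro!: test_functions_integrable test_functions_mult test_functions_pderivative smooth_pderivative assms g)
  ultimately show ?thesis
    using test_functions_integral_by_parts[OF assms g, of 1] by simp
qed

lemma spacetime_subset: "test_functions spacetime \<subseteq> test_functions UNIV"
  using test_functions_mono by blast

text \<open>The derivatives are moved to the test function separately, each term being integrable,
  and recombined there into the single derivative along \<open>(1, - c)\<close>.\<close>

lemma weak_form_along_characteristics:
  fixes U :: "real \<times> 'a::euclidean_space \<Rightarrow> complex"
  assumes U: "locally_integrable spacetime U" and \<phi>s: "\<phi> \<in> test_functions spacetime"
  shows "\<i> * dist_time_deriv (regular_dist U) \<phi> + dist_space_multiplier (\<lambda>\<xi>. a + c \<bullet> \<xi>) (regular_dist U) \<phi>
     = (LINT p|lborel. U p * (- \<i> * frechet_derivative \<phi> (at p) (1, - c) + of_real a * \<phi> p))"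
proof -
  have \<phi>: "\<phi> \<in> test_functions UNIV" using \<phi>s spacetime_subset by blast
  define q where "q = (\<lambda>p. - \<i> * frechet_derivative \<phi> (at p) (1, - c) + of_real a * \<phi> p)"
  define M where "M = (\<lambda>(t, x). fourier_multiplier (\<lambda>\<xi>. a + c \<bullet> (- \<xi>)) (\<lambda>y. \<phi> (t, y)) x)"
  have M: "M p = q p + \<i> * frechet_derivative \<phi> (at p) (1, 0)" for p
    using transposed_operator[OF \<phi>, of p a c] unfolding M_def q_def by (auto simp: algebra_simps)
  have q: "q \<in> test_functions spacetime" unfolding q_def
    by (intro test_functions_add test_functions_mult[OF _ smooth_const] test_functions_pderivative \<phi>s)
  note i1 = locally_integrable_mult_test[OF U q]
  note i2 = locally_integrable_mult_test[OF U test_functions_pderivative[OF \<phi>s, of "(1, 0)"]]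
  have "U p * M p = U p * q p + \<i> * (U p * frechet_derivative \<phi> (at p) (1, 0))" for p
    by (simp add: M algebra_simps)
  then have "(LINT p|lborel. U p * M p) = (LINT p|lborel. U p * q p) + \<i> * (LINT p|lborel. U p * frechet_derivative \<phi> (at p) (1, 0))"
    using i1 i2 by simp
  moreover have "\<i> * dist_time_deriv (regular_dist U) \<phi> + dist_space_multiplier (\<lambda>\<xi>. a + c \<bullet> \<xi>) (regular_dist U) \<phi>
    = - \<i> * (LINT p|lborel. U p * frechet_derivative \<phi> (at p) (1, 0)) + (LINT p|lborel. U p * M p)"
    by (simp add: dist_time_deriv_def dist_space_multiplier_def regular_dist_def M_def)
  ultimately show ?thesis by (simp add: q_def)
qed

text \<open>Local boundedness of the datum makes both \<open>U\<close> and its nonlinearity locally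
  integrable. In sheared coordinates Fubini then reduces the weak equation to the identity on each
  characteristic.\<close>

theorem evolve_solves_cauchy_problem:
  fixes u0 :: "'a::euclidean_space \<Rightarrow> complex" and c :: 'a
  assumes u0: "integrable lborel u0" and bd: "\<And>R. \<exists>B. \<forall>x. norm x \<le> R \<longrightarrow> cmod (u0 x) \<le> B" and "\<sigma> > 0"
  shows "solves_cauchy_problem (\<lambda>\<xi>. a + c \<bullet> \<xi>) lam \<sigma> (regular_dist u0)
    (\<lambda>t. regular_dist (\<lambda>x. evolve a lam \<sigma> t (u0 (x + t *\<^sub>R c))))"
proof -
  have [measurable]: "u0 \<in> borel_measurable borel" using borel_measurable_integrable[OF u0] by simp
  define U where "U = (\<lambda>(t, x). evolve a lam \<sigma> t (u0 (x + t *\<^sub>R c)))"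
  have Um [measurable]: "U \<in> borel_measurable borel" unfolding U_def borel_prod[symmetric] by measurable
  have NUm [measurable]: "(\<lambda>p. nonlinearity \<sigma> (U p)) \<in> borel_measurable borel" unfolding nonlinearity_def by measurable
  have int: "integrable lborel (\<lambda>x. evolve a lam \<sigma> t (u0 (x + t *\<^sub>R c)))" for t
  proof (rule Bochner_Integration.integrable_bound)
    show "integrable lborel (\<lambda>x. u0 (t *\<^sub>R c + x))" using u0 by (subst lborel_translate_integral(2)) auto
  qed (auto simp: add.commute)
  have curve: "continuous_curve_in_distributions (\<lambda>t. regular_dist (\<lambda>x. evolve a lam \<sigma> t (u0 (x + t *\<^sub>R c))))"
    unfolding continuous_curve_in_distributions_def
  proof (intro conjI allI impI ballI)
    show "distribution UNIV (regular_dist (\<lambda>x. evolve a lam \<sigma> t (u0 (x + t *\<^sub>R c))))" for t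
      by (rule distribution_regular_dist[OF int])
    fix \<phi> :: "'a \<Rightarrow> complex" assume \<phi>: "\<phi> \<in> test_functions UNIV"
    then have [measurable]: "\<phi> \<in> borel_measurable borel" by (rule test_functions_measurable)
    have "regular_dist (\<lambda>x. evolve a lam \<sigma> t (u0 (x + t *\<^sub>R c))) \<phi> =
       (LINT y|lborel. evolve a lam \<sigma> t (u0 y) * \<phi> (y - t *\<^sub>R c))" for t
      using lborel_translate_integral(1)[of "\<lambda>y. evolve a lam \<sigma> t (u0 y) * \<phi> (y - t *\<^sub>R c)" "t *\<^sub>R c"]
      unfolding regular_dist_def by (simp add: add.commute)
    then show "continuous_on {0..} (\<lambda>t. regular_dist (\<lambda>x. evolve a lam \<sigma> t (u0 (x + t *\<^sub>R c))) \<phi>)"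
      using evolve_weak_continuous[OF _ integrable_imp_locally_integrable[OF u0] \<phi>] by simp
  qed
  have Ubd: "\<exists>B. \<forall>p\<in>K. cmod (U p) \<le> B" if "compact K" for K
  proof -
    have "compact ((\<lambda>(t, x). x + t *\<^sub>R c) ` K)"
      unfolding case_prod_beta by (intro compact_continuous_image continuous_intros that)
    from compact_imp_bounded[OF this]
    obtain R where R: "\<And>z. z \<in> (\<lambda>(t, x). x + t *\<^sub>R c) ` K \<Longrightarrow> norm z \<le> R"
      unfolding bounded_iff by blast
    obtain B where "\<And>x. norm x \<le> R \<Longrightarrow> cmod (u0 x) \<le> B" using bd[of R] by blast
    moreover have "norm (x + t *\<^sub>R c) \<le> R" if "(t, x) \<in> K" for t x
      using R[OF imageI[OF that]] by simp
    ultimately show ?thesis by (intro exI[of _ B]) (auto simp: U_def)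
  qed
  have li: "locally_integrable spacetime U" "locally_integrable spacetime (\<lambda>p. nonlinearity \<sigma> (U p))"
  proof -
    show "locally_integrable spacetime U"
      using Ubd by (intro locally_integrable_if_locally_bounded) auto
    show "locally_integrable spacetime (\<lambda>p. nonlinearity \<sigma> (U p))"
    proof (rule locally_integrable_if_locally_bounded[OF NUm])
      fix K :: "(real \<times> 'a) set" assume "compact K"
      then obtain B where B: "\<And>p. p \<in> K \<Longrightarrow> cmod (U p) \<le> B" using Ubd by blast
      have "cmod (nonlinearity \<sigma> (U p)) \<le> B powr (2 * \<sigma>) * B" if "p \<in> K" for p
        using B[OF that] \<open>\<sigma> > 0\<close> order_trans[OF norm_ge_zero B[OF that]]
        unfolding nonlinearity_def norm_mult by (auto intro!: mult_mono powr_mono2)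
      then show "\<exists>B. \<forall>p\<in>K. cmod (nonlinearity \<sigma> (U p)) \<le> B" by blast
    qed
  qed
  have eq: "\<i> * dist_time_deriv (regular_dist U) \<phi> + dist_space_multiplier (\<lambda>\<xi>. a + c \<bullet> \<xi>) (regular_dist U) \<phi>
     = of_real lam * regular_dist (\<lambda>p. nonlinearity \<sigma> (U p)) \<phi>"
    if \<phi>s: "\<phi> \<in> test_functions spacetime" for \<phi>
  proof -
    have \<phi>: "\<phi> \<in> test_functions UNIV" using \<phi>s spacetime_subset by blast
    define q where "q = (\<lambda>p. - \<i> * frechet_derivative \<phi> (at p) (1, - c) + of_real a * \<phi> p)"
    have q: "q \<in> test_functions spacetime" unfolding q_def
      by (intro test_functions_add test_functions_mult[OF _ smooth_const] test_functions_pderivative \<phi>s)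
    note i1 = locally_integrable_mult_test[OF li(1) q]
    note i3 = locally_integrable_mult_test[OF li(2) \<phi>s]
    define G where "G p = U p * q p - of_real lam * (nonlinearity \<sigma> (U p) * \<phi> p)" for p
    have G: "integrable lborel G" unfolding G_def[abs_def] using i1 i3 by auto
    have Gm [measurable]: "G \<in> borel_measurable borel" using borel_measurable_integrable[OF G] by simp
    have Gs: "integrable (lborel \<Otimes>\<^sub>M lborel) (\<lambda>(t, y). G (shear c (t, y)))"
      using G lborel_integral_shear(2)[OF Gm, of c] by (simp add: lborel_prod case_prod_beta')
    have "(LINT p|lborel. G p) = (LINT p|lborel. G (shear c p))"
      by (simp add: lborel_integral_shear(1))
    also have "\<dots> = (LINT y|lborel. (LINT t|lborel. G (shear c (t, y))))"
      using lborel_pair.integral_snd[OF Gs] by (simp add: lborel_prod case_prod_beta')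
    also have "\<dots> = (LINT y::'a|lborel. 0)"
    proof (intro Bochner_Integration.integral_cong refl)
      fix y
      have "G (shear c (t, y)) = evolve a lam \<sigma> t (u0 y) * (- \<i> * frechet_derivative (\<lambda>t. \<phi> (t, y - t *\<^sub>R c)) (at t) 1 + of_real a * \<phi> (t, y - t *\<^sub>R c))
          - of_real lam * (nonlinearity \<sigma> (evolve a lam \<sigma> t (u0 y)) * \<phi> (t, y - t *\<^sub>R c))" for t
        by (simp add: G_def U_def q_def shear_def test_functions_slice_characteristic(2)[OF \<phi>])
      then show "(LINT t|lborel. G (shear c (t, y))) = 0"
        using evolve_solves_along_characteristic[OF test_functions_slice_characteristic(1)[OF \<phi>, of y c], of a lam \<sigma> "u0 y"] by simp
    qed
    finally have "(LINT p|lborel. U p * q p) = of_real lam * (LINT p|lborel. nonlinearity \<sigma> (U p) * \<phi> p)"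
      unfolding G_def using i1 i3 by simp
    then show ?thesis
      unfolding weak_form_along_characteristics[OF li(1) \<phi>s] by (simp add: q_def regular_dist_def)
  qed
  show ?thesis
    unfolding solves_cauchy_problem_def
  proof (intro conjI exI[of _ U])
    show "AE t in lborel. 0 < t \<longrightarrow> locally_integrable UNIV (\<lambda>x. U (t, x)) \<and>
       dist_eq UNIV (regular_dist (\<lambda>x. evolve a lam \<sigma> t (u0 (x + t *\<^sub>R c)))) (regular_dist (\<lambda>x. U (t, x)))"
      using integrable_imp_locally_integrable[OF int] by (simp add: U_def dist_eq_def)
  qed (use curve li eq in \<open>auto simp: dist_eq_def\<close>)
qed

section \<open>Weak derivatives on the half-line\<close>

lemma compact_in_halfline:
  assumes "compact K" "K \<subseteq> {0::real<..}"
  obtains \<alpha> \<beta> where "0 < \<alpha>" "\<alpha> < 1" "1 < \<beta>" "K \<subseteq> {\<alpha>..\<beta>}"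
proof (cases "K = {}")
  case True
  then show ?thesis by (intro that[of "1/2" 2]) auto
next
  case False
  obtain m where m: "m \<in> K" "\<And>x. x \<in> K \<Longrightarrow> m \<le> x" using compact_attains_inf[OF assms(1) False] by blast
  obtain M where M: "M \<in> K" "\<And>x. x \<in> K \<Longrightarrow> x \<le> M" using compact_attains_sup[OF assms(1) False] by blast
  have "m > 0" using m assms by auto
  then show ?thesis
    by (intro that[of "min m (1/2)" "max M 2"]) (use m M in \<open>auto simp: min_le_iff_disj le_max_iff_disj\<close>)
qed

lemma test_functions_halfline_support:
  assumes "f \<in> test_functions {0::real<..}"
  obtains \<alpha> \<beta> where "0 < \<alpha>" "\<alpha> < 1" "1 < \<beta>" "\<And>t. t \<notin> {\<alpha>..\<beta>} \<Longrightarrow> f t = 0"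
proof -
  obtain K where K: "compact K" "K \<subseteq> {0<..}" "\<And>x. x \<notin> K \<Longrightarrow> f x = 0"
    using test_functionsE[OF assms] by metis
  obtain \<alpha> \<beta> where "0 < \<alpha>" "\<alpha> < 1" "1 < \<beta>" "K \<subseteq> {\<alpha>..\<beta>}" using compact_in_halfline[OF K(1,2)] .
  moreover have "f t = 0" if "t \<notin> {\<alpha>..\<beta>}" for t
    by (rule K(3)) (use \<open>K \<subseteq> {\<alpha>..\<beta>}\<close> that in blast)
  ultimately show ?thesis by (intro that[of \<alpha> \<beta>])
qed

text \<open>The integral taken from the left vanishes before the support, and mean zero makes it
  vanish beyond the support too.\<close>

lemma test_function_primitive:
  assumes f: "f \<in> test_functions {0::real<..}" and zero: "(LINT t|lborel. f t) = 0"
  obtains \<theta> where "\<theta> \<in> test_functions {0<..}" "\<And>t. frechet_derivative \<theta> (at t) 1 = f t"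
proof -
  obtain \<alpha> \<beta> where ab: "0 < \<alpha>" "\<alpha> < 1" "1 < \<beta>" and f0: "\<And>t. t \<notin> {\<alpha>..\<beta>} \<Longrightarrow> f t = 0"
    using test_functions_halfline_support[OF f] by metis
  have cont: "continuous_on S f" for S using f by (simp add: smooth_continuous test_functions_smooth)
  define \<theta> where "\<theta> t = integral {0..t} f" for t
  have left: "\<theta> t = 0" if "t < \<alpha>" for t
    unfolding \<theta>_def using that by (intro integral_unique has_integral_is_0) (auto intro: f0)
  have right: "\<theta> t = 0" if "t > \<beta>" for t
  proof -
    have "(f has_integral integral {0..t} f) {0..t}"
      using cont by (intro integrable_integral integrable_continuous_interval)
    then have "(f has_integral \<theta> t) UNIV"
      unfolding \<theta>_def by (rule has_integral_on_superset) (use that ab in \<open>auto intro: f0\<close>)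
    moreover have "(f has_integral (LINT t|lborel. f t)) UNIV"
      using has_integral_integral_lborel[OF test_functions_integrable[OF f]] .
    ultimately show ?thesis using zero has_integral_unique by metis
  qed
  have d: "(\<theta> has_vector_derivative f t) (at t)" for t
  proof (cases "t > 0")
    case True
    have "((\<lambda>u. integral {0..u} f) has_vector_derivative f t) (at t within {0..t + 1})"
      using True by (intro integral_has_vector_derivative cont) auto
    then show ?thesis using True unfolding \<theta>_def[abs_def] by (simp add: at_within_Icc_at)
  next
    case False
    have "((\<lambda>_. 0) has_vector_derivative f t) (at t)" using f0[of t] False ab by simp
    then show ?thesis
      by (rule has_vector_derivative_transform_within_open[of _ _ _ "{..<\<alpha>}"]) (use False ab left in auto)
  qed
  have "\<theta> \<in> test_functions {0<..}"
  proof (rule test_functionsI[of _ "{\<alpha>..\<beta>}"])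
    show "smooth \<theta>" by (rule smooth_vector_derivI[OF d test_functions_smooth[OF f]])
  qed (use ab left right in \<open>auto simp: not_le\<close>)
  moreover have "frechet_derivative \<theta> (at t) 1 = f t" for t
    using vector_derivative_pderivative[OF d, THEN fun_cong] .
  ultimately show ?thesis using that by blast
qed

text \<open>The base point is 1 because local integrability on the open half-line gives no control
  at 0.\<close>

definition primitive :: "(real \<Rightarrow> complex) \<Rightarrow> real \<Rightarrow> complex" where
  "primitive g t = (if 1 \<le> t then integral {1..t} g else - integral {t..1} g)"

lemma locally_integrable_halfline_interval:
  assumes "locally_integrable {0::real<..} g" "0 < \<alpha>"
  shows "set_integrable lborel {\<alpha>..\<beta>} g" "g integrable_on {\<alpha>..\<beta>}"
proof -
  show "set_integrable lborel {\<alpha>..\<beta>} g"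
  proof -
    have "{\<alpha>..\<beta>} \<subseteq> {0<..}" using assms(2) by (auto intro: less_le_trans)
    then show ?thesis
      using assms(1)[unfolded locally_integrable_def, rule_format, of "{\<alpha>..\<beta>}"] by simp
  qed
  then show "g integrable_on {\<alpha>..\<beta>}" by (rule set_borel_integral_eq_integral(1))
qed

lemma primitive_diff:
  assumes g: "locally_integrable {0<..} g" and t: "0 < \<alpha>" "\<alpha> \<le> t"
  shows "primitive g t = primitive g \<alpha> + integral {\<alpha>..t} g"
proof -
  note i = locally_integrable_halfline_interval(2)[OF g]
  have "integral {r..s} g + integral {s..u} g = integral {r..u} g" if "0 < r" "r \<le> s" "s \<le> u" for r s u
    using that i by (intro Henstock_Kurzweil_Integration.integral_combine) auto
  from this[of 1 \<alpha> t] this[of \<alpha> 1 t] this[of \<alpha> t 1] t show ?thesis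
    unfolding primitive_def by (auto simp: algebra_simps)
qed

lemma primitive_continuous:
  assumes g: "locally_integrable {0<..} g"
  shows "continuous_on {0<..} (primitive g)"
proof (rule continuous_at_imp_continuous_on, intro ballI)
  fix x :: real assume x: "x \<in> {0<..}"
  have "continuous_on {x/2..x+1} (\<lambda>t. primitive g (x/2) + integral {x/2..t} g)"
    using x by (intro continuous_intros indefinite_integral_continuous_1 locally_integrable_halfline_interval[OF g]) auto
  then have "continuous_on {x/2..x+1} (primitive g)"
    by (rule continuous_on_eq) (use x in \<open>auto intro!: primitive_diff[OF g, symmetric]\<close>)
  then show "isCont (primitive g) x"
    using x by (intro continuous_on_interior[of "{x/2..x+1}"]) auto
qed

lemma continuous_locally_integrable:
  assumes "continuous_on {0::real<..} f" shows "locally_integrable {0<..} f"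
  unfolding locally_integrable_def set_integrable_def
  using assms borel_integrable_compact continuous_on_subset by blast

text \<open>As \<open>g\<close> is only locally integrable, the product rule is replaced by Fubini
  on the triangle \<open>s \<le> t\<close>. The base value \<open>primitive g \<alpha>\<close> drops
  out, because the derivative of a test function has mean zero.\<close>

lemma primitive_integral_by_parts:
  assumes g: "locally_integrable {0<..} g" and \<theta>: "\<theta> \<in> test_functions {0<..}"
  shows "(LINT t|lborel. primitive g t * frechet_derivative \<theta> (at t) 1) = - (LINT t|lborel. g t * \<theta> t)"
proof -
  obtain \<alpha> \<beta> where ab: "0 < \<alpha>" "\<alpha> < 1" "1 < \<beta>" and \<theta>0: "\<And>t. t \<notin> {\<alpha>..\<beta>} \<Longrightarrow> \<theta> t = 0"
    using test_functions_halfline_support[OF \<theta>] by metis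
  define d where "d = pderivative \<theta> 1"
  have d: "d \<in> test_functions {0<..}" unfolding d_def by (rule test_functions_pderivative[OF \<theta>])
  have [measurable]: "d \<in> borel_measurable borel" by (rule test_functions_measurable[OF d])
  have d0: "d t = 0" if "t \<notin> {\<alpha>..\<beta>}" for t
    unfolding d_def by (rule pderivative_zero_outside[of "{\<alpha>..\<beta>}"]) (use \<theta>0 that in auto)
  \<comment> \<open>Cut off to an interval around the support of \<theta>, \<open>g\<close> becomes
    integrable and Fubini applies.\<close>
  define h where "h s = indicat_real {\<alpha>..\<beta>} s *\<^sub>R g s" for s
  have h: "integrable lborel h"
    using locally_integrable_halfline_interval(1)[OF g ab(1), of \<beta>] unfolding h_def[abs_def] set_integrable_def .
  then have [measurable]: "h \<in> borel_measurable borel" using borel_measurable_integrable by force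
  have int: "integrable (lborel \<Otimes>\<^sub>M lborel) (\<lambda>(t, s). d t * h s * of_real (indicat_real {..t} s))"
  proof (rule Bochner_Integration.integrable_bound[OF integrable_pair_mult[OF test_functions_integrable[OF d] h]])
    define S where "S = {p :: real \<times> real. snd p \<le> fst p}"
    have [measurable]: "S \<in> sets (borel \<Otimes>\<^sub>M borel)"
      unfolding S_def borel_prod by (intro borel_closed closed_Collect_le continuous_intros)
    have "(\<lambda>(t, s). d t * h s * of_real (indicat_real {..t} s)) = (\<lambda>p. d (fst p) * h (snd p) * of_real (indicat_real S p))"
      by (auto simp: S_def indicator_def)
    then show "(\<lambda>(t, s). d t * h s * of_real (indicat_real {..t} s)) \<in> borel_measurable (lborel \<Otimes>\<^sub>M lborel)"
      by simp
  qed (auto simp: indicator_def norm_mult)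
  have inner1: "(LINT s|lborel. d t * h s * of_real (indicat_real {..t} s)) = d t * (primitive g t - primitive g \<alpha>)" for t
  proof (cases "t \<in> {\<alpha>..\<beta>}")
    case True
    have "(LINT s|lborel. d t * h s * of_real (indicat_real {..t} s)) = d t * (LINT s:{\<alpha>..t}|lborel. g s)"
      unfolding set_lebesgue_integral_def mult.assoc integral_mult_right_zero
      by (rule arg_cong[where f = "(*) (d t)"], rule Bochner_Integration.integral_cong)
         (use True in \<open>auto simp: h_def indicator_def\<close>)
    also have "(LINT s:{\<alpha>..t}|lborel. g s) = integral {\<alpha>..t} g"
      by (intro set_borel_integral_eq_integral locally_integrable_halfline_interval[OF g ab(1)])
    also have "\<dots> = primitive g t - primitive g \<alpha>" using primitive_diff[OF g ab(1), of t] True by simp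
    finally show ?thesis .
  qed (simp add: d0)
  have inner2: "(LINT t|lborel. d t * h s * of_real (indicat_real {..t} s)) = - (h s * \<theta> s)" for s
  proof (cases "s \<in> {\<alpha>..\<beta>}")
    case True
    have "(LINT t|lborel. d t * h s * of_real (indicat_real {..t} s)) = h s * (LINT t:{s..\<beta> + 1}|lborel. d t)"
      unfolding set_lebesgue_integral_def integral_mult_right_zero[symmetric]
      by (rule Bochner_Integration.integral_cong) (use d0 in \<open>auto simp: indicator_def\<close>)
    also have "(LINT t:{s..\<beta> + 1}|lborel. d t) = integral {s..\<beta> + 1} d"
      using True ab by (intro set_borel_integral_eq_integral continuous_locally_integrable
          locally_integrable_halfline_interval smooth_continuous test_functions_smooth[OF d]) auto
    also have "\<dots> = \<theta> (\<beta> + 1) - \<theta> s"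
      unfolding d_def using True
      by (intro integral_unique fundamental_theorem_of_calculus)
         (auto intro!: has_vector_derivative_at_within smooth_pderivative_has_vector_derivative test_functions_smooth[OF \<theta>])
    also have "\<dots> = - \<theta> s" by (simp add: \<theta>0)
    finally show ?thesis by simp
  qed (simp add: h_def)
  have pd: "integrable lborel (\<lambda>t. primitive g t * d t)"
    by (rule locally_integrable_mult_test[OF continuous_locally_integrable[OF primitive_continuous[OF g]] d])
  have "(LINT t|lborel. d t * (primitive g t - primitive g \<alpha>)) = (LINT s|lborel. - (h s * \<theta> s))"
    using lborel_pair.Fubini_integral[OF int] by (simp add: inner1 inner2)
  also have "\<dots> = - (LINT s|lborel. g s * \<theta> s)"
    unfolding integral_minus
    by (rule arg_cong[where f = uminus], rule Bochner_Integration.integral_cong) (use \<theta>0 in \<open>auto simp: h_def indicator_def\<close>)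
  also have "(LINT t|lborel. d t * (primitive g t - primitive g \<alpha>)) = (LINT t|lborel. primitive g t * d t) - primitive g \<alpha> * (LINT t|lborel. d t)"
    using pd test_functions_integrable[OF d] by (simp add: algebra_simps)
  also have "(LINT t|lborel. d t) = 0"
    unfolding d_def by (rule test_functions_integral_pderivative) (use \<theta> test_functions_mono in blast)
  finally show ?thesis by (simp add: d_def)
qed

section \<open>Testing with countably many bumps on the half-line\<close>

lemma box_bump_real_tendsto:
  fixes p q :: "nat \<Rightarrow> real"
  assumes "p \<longlonglongrightarrow> a" "q \<longlonglongrightarrow> b"
  shows "(\<lambda>k. box_bump n (p k) (q k) t) \<longlonglongrightarrow> box_bump n a b t"
proof -
  have "isCont (flat_exp 0) x" for x using flat_exp_DERIV DERIV_isCont by blast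
  then have *: "(\<lambda>k. flat_exp 0 (f k)) \<longlonglongrightarrow> flat_exp 0 l" if "f \<longlonglongrightarrow> l" for f l
    using that isCont_tendsto_compose by blast
  show ?thesis unfolding box_bump_def by simp (intro tendsto_mult * tendsto_intros assms)
qed

text \<open>A bump depends continuously on the endpoints of its box, so rational ones suffice; they
  approach \<open>a\<close> and \<open>b\<close> from inside, where \<open>h\<close> is
  integrable.\<close>

lemma fundamental_lemma_halfline_rational:
  fixes h :: "real \<Rightarrow> complex"
  assumes h: "locally_integrable {0<..} h"
    and zero: "\<And>n p q. p \<in> \<rat> \<Longrightarrow> q \<in> \<rat> \<Longrightarrow> 0 < p \<Longrightarrow> (LINT t|lborel. h t * complex_of_real (box_bump n p q t)) = 0"
  shows "AE t in lborel. 0 < t \<longrightarrow> h t = 0"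
proof -
  have "AE t in lborel. t \<in> {0<..} \<longrightarrow> h t = 0"
  proof (rule fundamental_lemma)
    show "open {0::real<..}" by simp
    show "set_integrable lborel (cbox a b) h" if "cbox a b \<subseteq> {0<..}" for a b
      using h[unfolded locally_integrable_def, rule_format, of "cbox a b"] that compact_cbox[of a b] by simp
    fix n and a b :: real assume ab: "cbox a b \<subseteq> {0<..}"
    show "(LINT t|lborel. h t * complex_of_real (box_bump n a b t)) = 0"
    proof (cases "a < b")
      case False
      then have "box_bump n a b t = 0" for t by (intro box_bump_zero) auto
      then show ?thesis by simp
    next
      case True
      then have "a \<in> cbox a b" by simp
      then have "0 < a" using ab by blast
      define k where "k t = indicat_real {a..b} t *\<^sub>R h t" for t
      have k: "integrable lborel k"
        using locally_integrable_halfline_interval(1)[OF h \<open>0 < a\<close>, of b] unfolding k_def[abs_def] set_integrable_def .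
      then have [measurable]: "k \<in> borel_measurable borel" using borel_measurable_integrable by force
      have [measurable]: "(\<lambda>t. complex_of_real (box_bump n r s t)) \<in> borel_measurable borel" for r s :: real
        by (intro smooth_measurable smooth_box_bump)
      have eq: "h t * complex_of_real (box_bump n r s t) = k t * complex_of_real (box_bump n r s t)" if "a \<le> r" "s \<le> b" for r s t
        using box_bump_zero[of t r s n] that by (auto simp: k_def indicator_def)
      have "\<forall>m. \<exists>r\<in>\<rat>. a < r \<and> r < a + inverse (real (Suc m))" by (auto intro!: Rats_dense_in_real)
      then obtain p where p: "\<And>m. p m \<in> \<rat>" "\<And>m. a < p m" "\<And>m. p m < a + inverse (real (Suc m))" by metis
      have "\<forall>m. \<exists>r\<in>\<rat>. b - inverse (real (Suc m)) < r \<and> r < b" by (auto intro!: Rats_dense_in_real)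
      then obtain q where q: "\<And>m. q m \<in> \<rat>" "\<And>m. b - inverse (real (Suc m)) < q m" "\<And>m. q m < b" by metis
      have "p \<longlonglongrightarrow> a"
      proof (rule tendsto_sandwich[OF _ _ tendsto_const])
        show "(\<lambda>m. a + inverse (real (Suc m))) \<longlonglongrightarrow> a" using tendsto_add[OF tendsto_const LIMSEQ_inverse_real_of_nat, of a] by simp
      qed (use p(2,3)[THEN less_imp_le] in auto)
      moreover have "q \<longlonglongrightarrow> b"
      proof (rule tendsto_sandwich[OF _ _ _ tendsto_const])
        show "(\<lambda>m. b - inverse (real (Suc m))) \<longlonglongrightarrow> b" using tendsto_diff[OF tendsto_const LIMSEQ_inverse_real_of_nat, of b] by simp
      qed (use q(2,3)[THEN less_imp_le] in auto)
      ultimately have lim: "(\<lambda>m. box_bump n (p m) (q m) t) \<longlonglongrightarrow> box_bump n a b t" for t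
        by (rule box_bump_real_tendsto)
      have "(\<lambda>m. LINT t|lborel. k t * complex_of_real (box_bump n (p m) (q m) t)) \<longlonglongrightarrow> (LINT t|lborel. k t * complex_of_real (box_bump n a b t))"
      proof (rule integral_dominated_convergence[where w = "\<lambda>t. norm (k t)"])
        show "AE t in lborel. (\<lambda>m. k t * complex_of_real (box_bump n (p m) (q m) t)) \<longlonglongrightarrow> k t * complex_of_real (box_bump n a b t)"
          by (intro AE_I2 tendsto_mult tendsto_const tendsto_of_real lim)
        show "AE t in lborel. norm (k t * complex_of_real (box_bump n (p m) (q m) t)) \<le> norm (k t)" for m
          by (auto simp: norm_mult box_bump_nonneg intro!: mult_left_le box_bump_le_1)
      qed (use k in auto)
      moreover have "(LINT t|lborel. k t * complex_of_real (box_bump n (p m) (q m) t)) = 0" for m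
        using zero[OF p(1) q(1), of m n m] p(2)[of m] q(3)[of m] \<open>0 < a\<close>
        unfolding eq[OF less_imp_le[OF p(2)] less_imp_le[OF q(3)]] by simp
      ultimately show ?thesis unfolding eq[OF order_refl order_refl] by (simp add: LIMSEQ_const_iff)
    qed
  qed
  then show ?thesis by simp
qed

text \<open>Subtracting a suitable multiple of this function from a bump leaves a function of mean
  zero, which has a primitive among the test functions.\<close>

definition unit_bump :: "real \<Rightarrow> complex" where
  "unit_bump t = of_real (box_bump 1 1 2 t) / (LINT s::real|lborel. complex_of_real (box_bump 1 1 2 s))"

lemma unit_bump_test: "unit_bump \<in> test_functions {0<..}"
proof -
  have "(\<lambda>t::real. complex_of_real (box_bump 1 1 2 t)) \<in> test_functions {0<..}"
    by (rule test_functions_box_bump) auto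
  from test_functions_mult[OF this smooth_const, of "1 / (LINT s::real|lborel. complex_of_real (box_bump 1 1 2 s))"]
  show ?thesis by (simp add: unit_bump_def[abs_def])
qed

lemma unit_bump_integral: "(LINT t|lborel. unit_bump t) = 1"
proof -
  have int: "integrable lborel (\<lambda>t::real. complex_of_real (box_bump 1 1 2 t))"
    by (intro test_functions_integrable[of _ UNIV] test_functions_box_bump) auto
  then have intr: "integrable lborel (\<lambda>t::real. box_bump 1 1 2 t)"
    using integrable_Re by fastforce
  have "(LINT s|lborel. box_bump 1 1 (2::real) s) \<noteq> 0"
  proof
    assume "(LINT s|lborel. box_bump 1 1 (2::real) s) = 0"
    then have "AE s in lborel. box_bump 1 1 (2::real) s = 0"
      using integral_nonneg_eq_0_iff_AE[OF intr] by (simp add: box_bump_nonneg)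
    then have "AE s in lborel. s \<notin> box 1 (2::real)"
      by eventually_elim (use box_bump_pos[of _ 1 "2::real" 1] in force)
    then have "emeasure lborel (box 1 (2::real)) = 0"
      by (subst (asm) AE_iff_measurable[of "box 1 2"]) auto
    then show False by simp
  qed
  then have "(LINT s|lborel. complex_of_real (box_bump 1 1 (2::real) s)) \<noteq> 0" by simp
  then show ?thesis unfolding unit_bump_def by simp
qed

text \<open>The lemma of du Bois-Reymond: the difference of \<open>w\<close> and the primitive of
  \<open>g\<close> annihilates all mean-zero corrections of bumps, hence is constant. The hypothesis
  \<open>weak\<close> concerns countably many \<theta> only, so it can be met on almost every line
  at once.\<close>

lemma weak_derivative_halfline:
  assumes w: "locally_integrable {0<..} w" and g: "locally_integrable {0<..} g"
    and weak: "\<And>n p q. p \<in> \<rat> \<Longrightarrow> q \<in> \<rat> \<Longrightarrow> 0 < p \<Longrightarrow>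
      \<exists>\<theta>\<in>test_functions {0<..}. (\<forall>t. frechet_derivative \<theta> (at t) 1 =
           complex_of_real (box_bump n p q t) - (LINT s|lborel. complex_of_real (box_bump n p q s)) * unit_bump t) \<and>
        (LINT t|lborel. w t * frechet_derivative \<theta> (at t) 1 + g t * \<theta> t) = 0"
  shows "\<exists>A. AE t in lborel. 0 < t \<longrightarrow> w t = A + primitive g t"
proof -
  define F where "F = primitive g"
  have F: "locally_integrable {0<..} F"
    unfolding F_def by (intro continuous_locally_integrable primitive_continuous g)
  \<comment> \<open>The only possible constant, as \<open>unit_bump\<close> has integral 1.\<close>
  define A where "A = (LINT t|lborel. (w t - F t) * unit_bump t)"
  have wF: "locally_integrable {0<..} (\<lambda>t. w t - F t)"
    using w F unfolding locally_integrable_def set_integrable_def by (auto simp: scaleR_diff_right)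
  have "AE t in lborel. 0 < t \<longrightarrow> w t - F t - A = 0"
  proof (rule fundamental_lemma_halfline_rational)
    have "locally_integrable {0<..} (\<lambda>t::real. A)" by (intro continuous_locally_integrable continuous_intros)
    then show "locally_integrable {0<..} (\<lambda>t. w t - F t - A)"
      using wF unfolding locally_integrable_def set_integrable_def by (auto simp: scaleR_diff_right)
    fix n and p q :: real assume pq: "p \<in> \<rat>" "q \<in> \<rat>" "0 < p"
    define b where "b t = complex_of_real (box_bump n p q t)" for t
    define C where "C = (LINT s|lborel. b s)"
    obtain \<theta> where \<theta>: "\<theta> \<in> test_functions {0<..}" "\<And>t. frechet_derivative \<theta> (at t) 1 = b t - C * unit_bump t"
      "(LINT t|lborel. w t * frechet_derivative \<theta> (at t) 1 + g t * \<theta> t) = 0"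
      using weak[OF pq, of n] unfolding b_def C_def by blast
    have b: "b \<in> test_functions {0<..}"
      unfolding b_def[abs_def] using pq by (intro test_functions_box_bump) auto
    note i = locally_integrable_mult_test[OF _ test_functions_pderivative[OF \<theta>(1)], of _ 1]
    have "(LINT t|lborel. (w t - F t) * frechet_derivative \<theta> (at t) 1) =
       (LINT t|lborel. w t * frechet_derivative \<theta> (at t) 1) - (LINT t|lborel. F t * frechet_derivative \<theta> (at t) 1)"
      using i[OF w] i[OF F] by (simp add: left_diff_distrib)
    also have "\<dots> = (LINT t|lborel. w t * frechet_derivative \<theta> (at t) 1) + (LINT t|lborel. g t * \<theta> t)"
      unfolding F_def primitive_integral_by_parts[OF g \<theta>(1)] by simp
    also have "\<dots> = 0"
      using \<theta>(3) i[OF w] locally_integrable_mult_test[OF g \<theta>(1)] by simp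
    finally have "(LINT t|lborel. (w t - F t) * b t - C * ((w t - F t) * unit_bump t)) = 0"
      unfolding \<theta>(2) by (simp add: algebra_simps)
    then have "(LINT t|lborel. (w t - F t) * b t) - C * A = 0"
      using locally_integrable_mult_test[OF wF b] locally_integrable_mult_test[OF wF unit_bump_test]
      by (simp add: A_def)
    moreover have "(LINT t|lborel. (w t - F t - A) * b t) = (LINT t|lborel. (w t - F t) * b t) - A * C"
      using locally_integrable_mult_test[OF wF b] test_functions_integrable[OF b]
      by (simp add: left_diff_distrib[of _ A] C_def)
    ultimately show "(LINT t|lborel. (w t - F t - A) * complex_of_real (box_bump n p q t)) = 0"
      by (simp add: b_def mult.commute)
  qed
  then show ?thesis by (intro exI[of _ A]) (auto simp: F_def algebra_simps)
qed

section \<open>The differential equation on one characteristic\<close>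

definition vector_field :: "real \<Rightarrow> real \<Rightarrow> real \<Rightarrow> complex \<Rightarrow> complex" where
  "vector_field a lam \<sigma> z = \<i> * of_real (a - lam * cmod z powr (2 * \<sigma>)) * z"

lemma constant_if_zero_vector_derivative:
  fixes f :: "real \<Rightarrow> 'b::real_normed_vector"
  assumes "\<And>t. 0 < t \<Longrightarrow> (f has_vector_derivative 0) (at t)" "0 < s" "0 < t"
  shows "f s = f t"
proof -
  have "(f has_derivative (\<lambda>h. 0)) (at x within {0<..})" if "x \<in> {0<..}" for x
    using assms(1)[of x] that unfolding has_vector_derivative_def by (simp add: has_derivative_at_withinI)
  then obtain c where "\<And>x. x \<in> {0<..} \<Longrightarrow> f x = c"
    using has_derivative_zero_constant[of "{0<..}" f] by auto
  then show ?thesis using assms(2,3) by simp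
qed

text \<open>The vector field is orthogonal to \<open>y\<close>, so the modulus is conserved. The
  equation thereby becomes linear with a constant coefficient, and an integrating factor solves
  it.\<close>

lemma vector_field_flow:
  assumes "\<And>t. 0 < t \<Longrightarrow> (y has_vector_derivative vector_field a lam \<sigma> (y t)) (at t)"
  obtains b where "\<And>t. 0 < t \<Longrightarrow> y t = evolve a lam \<sigma> t b"
proof -
  have mod: "((\<lambda>t. y t \<bullet> y t) has_vector_derivative 0) (at t)" if "0 < t" for t
  proof -
    have "((\<lambda>t. y t \<bullet> y t) has_derivative (\<lambda>h. y t \<bullet> (h *\<^sub>R vector_field a lam \<sigma> (y t)) + (h *\<^sub>R vector_field a lam \<sigma> (y t)) \<bullet> y t)) (at t)"
      using assms[OF that] unfolding has_vector_derivative_def by (intro has_derivative_inner)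
    moreover have "y t \<bullet> vector_field a lam \<sigma> (y t) = 0"
      by (simp add: vector_field_def inner_complex_def algebra_simps)
    ultimately show ?thesis by (simp add: has_vector_derivative_def inner_commute)
  qed
  have norm: "cmod (y t) = cmod (y 1)" if "0 < t" for t
    using constant_if_zero_vector_derivative[OF mod that, of 1] by (simp add: norm_eq_sqrt_inner)
  define \<kappa> where "\<kappa> = a - lam * cmod (y 1) powr (2 * \<sigma>)"
  define e where "e t = exp (- \<i> * complex_of_real \<kappa> * of_real (t \<bullet> 1))" for t :: real
  have "smooth e" unfolding e_def[abs_def] by (rule smooth_exp_inner)
  moreover have "pderivative e 1 = (\<lambda>t. - \<i> * of_real \<kappa> * e t)"
    unfolding e_def[abs_def] by (intro ext, subst pderivative_exp_inner) simp
  ultimately have e': "(e has_vector_derivative - \<i> * of_real \<kappa> * e t) (at t)" for t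
    using smooth_pderivative_has_vector_derivative[of e t] by metis
  have "((\<lambda>t. y t * e t) has_vector_derivative 0) (at t)" if "0 < t" for t
  proof -
    have eq: "y t * (- \<i> * of_real \<kappa> * e t) + vector_field a lam \<sigma> (y t) * e t = 0"
      by (simp add: vector_field_def norm[OF that] \<kappa>_def algebra_simps)
    have "((\<lambda>t. y t * e t) has_vector_derivative y t * (- \<i> * of_real \<kappa> * e t) + vector_field a lam \<sigma> (y t) * e t) (at t)"
      by (intro has_vector_derivative_mult assms that e')
    then show ?thesis unfolding eq .
  qed
  note d = this
  have const: "y t * e t = y 1 * e 1" if "0 < t" for t
    by (rule constant_if_zero_vector_derivative[of "\<lambda>t. y t * e t", OF d that zero_less_one])
  show ?thesis
  \<comment> \<open>The state at time 1 carried back to time 0, where nothing is assumed on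
    \<open>y\<close> itself.\<close>
  proof (rule that[of "y 1 * e 1"])
    fix t :: real assume "0 < t"
    have ee: "e t * exp (\<i> * of_real (\<kappa> * t)) = 1"
      by (simp add: e_def mult_exp_exp)
    have "cmod (e 1) = 1" by (simp add: e_def mult.assoc flip: of_real_mult)
    then have "cmod (y 1 * e 1) = cmod (y 1)" by (simp add: norm_mult)
    then have "evolve a lam \<sigma> t (y 1 * e 1) = y 1 * e 1 * exp (\<i> * of_real (\<kappa> * t))"
      by (simp add: evolve_def \<kappa>_def)
    also have "\<dots> = y t * (e t * exp (\<i> * of_real (\<kappa> * t)))"
      using const[OF \<open>0 < t\<close>] by (simp add: mult.assoc[symmetric])
    finally show "y t = evolve a lam \<sigma> t (y 1 * e 1)" unfolding ee by simp
  qed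
qed

lemma vector_field_continuous: "\<sigma> > 0 \<Longrightarrow> continuous_on A (vector_field a lam \<sigma>)"
  unfolding vector_field_def by (intro continuous_intros continuous_on_powr') auto

text \<open>\<open>w\<close> equals the continuous function \<open>y\<close> almost everywhere.
  Replacing \<open>w\<close> by \<open>y\<close> under the integral makes the integrand continuous,
  so \<open>y\<close> is a classical solution.\<close>

lemma mild_solution_is_flow:
  assumes w: "locally_integrable {0<..} (\<lambda>t. vector_field a lam \<sigma> (w t))" and "\<sigma> > 0"
    and mild: "AE t in lborel. 0 < t \<longrightarrow> w t = A + primitive (\<lambda>t. vector_field a lam \<sigma> (w t)) t"
  shows "\<exists>b. AE t in lborel. 0 < t \<longrightarrow> w t = evolve a lam \<sigma> t b"
proof -
  let ?g = "\<lambda>t. vector_field a lam \<sigma> (w t)"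
  define y where "y t = A + primitive ?g t" for t
  have y: "continuous_on {0<..} y" unfolding y_def by (intro continuous_intros primitive_continuous w)
  have vy: "continuous_on {0<..} (\<lambda>t. vector_field a lam \<sigma> (y t))"
    by (rule continuous_on_compose2[OF vector_field_continuous[OF \<open>\<sigma> > 0\<close>] y]) auto
  have eq: "integral {\<alpha>..t} ?g = integral {\<alpha>..t} (\<lambda>t. vector_field a lam \<sigma> (y t))" if "0 < \<alpha>" for \<alpha> t
  proof -
    have "integral {\<alpha>..t} ?g = (LINT s:{\<alpha>..t}|lborel. ?g s)"
      using locally_integrable_halfline_interval(1)[OF w that] by (simp add: set_borel_integral_eq_integral)
    also have "\<dots> = (LINT s:{\<alpha>..t}|lborel. vector_field a lam \<sigma> (y s))"
      unfolding set_lebesgue_integral_def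
    proof (rule integral_cong_AE)
      show "(\<lambda>s. indicat_real {\<alpha>..t} s *\<^sub>R ?g s) \<in> borel_measurable lborel"
        using locally_integrable_halfline_interval(1)[OF w that] unfolding set_integrable_def by (rule borel_measurable_integrable)
      show "(\<lambda>s. indicat_real {\<alpha>..t} s *\<^sub>R vector_field a lam \<sigma> (y s)) \<in> borel_measurable lborel"
        using locally_integrable_halfline_interval(1)[OF continuous_locally_integrable[OF vy] that] unfolding set_integrable_def by (rule borel_measurable_integrable)
      show "AE s in lborel. indicat_real {\<alpha>..t} s *\<^sub>R ?g s = indicat_real {\<alpha>..t} s *\<^sub>R vector_field a lam \<sigma> (y s)"
        using mild by eventually_elim (use that in \<open>auto simp: y_def indicator_def\<close>)
    qed
    also have "\<dots> = integral {\<alpha>..t} (\<lambda>t. vector_field a lam \<sigma> (y t))"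
      using locally_integrable_halfline_interval(1)[OF continuous_locally_integrable[OF vy] that] by (simp add: set_borel_integral_eq_integral)
    finally show ?thesis .
  qed
  have "(y has_vector_derivative vector_field a lam \<sigma> (y t)) (at t)" if "0 < t" for t
  proof -
    have "((\<lambda>u. y (t/2) + integral {t/2..u} (\<lambda>t. vector_field a lam \<sigma> (y t))) has_vector_derivative 0 + vector_field a lam \<sigma> (y t)) (at t within {t/2..t+1})"
      using that by (intro has_vector_derivative_add has_vector_derivative_const integral_has_vector_derivative continuous_on_subset[OF vy]) auto
    then have "((\<lambda>u. y (t/2) + integral {t/2..u} (\<lambda>t. vector_field a lam \<sigma> (y t))) has_vector_derivative vector_field a lam \<sigma> (y t)) (at t)"
      using that by (simp add: at_within_Icc_at)
    then show ?thesis
    proof (rule has_vector_derivative_transform_within_open[of _ _ _ "{t/2<..}"])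
      fix u assume "u \<in> {t/2<..}"
      then show "y (t/2) + integral {t/2..u} (\<lambda>t. vector_field a lam \<sigma> (y t)) = y u"
        using primitive_diff[OF w, of "t/2" u] that eq[of "t/2" u] by (simp add: y_def)
    qed (use that in auto)
  qed
  then obtain b where "\<And>t. 0 < t \<Longrightarrow> y t = evolve a lam \<sigma> t b" using vector_field_flow by metis
  then show ?thesis using mild by (intro exI[of _ b]) (auto simp: y_def elim!: eventually_mono)
qed

section \<open>Uniqueness\<close>

lemma in_spacetime [simp]: "(t, x) \<in> spacetime \<longleftrightarrow> 0 < t"
  by (simp add: spacetime_def)

lemma shear_in_spacetime [simp]: "shear c p \<in> spacetime \<longleftrightarrow> p \<in> spacetime"
  by (simp add: shear_def spacetime_def split: prod.split)

lemma locally_integrable_cong: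
  assumes "\<And>x. x \<in> \<Omega> \<Longrightarrow> f x = g x" "locally_integrable \<Omega> f" shows "locally_integrable \<Omega> g"
  unfolding locally_integrable_def
proof (intro allI impI, elim conjE)
  fix K assume K: "compact K" "K \<subseteq> \<Omega>"
  then have "set_integrable lborel K f" using assms(2) unfolding locally_integrable_def by simp
  moreover have "(\<lambda>x. indicat_real K x *\<^sub>R f x) = (\<lambda>x. indicat_real K x *\<^sub>R g x)"
    using K(2) assms(1) by (intro ext) (auto simp: indicator_def)
  ultimately show "set_integrable lborel K g" by (simp add: set_integrable_def)
qed

lemma locally_integrable_add:
  "locally_integrable \<Omega> f \<Longrightarrow> locally_integrable \<Omega> g \<Longrightarrow> locally_integrable \<Omega> (\<lambda>x. f x + g x)"
  unfolding locally_integrable_def set_integrable_def by (simp add: scaleR_add_right)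

lemma locally_integrable_cmult:
  "locally_integrable \<Omega> f \<Longrightarrow> locally_integrable \<Omega> (\<lambda>x. a * f x)"
  unfolding locally_integrable_def set_integrable_def
  by (auto simp flip: mult_scaleR_right intro!: integrable_mult_right)

text \<open>A compact exhaustion; being countable, it passes local integrability on to almost every
  line.\<close>

definition spacetime_part :: "nat \<Rightarrow> (real \<times> 'a::euclidean_space) set" where
  "spacetime_part n = {inverse (real (Suc n))..real (Suc n)} \<times> cball 0 (real (Suc n))"

lemma spacetime_part: "compact (spacetime_part n)" "spacetime_part n \<subseteq> spacetime"
proof -
  show "compact (spacetime_part n)"
    unfolding spacetime_part_def by (intro compact_Times compact_Icc compact_cball)
  have "0 < t" if "inverse (real (Suc n)) \<le> t" for t
    by (rule less_le_trans[OF _ that]) simp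
  then show "spacetime_part n \<subseteq> spacetime"
    by (auto simp: spacetime_part_def spacetime_def simp del: of_nat_Suc)
qed

lemma spacetime_part_mem:
  fixes x :: "'a::euclidean_space"
  assumes "0 < \<alpha>" "norm x \<le> R"
  obtains N where "\<And>n t. N \<le> n \<Longrightarrow> \<alpha> \<le> t \<Longrightarrow> t \<le> \<beta> \<Longrightarrow> (t, x) \<in> spacetime_part n"
proof -
  obtain N :: nat where N: "max (inverse \<alpha>) (max \<beta> R) < real N" using reals_Archimedean2 by blast
  show ?thesis
  proof (rule that[of N])
    fix n t assume n: "N \<le> n" "\<alpha> \<le> t" "t \<le> \<beta>"
    have "inverse \<alpha> < real (Suc n)" "\<beta> \<le> real (Suc n)" "R \<le> real (Suc n)" using N n by auto
    moreover from this(1) have "inverse (real (Suc n)) < \<alpha>"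
      using less_imp_inverse_less[of "inverse \<alpha>" "real (Suc n)"] assms by simp
    ultimately show "(t, x) \<in> spacetime_part n"
      using n assms by (auto simp: spacetime_part_def)
  qed
qed

text \<open>Local integrability says nothing about \<open>f\<close> outside the half-space, so
  measurability is claimed for the extension by zero, a limit of cut-offs to the compact
  exhaustion.\<close>

lemma locally_integrable_spacetime_measurable:
  fixes f :: "real \<times> 'a::euclidean_space \<Rightarrow> complex"
  assumes f: "locally_integrable spacetime f"
  shows "(\<lambda>p. indicat_real spacetime p *\<^sub>R f p) \<in> borel_measurable borel"
proof (rule borel_measurable_LIMSEQ_metric)
  show "(\<lambda>p. indicat_real (spacetime_part n) p *\<^sub>R f p) \<in> borel_measurable borel" for n
    using f[unfolded locally_integrable_def, rule_format, OF conjI[OF spacetime_part[of n]]]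
    unfolding set_integrable_def using borel_measurable_integrable by force
  fix p :: "real \<times> 'a"
  show "(\<lambda>n. indicat_real (spacetime_part n) p *\<^sub>R f p) \<longlonglongrightarrow> indicat_real spacetime p *\<^sub>R f p"
  proof (cases "p \<in> spacetime")
    case True
    then have "0 < fst p" by (simp add: spacetime_def)
    then obtain N where "\<And>n t. N \<le> n \<Longrightarrow> fst p \<le> t \<Longrightarrow> t \<le> fst p \<Longrightarrow> (t, snd p) \<in> spacetime_part n"
      using spacetime_part_mem[OF _ order_refl] by metis
    then have "p \<in> spacetime_part n" if "N \<le> n" for n
      using that by (metis order_refl prod.collapse)
    then have "eventually (\<lambda>n. indicat_real spacetime p *\<^sub>R f p = indicat_real (spacetime_part n) p *\<^sub>R f p) sequentially"
      using True by (intro eventually_sequentiallyI[of N]) simp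
    then show ?thesis by (rule Lim_transform_eventually[OF tendsto_const])
  next
    case False
    then have "p \<notin> spacetime_part n" for n using spacetime_part(2) by blast
    then show ?thesis using False by simp
  qed
qed

lemma locally_integrable_shear:
  fixes f :: "real \<times> 'a::euclidean_space \<Rightarrow> complex"
  assumes f: "locally_integrable spacetime f"
  shows "locally_integrable spacetime (\<lambda>p. f (shear c p))"
  unfolding locally_integrable_def
proof (intro allI impI, elim conjE)
  fix K :: "(real \<times> 'a) set" assume K: "compact K" "K \<subseteq> spacetime"
  define K' where "K' = shear c ` K"
  have "compact K'" unfolding K'_def by (intro compact_continuous_image shear_continuous K)
  moreover have "K' \<subseteq> spacetime" unfolding K'_def using K(2) by auto
  ultimately have i: "integrable lborel (\<lambda>p. indicat_real K' p *\<^sub>R f p)"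
    using f unfolding locally_integrable_def set_integrable_def by blast
  have "(\<lambda>p. indicat_real K' p *\<^sub>R f p) \<in> borel_measurable borel"
    using borel_measurable_integrable[OF i] by simp
  from lborel_integral_shear(2)[OF this, of c] i
  have "integrable lborel (\<lambda>p. indicat_real K' (shear c p) *\<^sub>R f (shear c p))" by simp
  moreover have "indicat_real K' (shear c p) = indicat_real K p" for p
    unfolding K'_def indicator_def by (auto, metis shear_inverse(1))
  ultimately show "set_integrable lborel K (\<lambda>p. f (shear c p))" by (simp add: set_integrable_def)
qed

text \<open>A product in straightened coordinates: at \<open>shear c (t, y)\<close> its value is
  \<open>\<theta> t * \<psi> y\<close>.\<close>

lemma test_functions_characteristic_tensor:
  fixes \<psi> :: "'a::euclidean_space \<Rightarrow> complex"
  assumes \<theta>: "\<theta> \<in> test_functions {0::real<..}" and \<psi>: "\<psi> \<in> test_functions UNIV"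
  shows "(\<lambda>p. \<theta> (fst p) * \<psi> (snd p + fst p *\<^sub>R c)) \<in> test_functions spacetime"
proof -
  obtain K where K: "compact K" "K \<subseteq> {0<..}" "\<And>t. t \<notin> K \<Longrightarrow> \<theta> t = 0" using test_functionsE[OF \<theta>] by metis
  obtain L where L: "compact L" "\<And>t. t \<notin> L \<Longrightarrow> \<psi> t = 0" using test_functionsE[OF \<psi>] by metis
  show ?thesis
  proof (rule test_functionsI[where K = "shear c ` (K \<times> L)"])
    show "smooth (\<lambda>p. \<theta> (fst p) * \<psi> (snd p + fst p *\<^sub>R c))"
      by (intro smooth_mult smooth_linear[OF test_functions_smooth[OF \<theta>]] smooth_linear[OF test_functions_smooth[OF \<psi>]])
         (auto intro!: linearI simp: algebra_simps)
    show "compact (shear c ` (K \<times> L))" by (intro compact_continuous_image shear_continuous compact_Times K L)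
    show "shear c ` (K \<times> L) \<subseteq> spacetime" using K(2) by auto
    fix p assume p: "p \<notin> shear c ` (K \<times> L)"
    have "p = shear c (fst p, snd p + fst p *\<^sub>R c)" by (simp add: shear_def)
    then have "fst p \<notin> K \<or> snd p + fst p *\<^sub>R c \<notin> L" using p by (metis imageI mem_Sigma_iff)
    then show "\<theta> (fst p) * \<psi> (snd p + fst p *\<^sub>R c) = 0" using K(3) L(2) by auto
  qed
qed

lemma test_functions_tensor:
  fixes \<psi> :: "'a::euclidean_space \<Rightarrow> complex"
  assumes "\<theta> \<in> test_functions {0::real<..}" "\<psi> \<in> test_functions UNIV"
  shows "(\<lambda>p. \<theta> (fst p) * \<psi> (snd p)) \<in> test_functions spacetime"
  using test_functions_characteristic_tensor[OF assms, of 0] by simp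

lemma vector_field_eq_nonlinearity:
  "vector_field a lam \<sigma> z = \<i> * of_real a * z + - \<i> * of_real lam * nonlinearity \<sigma> z"
  by (simp add: vector_field_def nonlinearity_def algebra_simps)

text \<open>For a product in straightened coordinates the derivative along the characteristic falls
  on \<theta> alone, and \<psi> remains as a free weight in the label of the characteristic.\<close>

lemma weak_equation_straightened:
  fixes V :: "real \<times> 'a::euclidean_space \<Rightarrow> complex"
  assumes V: "locally_integrable spacetime V" and NV: "locally_integrable spacetime (\<lambda>p. nonlinearity \<sigma> (V p))"
    and eq: "dist_eq spacetime
          (\<lambda>\<phi>. \<i> * dist_time_deriv (regular_dist V) \<phi> + dist_space_multiplier (\<lambda>\<xi>. a + c \<bullet> \<xi>) (regular_dist V) \<phi>)
          (\<lambda>\<phi>. complex_of_real lam * regular_dist (\<lambda>p. nonlinearity \<sigma> (V p)) \<phi>)"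
    and \<theta>: "\<theta> \<in> test_functions {0::real<..}" and \<psi>: "\<psi> \<in> test_functions UNIV"
  shows "(LINT p|lborel. (V (shear c p) * frechet_derivative \<theta> (at (fst p)) 1
      + vector_field a lam \<sigma> (V (shear c p)) * \<theta> (fst p)) * \<psi> (snd p)) = 0"
proof -
  define \<phi> where "\<phi> p = \<theta> (fst p) * \<psi> (snd p + fst p *\<^sub>R c)" for p
  have \<phi>: "\<phi> \<in> test_functions spacetime" unfolding \<phi>_def[abs_def] by (rule test_functions_characteristic_tensor[OF \<theta> \<psi>])
  have \<phi>U: "\<phi> \<in> test_functions UNIV" using \<phi> spacetime_subset by blast
  define q where "q = (\<lambda>p. - \<i> * frechet_derivative \<phi> (at p) (1, - c) + of_real a * \<phi> p)"
  have q: "q \<in> test_functions spacetime" unfolding q_def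
    by (intro test_functions_add test_functions_mult[OF _ smooth_const] test_functions_pderivative \<phi>)
  note i1 = locally_integrable_mult_test[OF V q] and i2 = locally_integrable_mult_test[OF NV \<phi>]
  define G where "G p = V p * q p - of_real lam * (nonlinearity \<sigma> (V p) * \<phi> p)" for p
  have Gi: "integrable lborel G" unfolding G_def[abs_def] using i1 i2 by auto
  have "(LINT p|lborel. V p * q p) = \<i> * dist_time_deriv (regular_dist V) \<phi> + dist_space_multiplier (\<lambda>\<xi>. a + c \<bullet> \<xi>) (regular_dist V) \<phi>"
    unfolding q_def by (rule weak_form_along_characteristics[OF V \<phi>, symmetric])
  also have "\<dots> = of_real lam * (LINT p|lborel. nonlinearity \<sigma> (V p) * \<phi> p)"
    using eq \<phi> unfolding dist_eq_def regular_dist_def[of "\<lambda>p. nonlinearity \<sigma> (V p)"] by blast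
  finally have "(LINT p|lborel. G p) = 0"
    unfolding G_def using i1 i2 by simp
  moreover have "(LINT p|lborel. G (shear c p)) = (LINT p|lborel. G p)"
    using borel_measurable_integrable[OF Gi] by (intro lborel_integral_shear) simp
  moreover have "G (shear c p) = - \<i> * ((V (shear c p) * frechet_derivative \<theta> (at (fst p)) 1
      + vector_field a lam \<sigma> (V (shear c p)) * \<theta> (fst p)) * \<psi> (snd p))" for p
  proof (cases p)
    case (Pair t y)
    have \<phi>s: "\<phi> (t, y - t *\<^sub>R c) = \<theta> t * \<psi> y" for t by (simp add: \<phi>_def)
    have "((\<lambda>t. \<theta> t * \<psi> y) has_vector_derivative frechet_derivative \<theta> (at t) 1 * \<psi> y) (at t)" for t
      by (intro has_vector_derivative_mult_left smooth_pderivative_has_vector_derivative test_functions_smooth[OF \<theta>])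
    from vector_derivative_pderivative[OF this, THEN fun_cong]
    have "frechet_derivative \<phi> (at (t, y - t *\<^sub>R c)) (1, - c) = frechet_derivative \<theta> (at t) 1 * \<psi> y"
      using test_functions_slice_characteristic(2)[OF \<phi>U, of y c t] unfolding \<phi>s by simp
    then show ?thesis
      unfolding G_def q_def Pair shear_def vector_field_eq_nonlinearity
      by (simp add: \<phi>s algebra_simps)
  qed
  ultimately show ?thesis by simp
qed

section \<open>From the weak equation to the flow on almost every characteristic\<close>

lemma AE_exists_in_open:
  assumes "AE x in lborel. Q (x::'a::euclidean_space)" "open S" "S \<noteq> {}"
  shows "\<exists>x\<in>S. Q x"
proof (rule ccontr)
  assume "\<not> (\<exists>x\<in>S. Q x)"
  then have "AE x in lborel. x \<notin> S" using assms(1) by (auto elim!: eventually_mono)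
  then have "emeasure lborel S = 0"
    using assms(2) by (subst (asm) AE_iff_measurable[of S]) auto
  then have "S \<in> null_sets lebesgue" using assms(2) by (intro null_sets_completionI) auto
  then show False using open_not_negligible[OF assms(2,3)] by (simp add: negligible_iff_null_sets)
qed

text \<open>Only times to the right of \<open>t\<close> are used, so the conclusion includes the
  initial time 0.\<close>

lemma continuous_on_eq_if_AE_eq:
  fixes f g :: "real \<Rightarrow> complex"
  assumes f: "continuous_on {0..} f" and g: "continuous_on {0..} g"
    and ae: "AE t in lborel. 0 < t \<longrightarrow> f t = g t" and t: "0 \<le> t"
  shows "f t = g t"
proof (rule ccontr)
  assume ne: "f t \<noteq> g t"
  have "continuous_on {0..} (\<lambda>t. f t - g t)" by (intro continuous_intros f g)
  then obtain d where d: "d > 0" "\<And>s. s \<in> {0..} \<Longrightarrow> dist s t < d \<Longrightarrow> dist (f s - g s) (f t - g t) < cmod (f t - g t)"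
    using t ne unfolding continuous_on_iff by (metis atLeast_iff diff_self norm_eq_zero right_minus_eq zero_less_norm_iff)
  have "{t<..<t + d} \<noteq> {}" using d(1) by simp
  with AE_exists_in_open[OF ae, of "{t<..<t + d}"] obtain s where s: "s \<in> {t<..<t + d}" "0 < s \<longrightarrow> f s = g s" by auto
  then have "f s = g s" using t by auto
  moreover have "dist (f s - g s) (f t - g t) < cmod (f t - g t)" using s t by (intro d(2)) (auto simp: dist_real_def)
  ultimately show False by (simp add: dist_norm norm_minus_commute)
qed

lemma evolve_inverse: "evolve a lam \<sigma> (- t) (evolve a lam \<sigma> t z) = z"
proof -
  have "evolve a lam \<sigma> (- t) (evolve a lam \<sigma> t z) = z * (exp (\<i> * of_real ((a - lam * cmod z powr (2 * \<sigma>)) * t)) * exp (\<i> * of_real ((a - lam * cmod z powr (2 * \<sigma>)) * (- t))))"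
    unfolding evolve_def[of a lam \<sigma> "- t"] cmod_evolve unfolding evolve_def by (simp add: mult.assoc)
  then show ?thesis by (simp add: mult_exp_exp)
qed

lemma borel_measurable_slice:
  fixes W :: "real \<times> 'a::euclidean_space \<Rightarrow> complex"
  assumes "W \<in> borel_measurable borel"
  shows "(\<lambda>t. W (t, y)) \<in> borel_measurable borel" "(\<lambda>y. W (t, y)) \<in> borel_measurable borel"
proof -
  have "(\<lambda>t. (t, y)) \<in> borel_measurable borel" by (intro borel_measurable_continuous_onI continuous_intros)
  from measurable_compose[OF this assms] show "(\<lambda>t. W (t, y)) \<in> borel_measurable borel" .
  have "(\<lambda>y. (t, y)) \<in> borel_measurable (borel :: 'a measure)" by (intro borel_measurable_continuous_onI continuous_intros)
  from measurable_compose[OF this assms] show "(\<lambda>y. W (t, y)) \<in> borel_measurable borel" .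
qed

lemma AE_locally_integrable_lines:
  fixes W :: "real \<times> 'a::euclidean_space \<Rightarrow> complex"
  assumes W: "locally_integrable spacetime W"
  shows "AE y in lborel. locally_integrable {0<..} (\<lambda>t. W (t, y))"
proof -
  have "AE y in lborel. \<forall>n. integrable lborel (\<lambda>t. indicat_real (spacetime_part n) (t, y) *\<^sub>R W (t, y))"
    unfolding AE_all_countable
  proof
    fix n
    have "integrable (lborel \<Otimes>\<^sub>M lborel) (\<lambda>(t, y). indicat_real (spacetime_part n) (t, y) *\<^sub>R W (t, y))"
      using W[unfolded locally_integrable_def set_integrable_def, rule_format, OF conjI[OF spacetime_part[of n]]]
      by (simp add: lborel_prod case_prod_beta')
    then show "AE y in lborel. integrable lborel (\<lambda>t. indicat_real (spacetime_part n) (t, y) *\<^sub>R W (t, y))"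
      by (rule lborel_pair.AE_integrable_snd)
  qed
  then show ?thesis
  proof eventually_elim
    case (elim y)
    show ?case unfolding locally_integrable_def
    proof (intro allI impI, elim conjE)
      fix K assume K: "compact K" "K \<subseteq> {0::real<..}"
      obtain \<alpha> \<beta> where ab: "0 < \<alpha>" "K \<subseteq> {\<alpha>..\<beta>}" using compact_in_halfline[OF K] by metis
      obtain N where N: "\<And>n t. N \<le> n \<Longrightarrow> \<alpha> \<le> t \<Longrightarrow> t \<le> \<beta> \<Longrightarrow> (t, y) \<in> spacetime_part n"
        using spacetime_part_mem[OF ab(1) order_refl] by metis
      have "integrable lborel (\<lambda>t. indicat_real K t *\<^sub>R (indicat_real (spacetime_part N) (t, y) *\<^sub>R W (t, y)))"
        using K(1) elim[rule_format, of N] by (intro integrable_mult_indicator) (auto simp: compact_imp_closed borel_closed)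
      moreover have "(\<lambda>t. indicat_real K t *\<^sub>R (indicat_real (spacetime_part N) (t, y) *\<^sub>R W (t, y))) = (\<lambda>t. indicat_real K t *\<^sub>R W (t, y))"
      proof
        fix t
        have "t \<in> K \<Longrightarrow> (t, y) \<in> spacetime_part N" using ab(2) by (intro N) auto
        then show "indicat_real K t *\<^sub>R (indicat_real (spacetime_part N) (t, y) *\<^sub>R W (t, y)) = indicat_real K t *\<^sub>R W (t, y)"
          by (cases "t \<in> K") auto
      qed
      ultimately show "set_integrable lborel K (\<lambda>t. W (t, y))" by (simp add: set_integrable_def)
    qed
  qed
qed

text \<open>By Fubini the expression pairs the inner time integral with \<psi>, and \<psi> is
  arbitrary. The exceptional null set still depends on \<theta>.\<close>

lemma AE_zero_on_lines:
  fixes W f :: "real \<times> 'a::euclidean_space \<Rightarrow> complex"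
  assumes W: "locally_integrable spacetime W" and f: "locally_integrable spacetime f"
    and weak: "\<And>\<psi>. \<psi> \<in> test_functions UNIV \<Longrightarrow>
      (LINT p|lborel. (W p * frechet_derivative \<theta> (at (fst p)) 1 + f p * \<theta> (fst p)) * \<psi> (snd p)) = 0"
    and \<theta>: "\<theta> \<in> test_functions {0<..}"
  shows "AE y in lborel. (LINT t|lborel. W (t, y) * frechet_derivative \<theta> (at t) 1 + f (t, y) * \<theta> t) = 0"
proof -
  define h where "h y = (LINT t|lborel. W (t, y) * frechet_derivative \<theta> (at t) 1 + f (t, y) * \<theta> t)" for y
  have \<psi>: "integrable lborel (\<lambda>y. h y * \<psi> y) \<and> (LINT y|lborel. h y * \<psi> y) = 0" if "\<psi> \<in> test_functions UNIV" for \<psi>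
  proof -
    have "integrable lborel (\<lambda>p. W p * (frechet_derivative \<theta> (at (fst p)) 1 * \<psi> (snd p)))"
      by (intro locally_integrable_mult_test[OF W] test_functions_tensor test_functions_pderivative \<theta> that)
    moreover have "integrable lborel (\<lambda>p. f p * (\<theta> (fst p) * \<psi> (snd p)))"
      by (intro locally_integrable_mult_test[OF f] test_functions_tensor \<theta> that)
    ultimately have "integrable lborel (\<lambda>p. (W p * frechet_derivative \<theta> (at (fst p)) 1 + f p * \<theta> (fst p)) * \<psi> (snd p))"
      by (simp add: distrib_right mult.assoc)
    then have i: "integrable (lborel \<Otimes>\<^sub>M lborel) (\<lambda>(t, y). (W (t, y) * frechet_derivative \<theta> (at t) 1 + f (t, y) * \<theta> t) * \<psi> y)"
      by (simp add: lborel_prod case_prod_beta')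
    have "integrable lborel (\<lambda>y. h y * \<psi> y)"
      using lborel_pair.integrable_snd[OF i] by (simp add: h_def)
    moreover have "(LINT y|lborel. h y * \<psi> y) = 0"
      using lborel_pair.integral_snd[OF i] weak[OF that] by (simp add: h_def lborel_prod case_prod_beta')
    ultimately show ?thesis ..
  qed
  have "AE y in lborel. h y = 0"
    by (rule AE_eq_if_equal_integrals) (use \<psi> in auto)
  then show ?thesis by (simp add: h_def)
qed

text \<open>To obtain one null set for all times, a single \<theta> is fixed in advance for each
  bump with rational endpoints; the index set \<open>I\<close> is countable.\<close>

lemma AE_flow_on_lines:
  fixes W :: "real \<times> 'a::euclidean_space \<Rightarrow> complex"
  assumes W: "locally_integrable spacetime W" and f: "locally_integrable spacetime (\<lambda>p. vector_field a lam \<sigma> (W p))"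
    and weak: "\<And>\<theta> \<psi>. \<theta> \<in> test_functions {0<..} \<Longrightarrow> \<psi> \<in> test_functions UNIV \<Longrightarrow>
      (LINT p|lborel. (W p * frechet_derivative \<theta> (at (fst p)) 1 + vector_field a lam \<sigma> (W p) * \<theta> (fst p)) * \<psi> (snd p)) = 0"
    and "\<sigma> > 0"
  shows "AE y in lborel. \<exists>b. AE t in lborel. 0 < t \<longrightarrow> W (t, y) = evolve a lam \<sigma> t b"
proof -
  define I :: "(nat \<times> real \<times> real) set" where "I = UNIV \<times> (\<rat> \<inter> {0<..}) \<times> \<rat>"
  have "countable I" unfolding I_def by (intro countable_SIGMA countable_Int1 countable_rat) auto
  have ex: "\<exists>\<theta>. \<theta> \<in> test_functions {0<..} \<and> (\<forall>t. frechet_derivative \<theta> (at t) 1 =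
      complex_of_real (box_bump n p q t) - (LINT s|lborel. complex_of_real (box_bump n p q s)) * unit_bump t)"
    if "0 < p" for n and p q :: real
  proof -
    define b where "b t = complex_of_real (box_bump n p q t)" for t
    define C where "C = (LINT s|lborel. b s)"
    have b: "b \<in> test_functions {0<..}"
      unfolding b_def[abs_def] using \<open>0 < p\<close> by (intro test_functions_box_bump) auto
    have 1: "(\<lambda>t. b t + - C * unit_bump t) \<in> test_functions {0<..}"
      by (intro test_functions_add b test_functions_mult[OF unit_bump_test smooth_const])
    have 2: "(LINT t|lborel. b t + - C * unit_bump t) = 0"
      using test_functions_integrable[OF b] test_functions_integrable[OF unit_bump_test] unit_bump_integral
      by (simp add: C_def)
    obtain \<theta> where "\<theta> \<in> test_functions {0<..}" "\<And>t. frechet_derivative \<theta> (at t) 1 = b t + - C * unit_bump t"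
      using test_function_primitive[OF 1 2] by blast
    then show ?thesis
      unfolding b_def C_def by (intro exI[of _ \<theta>]) simp
  qed
  have "\<forall>i\<in>I. \<exists>\<theta>. \<theta> \<in> test_functions {0<..} \<and> (\<forall>t. frechet_derivative \<theta> (at t) 1 =
     (case i of (n, p, q) \<Rightarrow> complex_of_real (box_bump n p q t) - (LINT s|lborel. complex_of_real (box_bump n p q s)) * unit_bump t))"
    using ex by (auto simp: I_def)
  from bchoice[OF this] obtain \<Theta> where \<Theta>': "\<forall>i\<in>I. \<Theta> i \<in> test_functions {0<..} \<and> (\<forall>t. frechet_derivative (\<Theta> i) (at t) 1 =
     (case i of (n, p, q) \<Rightarrow> complex_of_real (box_bump n p q t) - (LINT s|lborel. complex_of_real (box_bump n p q s)) * unit_bump t))"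
    by (elim exE)
  have \<Theta>: "\<Theta> i \<in> test_functions {0<..}" if "i \<in> I" for i using \<Theta>' that by simp
  have \<Theta>d: "frechet_derivative (\<Theta> (n, p, q)) (at t) 1 =
      complex_of_real (box_bump n p q t) - (LINT s|lborel. complex_of_real (box_bump n p q s)) * unit_bump t"
    if "(n, p, q) \<in> I" for n p q t using bspec[OF \<Theta>' that] by simp
  have "AE y in lborel. \<forall>i\<in>I. (LINT t|lborel. W (t, y) * frechet_derivative (\<Theta> i) (at t) 1 + vector_field a lam \<sigma> (W (t, y)) * \<Theta> i t) = 0"
    by (subst AE_ball_countable[OF \<open>countable I\<close>]) (intro ballI AE_zero_on_lines[OF W f weak] \<Theta>)
  moreover note AE_locally_integrable_lines[OF W] AE_locally_integrable_lines[OF f]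
  ultimately show ?thesis
  proof eventually_elim
    case (elim y)
    have "\<exists>A. AE t in lborel. 0 < t \<longrightarrow> W (t, y) = A + primitive (\<lambda>t. vector_field a lam \<sigma> (W (t, y))) t"
    proof (rule weak_derivative_halfline[OF elim(2,3)])
      fix n and p q :: real assume "p \<in> \<rat>" "q \<in> \<rat>" "0 < p"
      then have i: "(n, p, q) \<in> I" by (simp add: I_def)
      show "\<exists>\<theta>\<in>test_functions {0<..}. (\<forall>t. frechet_derivative \<theta> (at t) 1 =
           complex_of_real (box_bump n p q t) - (LINT s|lborel. complex_of_real (box_bump n p q s)) * unit_bump t) \<and>
        (LINT t|lborel. W (t, y) * frechet_derivative \<theta> (at t) 1 + vector_field a lam \<sigma> (W (t, y)) * \<theta> t) = 0"
        using \<Theta>[OF i] \<Theta>d[OF i] bspec[OF elim(1) i] by (intro bexI[of _ "\<Theta> (n, p, q)"] conjI allI)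
    qed
    then show ?case using mild_solution_is_flow[OF elim(3) \<open>\<sigma> > 0\<close>] by blast
  qed
qed

text \<open>Each line supplies its own value, but not a measurable choice. The backward flow
  recovers this value as a constant in \<open>t\<close>; averaging over \<open>{1..2}\<close>, an
  interval of length 1, gives a formula that is measurable in \<open>y\<close>. Measurability also
  permits the exchange of the two almost-everywhere quantifiers.\<close>

lemma exists_measurable_profile:
  fixes W :: "real \<times> 'a::euclidean_space \<Rightarrow> complex"
  assumes [measurable]: "W \<in> borel_measurable borel"
    and flow: "AE y in lborel. \<exists>b. AE t in lborel. 0 < t \<longrightarrow> W (t, y) = evolve a lam \<sigma> t b"
  obtains b where "b \<in> borel_measurable borel"
    "AE t in lborel. AE y in lborel. 0 < t \<longrightarrow> W (t, y) = evolve a lam \<sigma> t (b y)"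
proof -
  define b where "b y = (LINT t:{1..2}|lborel. evolve a lam \<sigma> (- t) (W (t, y)))" for y
  have Wp [measurable]: "W \<in> borel_measurable (borel \<Otimes>\<^sub>M borel)" by (simp add: borel_prod)
  have bm [measurable]: "b \<in> borel_measurable borel"
    unfolding b_def[abs_def] set_lebesgue_integral_def by measurable
  have "AE y in lborel. AE t in lborel. 0 < t \<longrightarrow> W (t, y) = evolve a lam \<sigma> t (b y)"
    using flow
  proof eventually_elim
    case (elim y)
    then obtain z where z: "AE t in lborel. 0 < t \<longrightarrow> W (t, y) = evolve a lam \<sigma> t z" by blast
    have [measurable]: "(\<lambda>t. W (t, y)) \<in> borel_measurable borel" by (rule borel_measurable_slice[OF assms(1)])
    have "b y = (LINT t:{1..2::real}|lborel. z)"
      unfolding b_def set_lebesgue_integral_def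
    proof (rule integral_cong_AE)
      show "AE t in lborel. indicat_real {1..2} t *\<^sub>R evolve a lam \<sigma> (- t) (W (t, y)) = indicat_real {1..2} t *\<^sub>R z"
        using z by eventually_elim (auto simp: indicator_def evolve_inverse)
    qed measurable
    also have "\<dots> = z" by (simp add: set_lebesgue_integral_def)
    finally show ?case using z by simp
  qed
  moreover have "{p \<in> space (lborel \<Otimes>\<^sub>M lborel). 0 < fst p \<longrightarrow> W (fst p, snd p) = evolve a lam \<sigma> (fst p) (b (snd p))} \<in> sets (lborel \<Otimes>\<^sub>M lborel)"
    by measurable
  ultimately have "AE t in lborel. AE y in lborel. 0 < t \<longrightarrow> W (t, y) = evolve a lam \<sigma> t (b y)"
    by (subst lborel_pair.AE_commute)
  then show ?thesis by (rule that[OF bm])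
qed

lemma locally_integrable_translate:
  fixes f :: "'a::euclidean_space \<Rightarrow> complex"
  assumes "locally_integrable UNIV f" shows "locally_integrable UNIV (\<lambda>x. f (p + x))"
  unfolding locally_integrable_def
proof (intro allI impI, elim conjE)
  fix K :: "'a set" assume "compact K"
  then have "compact ((+) p ` K)" by (intro compact_continuous_image continuous_intros)
  then have i: "integrable lborel (\<lambda>x. indicat_real ((+) p ` K) x *\<^sub>R f x)"
    using assms unfolding locally_integrable_def set_integrable_def by simp
  have "integrable lborel (\<lambda>x. indicat_real ((+) p ` K) (p + x) *\<^sub>R f (p + x))"
    using i borel_measurable_integrable[OF i] by (subst lborel_translate_integral(2)) auto
  moreover have "indicat_real ((+) p ` K) (p + x) = indicat_real K x" for x by (auto simp: indicator_def)
  ultimately show "set_integrable lborel K (\<lambda>x. f (p + x))" by (simp add: set_integrable_def)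
qed

text \<open>The slices of \<open>V\<close> represent \<open>v t\<close> only for almost every time,
  so the flow identity is first obtained for such \<open>t\<close> and then extended by weak
  continuity of both sides. At time 0 it identifies the profile \<open>b\<close> with
  \<open>u0\<close>, after which the solution is known at all times.\<close>

theorem evolve_unique:
  fixes u0 :: "'a::euclidean_space \<Rightarrow> complex" and c :: 'a
  assumes u0: "integrable lborel u0" and "\<sigma> > 0"
    and sol: "solves_cauchy_problem (\<lambda>\<xi>. a + c \<bullet> \<xi>) lam \<sigma> (regular_dist u0) v" and "0 \<le> t"
  shows "dist_eq UNIV (v t) (regular_dist (\<lambda>x. evolve a lam \<sigma> t (u0 (x + t *\<^sub>R c))))"
proof -
  have [measurable]: "u0 \<in> borel_measurable borel" using borel_measurable_integrable[OF u0] by simp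
  obtain V where V: "locally_integrable spacetime V" "locally_integrable spacetime (\<lambda>p. nonlinearity \<sigma> (V p))"
    and slice: "AE t in lborel. 0 < t \<longrightarrow> locally_integrable UNIV (\<lambda>x. V (t, x)) \<and> dist_eq UNIV (v t) (regular_dist (\<lambda>x. V (t, x)))"
    and eq: "dist_eq spacetime
          (\<lambda>\<phi>. \<i> * dist_time_deriv (regular_dist V) \<phi> + dist_space_multiplier (\<lambda>\<xi>. a + c \<bullet> \<xi>) (regular_dist V) \<phi>)
          (\<lambda>\<phi>. complex_of_real lam * regular_dist (\<lambda>p. nonlinearity \<sigma> (V p)) \<phi>)"
    using sol unfolding solves_cauchy_problem_def by blast
  have vcont: "continuous_on {0..} (\<lambda>t. v t \<phi>)" and v0: "v 0 \<phi> = regular_dist u0 \<phi>" if "\<phi> \<in> test_functions UNIV" for \<phi>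
    using sol that unfolding solves_cauchy_problem_def continuous_curve_in_distributions_def dist_eq_def by auto
  define V0 where "V0 p = indicat_real spacetime p *\<^sub>R V p" for p
  have [measurable]: "V0 \<in> borel_measurable borel"
    unfolding V0_def[abs_def] by (rule locally_integrable_spacetime_measurable[OF V(1)])
  define W where "W p = V0 (shear c p)" for p
  have Wm: "W \<in> borel_measurable borel" unfolding W_def[abs_def] by measurable
  have WV: "W p = V (shear c p)" if "p \<in> spacetime" for p using that by (simp add: W_def V0_def)
  have W: "locally_integrable spacetime W"
    by (rule locally_integrable_cong[OF WV[symmetric] locally_integrable_shear[OF V(1)]])
  have f: "locally_integrable spacetime (\<lambda>p. vector_field a lam \<sigma> (W p))"
  proof (rule locally_integrable_cong)
    show "locally_integrable spacetime (\<lambda>p. \<i> * of_real a * V (shear c p) + - \<i> * of_real lam * nonlinearity \<sigma> (V (shear c p)))"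
      by (intro locally_integrable_add locally_integrable_cmult locally_integrable_shear[OF V(1)] locally_integrable_shear[OF V(2)])
  qed (simp add: WV vector_field_eq_nonlinearity)
  have lines: "AE y in lborel. \<exists>b. AE t in lborel. 0 < t \<longrightarrow> W (t, y) = evolve a lam \<sigma> t b"
  proof (rule AE_flow_on_lines[OF W f _ \<open>\<sigma> > 0\<close>])
    fix \<theta> :: "real \<Rightarrow> complex" and \<psi> :: "'a \<Rightarrow> complex"
    assume \<theta>: "\<theta> \<in> test_functions {0<..}" and \<psi>: "\<psi> \<in> test_functions UNIV"
    \<comment> \<open>Outside the half-space, where \<open>W\<close> and the sheared
      \<open>V\<close> may differ, the test function and its derivative vanish.\<close>
    have \<theta>0: "\<theta> (fst p) = 0" "frechet_derivative \<theta> (at (fst p)) 1 = 0" if "p \<notin> spacetime" for p :: "real \<times> 'a"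
    proof -
      obtain K where K: "compact K" "K \<subseteq> {0<..}" "\<And>t. t \<notin> K \<Longrightarrow> \<theta> t = 0" using test_functionsE[OF \<theta>] by metis
      have "fst p \<notin> K" using that K(2) by (auto simp: spacetime_def)
      then show "\<theta> (fst p) = 0" "frechet_derivative \<theta> (at (fst p)) 1 = 0"
        using K by (auto intro!: pderivative_zero_outside[of K] simp: compact_imp_closed)
    qed
    have WV': "(W p * frechet_derivative \<theta> (at (fst p)) 1 + vector_field a lam \<sigma> (W p) * \<theta> (fst p)) * \<psi> (snd p)
       = (V (shear c p) * frechet_derivative \<theta> (at (fst p)) 1 + vector_field a lam \<sigma> (V (shear c p)) * \<theta> (fst p)) * \<psi> (snd p)" for p
      using WV[of p] \<theta>0[of p] by (cases "p \<in> spacetime") auto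
    show "(LINT p|lborel. (W p * frechet_derivative \<theta> (at (fst p)) 1 + vector_field a lam \<sigma> (W p) * \<theta> (fst p)) * \<psi> (snd p)) = 0"
      unfolding WV' by (intro weak_equation_straightened[OF V eq \<theta> \<psi>])
  qed
  obtain b where b [measurable]: "b \<in> borel_measurable borel"
    and flow: "AE t in lborel. AE y in lborel. 0 < t \<longrightarrow> W (t, y) = evolve a lam \<sigma> t (b y)"
    using exists_measurable_profile[OF Wm lines] by blast
  have W_slice: "W (t, y) = V (t, - (t *\<^sub>R c) + y)" if "0 < t" for t y
    using that by (simp add: WV) (simp add: shear_def)
  have W_slice_m [measurable]: "(\<lambda>y. W (t, y)) \<in> borel_measurable borel" for t by (rule borel_measurable_slice[OF Wm])
  \<comment> \<open>One good time suffices: its slice is locally integrable, and the flow preserves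
    the modulus.\<close>
  have bli: "locally_integrable UNIV b"
  proof -
    obtain t where t: "0 < t" "locally_integrable UNIV (\<lambda>x. V (t, x))" "AE y in lborel. W (t, y) = evolve a lam \<sigma> t (b y)"
      using AE_exists_in_open[OF eventually_conj[OF slice flow], of "{0<..}"] by auto
    have "locally_integrable UNIV (\<lambda>y. W (t, y))"
      unfolding W_slice[OF t(1)] by (rule locally_integrable_translate[OF t(2)])
    then show ?thesis
      unfolding locally_integrable_def set_integrable_def
    proof (intro allI impI, elim allE impE)
      fix K :: "'a set" assume K: "compact K \<and> K \<subseteq> UNIV"
      then show "compact K \<and> K \<subseteq> UNIV" .
      assume i: "integrable lborel (\<lambda>y. indicat_real K y *\<^sub>R W (t, y))"
      have [measurable]: "K \<in> sets borel" using K by (simp add: compact_imp_closed borel_closed)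
      show "integrable lborel (\<lambda>y. indicat_real K y *\<^sub>R b y)"
      proof (rule Bochner_Integration.integrable_bound[OF i])
        show "AE y in lborel. norm (indicat_real K y *\<^sub>R b y) \<le> norm (indicat_real K y *\<^sub>R W (t, y))"
          using t(3) by eventually_elim simp
      qed measurable
    qed
  qed
  define h where "h \<phi> t = (LINT y|lborel. evolve a lam \<sigma> t (b y) * \<phi> (y - t *\<^sub>R c))" for \<phi> t
  have vh: "v t \<phi> = h \<phi> t" if \<phi>: "\<phi> \<in> test_functions UNIV" and "0 \<le> t" for \<phi> t
  proof (rule continuous_on_eq_if_AE_eq[OF vcont[OF \<phi>] _ _ \<open>0 \<le> t\<close>])
    have [measurable]: "\<phi> \<in> borel_measurable borel" using \<phi> by (rule test_functions_measurable)
    show "continuous_on {0..} (h \<phi>)"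
      unfolding h_def[abs_def] by (rule evolve_weak_continuous[OF b bli \<phi>])
    show "AE t in lborel. 0 < t \<longrightarrow> v t \<phi> = h \<phi> t"
      using slice flow
    proof eventually_elim
      case (elim t)
      show ?case
      proof
        assume "0 < t"
        have i: "integrable lborel (\<lambda>x. V (t, x) * \<phi> x)"
          using elim(1) \<open>0 < t\<close> by (intro locally_integrable_mult_test[OF _ \<phi>]) simp
        have "v t \<phi> = (LINT x|lborel. V (t, x) * \<phi> x)"
          using elim(1) \<open>0 < t\<close> \<phi> by (simp add: dist_eq_def regular_dist_def)
        also have "\<dots> = (LINT y|lborel. V (t, - (t *\<^sub>R c) + y) * \<phi> (- (t *\<^sub>R c) + y))"
          using borel_measurable_integrable[OF i] by (subst lborel_translate_integral(1)) auto
        also have "\<dots> = (LINT y|lborel. W (t, y) * \<phi> (y - t *\<^sub>R c))"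
          by (simp add: W_slice[OF \<open>0 < t\<close>])
        also have "\<dots> = h \<phi> t"
          unfolding h_def
        proof (rule integral_cong_AE)
          show "AE y in lborel. W (t, y) * \<phi> (y - t *\<^sub>R c) = evolve a lam \<sigma> t (b y) * \<phi> (y - t *\<^sub>R c)"
            using elim(2) by eventually_elim (use \<open>0 < t\<close> in simp)
        qed measurable
        finally show "v t \<phi> = h \<phi> t" .
      qed
    qed
  qed
  have "AE y in lborel. b y = u0 y"
  proof (rule AE_eq_if_equal_integrals)
    fix \<phi> :: "'a \<Rightarrow> complex" assume \<phi>: "\<phi> \<in> test_functions UNIV"
    show "integrable lborel (\<lambda>x. b x * \<phi> x)" by (rule locally_integrable_mult_test[OF bli \<phi>])
    show "integrable lborel (\<lambda>x. u0 x * \<phi> x)"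
      by (rule locally_integrable_mult_test[OF integrable_imp_locally_integrable[OF u0] \<phi>])
    show "(LINT x|lborel. b x * \<phi> x) = (LINT x|lborel. u0 x * \<phi> x)"
      using vh[OF \<phi> order_refl] v0[OF \<phi>] by (simp add: h_def regular_dist_def)
  qed
  note bu = this
  show ?thesis unfolding dist_eq_def
  proof
    fix \<phi> :: "'a \<Rightarrow> complex" assume \<phi>: "\<phi> \<in> test_functions UNIV"
    then have [measurable]: "\<phi> \<in> borel_measurable borel" by (rule test_functions_measurable)
    have "v t \<phi> = (LINT y|lborel. evolve a lam \<sigma> t (u0 y) * \<phi> (y - t *\<^sub>R c))"
      unfolding vh[OF \<phi> \<open>0 \<le> t\<close>] h_def
    proof (rule integral_cong_AE)
      show "AE y in lborel. evolve a lam \<sigma> t (b y) * \<phi> (y - t *\<^sub>R c) = evolve a lam \<sigma> t (u0 y) * \<phi> (y - t *\<^sub>R c)"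
        using bu by eventually_elim simp
    qed measurable
    also have "\<dots> = (LINT x|lborel. evolve a lam \<sigma> t (u0 (t *\<^sub>R c + x)) * \<phi> (t *\<^sub>R c + x - t *\<^sub>R c))"
      by (subst lborel_translate_integral(1)[of "\<lambda>y. evolve a lam \<sigma> t (u0 y) * \<phi> (y - t *\<^sub>R c)"]) auto
    finally show "v t \<phi> = regular_dist (\<lambda>x. evolve a lam \<sigma> t (u0 (x + t *\<^sub>R c))) \<phi>"
      by (simp add: regular_dist_def add.commute)
  qed
qed

section \<open>Sobolev energy and plateaus of small energy\<close>

definition weight :: "'a::euclidean_space \<Rightarrow> real" where
  "weight \<xi> = (1 + (norm \<xi>)\<^sup>2) powr (real DIM('a) / 2)"

text \<open>The square of the H^{d/2} norm.\<close>

definition energy :: "('a::euclidean_space \<Rightarrow> complex) \<Rightarrow> real" where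
  "energy f = (LINT \<xi>|lborel. weight \<xi> * (cmod (fourier f \<xi>))\<^sup>2)"

lemma weight_sobolev: "sobolev_weighted_sq (real DIM('a) / 2) g (\<xi>::'a::euclidean_space) = weight \<xi> * (cmod (g \<xi>))\<^sup>2"
  by (simp add: sobolev_weighted_sq_def weight_def)

lemma weight_ge_1: "1 \<le> weight \<xi>"
  unfolding weight_def by (intro ge_one_powr_ge_zero) auto

lemma weight_nonneg [simp]: "0 \<le> weight \<xi>"
  by (simp add: weight_def)

lemma weight_measurable [measurable]: "weight \<in> borel_measurable borel"
  unfolding weight_def[abs_def] by measurable

lemma powr_half_DIM:
  fixes r :: real assumes "0 < r" shows "(r\<^sup>2) powr (real n / 2) = r ^ n"
proof -
  have "(r\<^sup>2) powr (real n / 2) = (r powr 2) powr (real n / 2)" using assms by simp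
  also have "\<dots> = r powr real n" by (subst powr_powr) simp
  also have "\<dots> = r ^ n" by (rule powr_realpow[OF assms])
  finally show ?thesis .
qed

lemma weight_le: "weight (\<xi>::'a::euclidean_space) \<le> (1 + norm \<xi>) ^ DIM('a)"
proof -
  have "1 + (norm \<xi>)\<^sup>2 \<le> (1 + norm \<xi>)\<^sup>2" by (simp add: power2_sum)
  then have "weight \<xi> \<le> ((1 + norm \<xi>)\<^sup>2) powr (real DIM('a) / 2)"
    unfolding weight_def by (intro powr_mono2) auto
  also have "\<dots> = (1 + norm \<xi>) ^ DIM('a)" by (intro powr_half_DIM) (auto simp: add_pos_nonneg)
  finally show ?thesis .
qed

text \<open>For \<open>e \<le> 1\<close> the constant in the weight only helps:
  \<open>e\<^sup>2 * (1 + (norm \<xi>)\<^sup>2)\<close> is at most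
  \<open>1 + (norm (e *\<^sub>R \<xi>))\<^sup>2\<close>, and the power d/2 turns
  \<open>e\<^sup>2\<close> into the Jacobian of the dilation.\<close>

lemma weight_scale:
  assumes "0 < e" "e \<le> 1"
  shows "e ^ DIM('a) * weight (\<xi>::'a::euclidean_space) \<le> weight (e *\<^sub>R \<xi>)"
proof -
  have "e ^ DIM('a) * weight \<xi> = (e\<^sup>2 * (1 + (norm \<xi>)\<^sup>2)) powr (real DIM('a) / 2)"
    unfolding weight_def using assms by (subst powr_mult) (auto simp: powr_half_DIM)
  also have "\<dots> \<le> (1 + (norm (e *\<^sub>R \<xi>))\<^sup>2) powr (real DIM('a) / 2)"
  proof (rule powr_mono2)
    have "e\<^sup>2 \<le> 1" using assms by (simp add: power_le_one)
    then show "e\<^sup>2 * (1 + (norm \<xi>)\<^sup>2) \<le> 1 + (norm (e *\<^sub>R \<xi>))\<^sup>2"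
      using assms by (simp add: power_mult_distrib distrib_left)
  qed auto
  finally show ?thesis by (simp add: weight_def)
qed

lemma integrable_weight_fourier:
  assumes "f \<in> test_functions (UNIV :: 'a::euclidean_space set)"
  shows "integrable lborel (\<lambda>\<xi>. weight \<xi> * cmod (fourier f \<xi>))"
proof -
  have [measurable]: "f \<in> borel_measurable borel" using assms by (rule test_functions_measurable)
  \<comment> \<open>The weight costs \<open>DIM('a)\<close> powers and integrability
    \<open>2 * DIM('a)\<close>.\<close>
  obtain C where C: "\<And>\<xi>. (1 + norm \<xi>) ^ (3 * DIM('a)) * cmod (fourier f \<xi>) \<le> C"
    using fourier_decay[OF assms] by metis
  have "integrable lborel (\<lambda>\<xi>. of_real (weight \<xi>) * fourier f \<xi>)"
  proof (rule integrable_if_decay)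
    fix \<xi> :: 'a
    have "(1 + norm \<xi>) ^ (2 * DIM('a)) * cmod (of_real (weight \<xi>) * fourier f \<xi>)
      = (1 + norm \<xi>) ^ (2 * DIM('a)) * (weight \<xi> * cmod (fourier f \<xi>))"
      using weight_ge_1[of \<xi>] by (simp add: norm_mult)
    also have "\<dots> \<le> (1 + norm \<xi>) ^ (2 * DIM('a)) * ((1 + norm \<xi>) ^ DIM('a) * cmod (fourier f \<xi>))"
      by (intro mult_left_mono mult_right_mono weight_le) auto
    also have "\<dots> = (1 + norm \<xi>) ^ (3 * DIM('a)) * cmod (fourier f \<xi>)"
      by (simp add: power_add[symmetric] mult.assoc[symmetric])
    finally show "(1 + norm \<xi>) ^ (2 * DIM('a)) * cmod (of_real (weight \<xi>) * fourier f \<xi>) \<le> C"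
      using C[of \<xi>] by linarith
  qed measurable
  from integrable_norm[OF this] show ?thesis
    by (simp add: norm_mult)
qed

lemma integrable_energy_cross:
  assumes f: "f \<in> test_functions (UNIV :: 'a::euclidean_space set)" and g: "g \<in> test_functions UNIV"
  shows "integrable lborel (\<lambda>\<xi>. weight \<xi> * (cmod (fourier f \<xi>) * cmod (fourier g \<xi>)))"
proof (rule Bochner_Integration.integrable_bound)
  have [measurable]: "f \<in> borel_measurable borel" "g \<in> borel_measurable borel"
    using f g test_functions_measurable by blast+
  let ?C = "fourier_const TYPE('a) * (LINT x|lborel. cmod (g x))"
  show "integrable lborel (\<lambda>\<xi>. weight \<xi> * cmod (fourier f \<xi>) * ?C)"
    by (intro integrable_mult_left integrable_weight_fourier f)
  show "(\<lambda>\<xi>. weight \<xi> * (cmod (fourier f \<xi>) * cmod (fourier g \<xi>))) \<in> borel_measurable lborel" by measurable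
  show "AE \<xi> in lborel. norm (weight \<xi> * (cmod (fourier f \<xi>) * cmod (fourier g \<xi>))) \<le> norm (weight \<xi> * cmod (fourier f \<xi>) * ?C)"
  proof (intro AE_I2)
    fix \<xi> :: 'a
    have "weight \<xi> * cmod (fourier f \<xi>) * cmod (fourier g \<xi>) \<le> weight \<xi> * cmod (fourier f \<xi>) * ?C"
      using weight_ge_1[of \<xi>] by (intro mult_left_mono fourier_norm_le) auto
    moreover have "0 \<le> weight \<xi> * cmod (fourier f \<xi>) * cmod (fourier g \<xi>)" using weight_ge_1[of \<xi>] by auto
    ultimately show "norm (weight \<xi> * (cmod (fourier f \<xi>) * cmod (fourier g \<xi>))) \<le> norm (weight \<xi> * cmod (fourier f \<xi>) * ?C)"
      by (simp add: mult.assoc)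
  qed
qed

lemma integrable_energy:
  "f \<in> test_functions UNIV \<Longrightarrow> integrable lborel (\<lambda>\<xi>. weight \<xi> * (cmod (fourier f \<xi>))\<^sup>2)"
  using integrable_energy_cross[of f f] by (simp add: power2_eq_square)

lemma energy_nonneg: "0 \<le> energy f"
  unfolding energy_def by (intro Bochner_Integration.integral_nonneg mult_nonneg_nonneg) auto

text \<open>At the exponent d/2 scaling is neutral: the squared transform carries
  \<open>e ^ DIM('a)\<close> twice, one factor is absorbed by the weight and the other by the change
  of variables. The inhomogeneous weight leaves an inequality, valid for contractions.\<close>

lemma energy_rescale:
  fixes f :: "'a::euclidean_space \<Rightarrow> complex"
  assumes f: "f \<in> test_functions UNIV" and e: "0 < e" "e \<le> 1"
  shows "energy (\<lambda>x. f (inverse e *\<^sub>R (x - p))) \<le> energy f"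
proof -
  have [measurable]: "f \<in> borel_measurable borel" using f by (rule test_functions_measurable)
  let ?g = "\<lambda>\<eta>::'a. weight \<eta> * (cmod (fourier f \<eta>))\<^sup>2"
  have gm: "?g \<in> borel_measurable borel" by measurable
  have m: "cmod (fourier (\<lambda>x. f (inverse e *\<^sub>R (x - p))) \<xi>) = e ^ DIM('a) * cmod (fourier f (e *\<^sub>R \<xi>))" for \<xi>
    using e by (subst fourier_affine) (auto simp: norm_mult norm_power)
  have i: "integrable lborel (\<lambda>\<xi>. ?g (0 + e *\<^sub>R \<xi>))"
    using lborel_affine_integral(2)[OF _ gm, of e 0] integrable_energy[OF f] e by simp
  have "energy (\<lambda>x. f (inverse e *\<^sub>R (x - p))) \<le> (LINT \<xi>|lborel. e ^ DIM('a) * ?g (0 + e *\<^sub>R \<xi>))"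
    unfolding energy_def
  proof (rule Bochner_Integration.integral_mono')
    show "integrable lborel (\<lambda>\<xi>. e ^ DIM('a) * ?g (0 + e *\<^sub>R \<xi>))" using i by (intro integrable_mult_right)
    fix \<xi> :: 'a
    have "weight \<xi> * (cmod (fourier (\<lambda>x. f (inverse e *\<^sub>R (x - p))) \<xi>))\<^sup>2
      = (e ^ DIM('a) * weight \<xi>) * (e ^ DIM('a) * (cmod (fourier f (e *\<^sub>R \<xi>)))\<^sup>2)"
      unfolding m by (simp add: power2_eq_square)
    also have "\<dots> \<le> weight (e *\<^sub>R \<xi>) * (e ^ DIM('a) * (cmod (fourier f (e *\<^sub>R \<xi>)))\<^sup>2)"
      using e by (intro mult_right_mono weight_scale) auto
    finally show "weight \<xi> * (cmod (fourier (\<lambda>x. f (inverse e *\<^sub>R (x - p))) \<xi>))\<^sup>2 \<le> e ^ DIM('a) * ?g (0 + e *\<^sub>R \<xi>)"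
      by (simp add: mult_ac)
    show "0 \<le> e ^ DIM('a) * ?g (0 + e *\<^sub>R \<xi>)" using e weight_ge_1[of "0 + e *\<^sub>R \<xi>"] by auto
  qed
  also have "\<dots> = e ^ DIM('a) * (LINT \<xi>|lborel. ?g (0 + e *\<^sub>R \<xi>))" by simp
  also have "(LINT \<xi>|lborel. ?g (0 + e *\<^sub>R \<xi>)) = inverse (e ^ DIM('a)) * energy f"
    using lborel_affine_integral(1)[OF _ gm, of e 0] e by (simp add: energy_def)
  also have "e ^ DIM('a) * (inverse (e ^ DIM('a)) * energy f) = energy f" using e by simp
  finally show ?thesis .
qed

text \<open>The cross term is kept, since it is small between distant scales; the doubling in
  \<open>energy_add_le_double\<close> would grow exponentially when dilates are added one by
  one.\<close>

lemma energy_add_le: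
  assumes f: "f \<in> test_functions (UNIV :: 'a::euclidean_space set)" and g: "g \<in> test_functions UNIV"
  shows "energy (\<lambda>x. f x + g x) \<le> energy f + energy g + 2 * (LINT \<xi>|lborel. weight \<xi> * (cmod (fourier f \<xi>) * cmod (fourier g \<xi>)))"
proof -
  have "energy (\<lambda>x. f x + g x) \<le> (LINT \<xi>|lborel. weight \<xi> * (cmod (fourier f \<xi>))\<^sup>2 + weight \<xi> * (cmod (fourier g \<xi>))\<^sup>2
      + 2 * (weight \<xi> * (cmod (fourier f \<xi>) * cmod (fourier g \<xi>))))"
    unfolding energy_def
  proof (rule Bochner_Integration.integral_mono)
    fix \<xi> :: 'a
    have "(cmod (fourier (\<lambda>x. f x + g x) \<xi>))\<^sup>2 \<le> (cmod (fourier f \<xi>) + cmod (fourier g \<xi>))\<^sup>2"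
      using f g by (subst fourier_add) (auto intro!: power_mono norm_triangle_ineq test_functions_integrable)
    then have "weight \<xi> * (cmod (fourier (\<lambda>x. f x + g x) \<xi>))\<^sup>2 \<le> weight \<xi> * (cmod (fourier f \<xi>) + cmod (fourier g \<xi>))\<^sup>2"
      using weight_ge_1[of \<xi>] by (intro mult_left_mono) auto
    then show "weight \<xi> * (cmod (fourier (\<lambda>x. f x + g x) \<xi>))\<^sup>2 \<le> weight \<xi> * (cmod (fourier f \<xi>))\<^sup>2 + weight \<xi> * (cmod (fourier g \<xi>))\<^sup>2
      + 2 * (weight \<xi> * (cmod (fourier f \<xi>) * cmod (fourier g \<xi>)))"
      by (simp add: power2_sum algebra_simps)
  qed (use f g in \<open>auto intro!: integrable_energy integrable_energy_cross test_functions_add integrable_mult_right Bochner_Integration.integrable_add\<close>)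
  also have "\<dots> = energy f + energy g + 2 * (LINT \<xi>|lborel. weight \<xi> * (cmod (fourier f \<xi>) * cmod (fourier g \<xi>)))"
    using integrable_energy[OF f] integrable_energy[OF g] integrable_energy_cross[OF f g] by (simp add: energy_def)
  finally show ?thesis .
qed

lemma energy_add_le_double:
  assumes f: "f \<in> test_functions (UNIV :: 'a::euclidean_space set)" and g: "g \<in> test_functions UNIV"
  shows "energy (\<lambda>x. f x + g x) \<le> 2 * energy f + 2 * energy g"
proof -
  have "2 * (LINT \<xi>|lborel. weight \<xi> * (cmod (fourier f \<xi>) * cmod (fourier g \<xi>)))
     = (LINT \<xi>|lborel. 2 * (weight \<xi> * (cmod (fourier f \<xi>) * cmod (fourier g \<xi>))))" by simp
  also have "\<dots> \<le> (LINT \<xi>|lborel. weight \<xi> * (cmod (fourier f \<xi>))\<^sup>2 + weight \<xi> * (cmod (fourier g \<xi>))\<^sup>2)"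
  proof (rule Bochner_Integration.integral_mono)
    fix \<xi> :: 'a
    have "2 * (cmod (fourier f \<xi>) * cmod (fourier g \<xi>)) \<le> (cmod (fourier f \<xi>))\<^sup>2 + (cmod (fourier g \<xi>))\<^sup>2"
      using sum_squares_bound[of "cmod (fourier f \<xi>)" "cmod (fourier g \<xi>)"] by simp
    then have "weight \<xi> * (2 * (cmod (fourier f \<xi>) * cmod (fourier g \<xi>))) \<le> weight \<xi> * ((cmod (fourier f \<xi>))\<^sup>2 + (cmod (fourier g \<xi>))\<^sup>2)"
      using weight_ge_1[of \<xi>] by (intro mult_left_mono) auto
    then show "2 * (weight \<xi> * (cmod (fourier f \<xi>) * cmod (fourier g \<xi>))) \<le> weight \<xi> * (cmod (fourier f \<xi>))\<^sup>2 + weight \<xi> * (cmod (fourier g \<xi>))\<^sup>2"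
      by (simp add: algebra_simps)
  qed (use f g in \<open>auto intro!: integrable_energy integrable_energy_cross integrable_mult_right Bochner_Integration.integrable_add\<close>)
  also have "\<dots> = energy f + energy g"
    using integrable_energy[OF f] integrable_energy[OF g] by (simp add: energy_def)
  finally show ?thesis using energy_add_le[OF f g] by linarith
qed

lemma energy_cmult: "energy (\<lambda>x. c * f x) = (cmod c)\<^sup>2 * energy f"
  unfolding energy_def fourier_cmult norm_mult power_mult_distrib integral_mult_right_zero[symmetric]
  by (simp only: mult.left_commute)

section \<open>Plateaus of small energy\<close>

abbreviation cube :: "real \<Rightarrow> 'a::euclidean_space set" where
  "cube r \<equiv> cbox (- r *\<^sub>R One) (r *\<^sub>R One)"

lemma mem_cube: "x \<in> cube r \<longleftrightarrow> (\<forall>i\<in>Basis. \<bar>x \<bullet> i\<bar> \<le> r)"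
  unfolding mem_box by (auto simp: abs_le_iff)

lemma cube_scale: "0 < e \<Longrightarrow> inverse e *\<^sub>R x \<in> cube r \<longleftrightarrow> x \<in> cube (e * r)"
  unfolding mem_cube by (simp add: abs_mult field_simps)

lemma cube_mono: "r \<le> s \<Longrightarrow> x \<in> cube r \<Longrightarrow> x \<in> cube s"
  unfolding mem_cube by (meson order_trans)

lemma test_functions_rescale:
  assumes "f \<in> test_functions UNIV" "e \<noteq> 0"
  shows "(\<lambda>x. f (inverse e *\<^sub>R (x - p))) \<in> test_functions UNIV"
  using test_functions_affine[OF assms(1), of "inverse e" "- inverse e *\<^sub>R p"] assms(2)
  by (simp add: scaleR_diff_right)

lemma integral_norm_rescale:
  fixes f :: "'a::euclidean_space \<Rightarrow> complex"
  assumes f: "f \<in> test_functions UNIV" and e: "0 < e"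
  shows "(LINT x|lborel. cmod (f (inverse e *\<^sub>R (x - p)))) = e ^ DIM('a) * (LINT x|lborel. cmod (f x))"
proof -
  have [measurable]: "f \<in> borel_measurable borel" using f by (rule test_functions_measurable)
  show ?thesis
    using lborel_affine_integral(1)[of "inverse e" "\<lambda>x. cmod (f x)" "- inverse e *\<^sub>R p"] e
    by (simp add: scaleR_diff_right power_inverse)
qed

text \<open>
  The sum of \<open>n\<close> dilates of one bump at sufficiently separated scales has energy of order \<open>n\<close>,
  since the energies are invariant under dilation and the interactions are negligible,
  while it equals \<open>n\<close> near the origin.
\<close>

lemma sum_of_dilates:
  assumes "\<tau> > 0"
  shows "\<exists>\<psi> r. 0 < r \<and> r \<le> 1 \<and> (\<lambda>x::'a::euclidean_space. complex_of_real (\<psi> x)) \<in> test_functions UNIV \<and>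
    (\<forall>x\<in>cube r. \<psi> x = real n) \<and> (\<forall>x. x \<notin> cube 2 \<longrightarrow> \<psi> x = 0) \<and>
    energy (\<lambda>x. complex_of_real (\<psi> x)) \<le> real n * (energy (\<lambda>x::'a. complex_of_real (plateau x)) + 1) \<and>
    (LINT x|lborel. \<bar>\<psi> x\<bar>) \<le> real n * \<tau>"
proof (induction n)
  case 0
  have "energy (\<lambda>x::'a. 0) = 0" by (simp add: energy_def fourier_def)
  then show ?case
    by (intro exI[of _ "\<lambda>x. 0"] exI[of _ 1]) (auto intro!: test_functionsI[of _ "{}"])
next
  case (Suc n)
  let ?P = "\<lambda>x::'a. complex_of_real (plateau x)"
  note P = test_functions_plateau[where 'a='a]
  obtain \<psi> :: "'a \<Rightarrow> real" and r where r: "0 < r" "r \<le> 1"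
    and \<psi>: "(\<lambda>x. complex_of_real (\<psi> x)) \<in> test_functions UNIV"
    and v: "\<And>x. x \<in> cube r \<Longrightarrow> \<psi> x = real n" "\<And>x. x \<notin> cube 2 \<Longrightarrow> \<psi> x = 0"
    and en: "energy (\<lambda>x. complex_of_real (\<psi> x)) \<le> real n * (energy ?P + 1)"
    and L1: "(LINT x|lborel. \<bar>\<psi> x\<bar>) \<le> real n * \<tau>"
    using Suc by blast
  define I where "I = (LINT \<xi>|lborel. weight \<xi> * cmod (fourier (\<lambda>x. complex_of_real (\<psi> x)) \<xi>))"
  define L where "L = (LINT x|lborel. cmod (?P x))"
  define C where "C = fourier_const TYPE('a) * L"
  have nonneg: "0 \<le> I" "0 \<le> L" "0 \<le> C"
    unfolding I_def L_def C_def using fourier_const_pos[where 'a='a] by auto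
  \<comment> \<open>The three bounds make \<open>e\<close> at most 1, limit the L^1 norm of the new
    dilate to \<tau>, and keep twice its interaction with the previous sum at most 1, the surplus
    per step in the energy bound.\<close>
  define e where "e = min 1 (min (\<tau> / (L + 1)) (1 / (2 * (C * I + 1))))"
  have e: "0 < e" "e \<le> 1" "e * L \<le> \<tau>" "2 * (e * C * I) \<le> 1"
  proof -
    show "0 < e" "e \<le> 1" unfolding e_def using nonneg assms by (auto simp: add_nonneg_pos)
    have "e * L \<le> \<tau> / (L + 1) * L" unfolding e_def using nonneg by (intro mult_right_mono) auto
    also have "\<dots> \<le> \<tau>" using nonneg assms by (simp add: field_simps)
    finally show "e * L \<le> \<tau>" .
    have "2 * (e * (C * I)) \<le> 2 * (1 / (2 * (C * I + 1)) * (C * I))"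
      unfolding e_def using nonneg by (intro mult_left_mono mult_right_mono) auto
    also have "\<dots> = (C * I) / (C * I + 1)"
    proof -
      have "2 * (1 / (2 * y) * x) = x / y" for x y :: real by simp
      then show ?thesis .
    qed
    also have "\<dots> \<le> 1"
    proof -
      have "0 < C * I + 1" using nonneg by (simp add: add_nonneg_pos)
      then show ?thesis by (simp add: divide_le_eq)
    qed
    finally show "2 * (e * C * I) \<le> 1" by (simp add: mult.assoc)
  qed
  have ed: "e ^ DIM('a) \<le> e" using e power_decreasing[of 1 "DIM('a)" e] by (simp add: Suc_leI)
  define \<phi> where "\<phi> x = plateau (inverse e *\<^sub>R x)" for x :: 'a
  have \<phi>: "(\<lambda>x. complex_of_real (\<phi> x)) \<in> test_functions UNIV"
    using test_functions_rescale[OF P, of e 0] e by (simp add: \<phi>_def)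
  \<comment> \<open>Contraction makes the transform of the new dilate uniformly small, while
    \<open>I\<close> is a fixed number determined by the earlier dilates.\<close>
  have F\<phi>: "cmod (fourier (\<lambda>x. complex_of_real (\<phi> x)) \<xi>) \<le> e * C" for \<xi>
  proof -
    have "cmod (fourier (\<lambda>x. complex_of_real (\<phi> x)) \<xi>) = e ^ DIM('a) * cmod (fourier ?P (e *\<^sub>R \<xi>))"
      using fourier_affine[OF test_functions_measurable[OF P], of e 0 \<xi>] e by (simp add: \<phi>_def norm_mult norm_power)
    also have "\<dots> \<le> e * C"
      unfolding C_def L_def using ed e by (intro mult_mono fourier_norm_le) auto
    finally show ?thesis .
  qed
  define \<psi>' where "\<psi>' x = \<psi> x + \<phi> x" for x
  have \<psi>'eq: "(\<lambda>x. complex_of_real (\<psi>' x)) = (\<lambda>x. complex_of_real (\<psi> x) + complex_of_real (\<phi> x))"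
    by (simp add: \<psi>'_def)
  show ?case
  proof (intro exI[of _ \<psi>'] exI[of _ "min r e"] conjI ballI allI impI)
    show "0 < min r e" "min r e \<le> 1" using r e by auto
    show "(\<lambda>x. complex_of_real (\<psi>' x)) \<in> test_functions UNIV"
      unfolding \<psi>'eq by (rule test_functions_add[OF \<psi> \<phi>])
    show "\<psi>' x = real (Suc n)" if "x \<in> cube (min r e)" for x
    proof -
      have "x \<in> cube r" "x \<in> cube (e * 1)" using that cube_mono[of "min r e" _ x] by auto
      then have "\<psi> x = real n" "inverse e *\<^sub>R x \<in> cube 1" using v(1) cube_scale[OF e(1), of x 1] by auto
      then show ?thesis using plateau_eq_1[of "inverse e *\<^sub>R x"] by (simp add: \<psi>'_def \<phi>_def)
    qed
    show "\<psi>' x = 0" if "x \<notin> cube 2" for x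
    proof -
      have "x \<notin> cube (e * 2)" using that cube_mono[of "e * 2" 2 x] e by auto
      then have "plateau (inverse e *\<^sub>R x) = 0"
        using cube_scale[OF e(1), of x 2] by (intro plateau_eq_0) auto
      then show ?thesis using v(2)[OF that] by (simp add: \<psi>'_def \<phi>_def)
    qed
    have "energy (\<lambda>x. complex_of_real (\<psi>' x)) \<le> energy (\<lambda>x. complex_of_real (\<psi> x)) + energy (\<lambda>x. complex_of_real (\<phi> x))
       + 2 * (LINT \<xi>|lborel. weight \<xi> * (cmod (fourier (\<lambda>x. complex_of_real (\<psi> x)) \<xi>) * cmod (fourier (\<lambda>x. complex_of_real (\<phi> x)) \<xi>)))"
      unfolding \<psi>'eq by (rule energy_add_le[OF \<psi> \<phi>])
    also have "energy (\<lambda>x. complex_of_real (\<phi> x)) \<le> energy ?P"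
      using energy_rescale[OF P e(1,2), of 0] by (simp add: \<phi>_def)
    also have "(LINT \<xi>|lborel. weight \<xi> * (cmod (fourier (\<lambda>x. complex_of_real (\<psi> x)) \<xi>) * cmod (fourier (\<lambda>x. complex_of_real (\<phi> x)) \<xi>)))
      \<le> (LINT \<xi>|lborel. (weight \<xi> * cmod (fourier (\<lambda>x. complex_of_real (\<psi> x)) \<xi>)) * (e * C))"
    proof (rule Bochner_Integration.integral_mono)
      fix \<xi> :: 'a
      show "weight \<xi> * (cmod (fourier (\<lambda>x. complex_of_real (\<psi> x)) \<xi>) * cmod (fourier (\<lambda>x. complex_of_real (\<phi> x)) \<xi>))
        \<le> (weight \<xi> * cmod (fourier (\<lambda>x. complex_of_real (\<psi> x)) \<xi>)) * (e * C)"
        unfolding mult.assoc[symmetric, of "weight \<xi>"] using weight_ge_1[of \<xi>] by (intro mult_left_mono F\<phi>) auto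
    qed (intro integrable_energy_cross integrable_mult_left integrable_weight_fourier \<psi> \<phi>)+
    also have "\<dots> = e * C * I" by (simp add: I_def)
    finally show "energy (\<lambda>x. complex_of_real (\<psi>' x)) \<le> real (Suc n) * (energy ?P + 1)"
      using en e(4) by (simp add: algebra_simps)
    have i: "integrable lborel (\<lambda>x. \<bar>\<psi> x\<bar>)" "integrable lborel (\<lambda>x. \<bar>\<phi> x\<bar>)"
      using integrable_norm[OF test_functions_integrable[OF \<psi>]] integrable_norm[OF test_functions_integrable[OF \<phi>]] by simp_all
    have "(LINT x|lborel. \<bar>\<psi>' x\<bar>) \<le> (LINT x|lborel. \<bar>\<psi> x\<bar> + \<bar>\<phi> x\<bar>)"
      using i by (intro Bochner_Integration.integral_mono') (auto simp: \<psi>'_def)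
    also have "\<dots> = (LINT x|lborel. \<bar>\<psi> x\<bar>) + (LINT x|lborel. \<bar>\<phi> x\<bar>)" using i by simp
    also have "(LINT x|lborel. \<bar>\<phi> x\<bar>) = e ^ DIM('a) * L"
      using integral_norm_rescale[OF P e(1), of 0] by (simp add: \<phi>_def L_def)
    also have "\<dots> \<le> e * L" using ed nonneg by (intro mult_right_mono) auto
    finally show "(LINT x|lborel. \<bar>\<psi>' x\<bar>) \<le> real (Suc n) * \<tau>" using L1 e(3) by (simp add: algebra_simps)
  qed
qed

text \<open>Division by \<open>n\<close> lowers the height of the sum of dilates to 1 and its energy
  from order \<open>n\<close> to order \<open>1 / n\<close>.\<close>

lemma small_energy_plateau:
  assumes "\<eta> > 0"
  obtains \<psi> r where "0 < r" "r \<le> 1" "(\<lambda>x::'a::euclidean_space. complex_of_real (\<psi> x)) \<in> test_functions UNIV"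
    "\<And>x. x \<in> cube r \<Longrightarrow> \<psi> x = 1" "\<And>x. x \<notin> cube 2 \<Longrightarrow> \<psi> x = 0"
    "energy (\<lambda>x. complex_of_real (\<psi> x)) \<le> \<eta>" "(LINT x|lborel. \<bar>\<psi> x\<bar>) \<le> \<eta>"
proof -
  let ?K = "energy (\<lambda>x::'a. complex_of_real (plateau x)) + 1"
  have K: "?K > 0" using energy_nonneg[of "\<lambda>x::'a. complex_of_real (plateau x)"] by simp
  obtain n :: nat where n: "?K / \<eta> < real n" using reals_Archimedean2 by blast
  then have n0: "0 < real n" using K assms by (meson divide_pos_pos less_trans)
  obtain \<psi> :: "'a \<Rightarrow> real" and r where r: "0 < r" "r \<le> 1"
    and \<psi>: "(\<lambda>x. complex_of_real (\<psi> x)) \<in> test_functions UNIV"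
    and v: "\<And>x. x \<in> cube r \<Longrightarrow> \<psi> x = real n" "\<And>x. x \<notin> cube 2 \<Longrightarrow> \<psi> x = 0"
    and en: "energy (\<lambda>x. complex_of_real (\<psi> x)) \<le> real n * ?K"
    and L1: "(LINT x|lborel. \<bar>\<psi> x\<bar>) \<le> real n * \<eta>"
    using sum_of_dilates[OF assms, of n] by blast
  have eq: "(\<lambda>x. complex_of_real (\<psi> x / real n)) = (\<lambda>x. complex_of_real (inverse (real n)) * complex_of_real (\<psi> x))"
    by (simp add: field_simps)
  show ?thesis
  proof (rule that[of r "\<lambda>x. \<psi> x / real n"])
    show "(\<lambda>x. complex_of_real (\<psi> x / real n)) \<in> test_functions UNIV"
      unfolding eq by (rule test_functions_mult[OF \<psi> smooth_const])
    have "energy (\<lambda>x. complex_of_real (\<psi> x / real n)) = (inverse (real n))\<^sup>2 * energy (\<lambda>x. complex_of_real (\<psi> x))"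
      unfolding eq energy_cmult norm_of_real using n0 by simp
    also have "\<dots> \<le> (inverse (real n))\<^sup>2 * (real n * ?K)" by (intro mult_left_mono en) auto
    also have "\<dots> = ?K / real n" using n0 by (simp add: power2_eq_square field_simps)
    also have "\<dots> \<le> \<eta>" using n n0 assms by (simp add: field_simps)
    finally show "energy (\<lambda>x. complex_of_real (\<psi> x / real n)) \<le> \<eta>" .
    have "(LINT x|lborel. \<bar>\<psi> x / real n\<bar>) = (LINT x|lborel. \<bar>\<psi> x\<bar>) / real n" by (simp add: abs_divide)
    also have "\<dots> \<le> \<eta>" using L1 n0 by (simp add: field_simps)
    finally show "(LINT x|lborel. \<bar>\<psi> x / real n\<bar>) \<le> \<eta>" .
  qed (use r v n0 in auto)
qed

text \<open>
  The perturbation is negligible in the energy since its amplitude tends to \<open>0\<close> as \<open>M\<close> grows; the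
  scale \<open>r\<close> is dictated by the plateau, but does not matter, by invariance under dilation.
\<close>

lemma perturbed_plateau:
  fixes \<beta> :: "'a::euclidean_space \<Rightarrow> real"
  assumes \<beta>: "(\<lambda>x. complex_of_real (\<beta> x)) \<in> test_functions UNIV" "\<And>x. x \<notin> cube 1 \<Longrightarrow> \<beta> x = 0"
    and "s > 0" "\<kappa> > 0"
  obtains M r f where "M \<ge> (real k + 1)\<^sup>2" "0 < r" "r \<le> 1"
    "(\<lambda>x. complex_of_real (f x)) \<in> test_functions UNIV" "\<And>x. x \<notin> cube 2 \<Longrightarrow> f x = 0"
    "\<And>y. y \<in> cube 1 \<Longrightarrow> f (r *\<^sub>R y) = M + (real k + 1) * M powr (- s) * \<beta> y"
    "energy (\<lambda>x. complex_of_real (f x)) \<le> \<kappa>" "(LINT x|lborel. \<bar>f x\<bar>) \<le> \<kappa>"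
proof -
  define E where "E = energy (\<lambda>x. complex_of_real (\<beta> x))"
  define L where "L = (LINT x|lborel. \<bar>\<beta> x\<bar>)"
  have nonneg: "0 \<le> E" "0 \<le> L" unfolding E_def L_def by (auto intro: energy_nonneg)
  have T: "((\<lambda>M. (real k + 1) * M powr (- s)) \<longlongrightarrow> (real k + 1) * 0) at_top"
    by (intro tendsto_intros tendsto_neg_powr filterlim_ident) (use \<open>s > 0\<close> in auto)
  have "((\<lambda>M. 2 * ((real k + 1) * M powr (- s))\<^sup>2 * E) \<longlongrightarrow> 2 * ((real k + 1) * 0)\<^sup>2 * E) at_top"
    "((\<lambda>M. (real k + 1) * M powr (- s) * L) \<longlongrightarrow> (real k + 1) * 0 * L) at_top"
    by (rule tendsto_mult[OF tendsto_mult[OF tendsto_const tendsto_power[OF T]] tendsto_const])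
       (rule tendsto_mult[OF T tendsto_const])
  then have "eventually (\<lambda>M. 2 * ((real k + 1) * M powr (- s))\<^sup>2 * E < \<kappa> / 2) at_top"
     "eventually (\<lambda>M. (real k + 1) * M powr (- s) * L < \<kappa> / 2) at_top"
    using \<open>\<kappa> > 0\<close> by (auto dest!: order_tendstoD(2)[where a = "\<kappa> / 2"])
  then have "eventually (\<lambda>M. 2 * ((real k + 1) * M powr (- s))\<^sup>2 * E < \<kappa> / 2 \<and> (real k + 1) * M powr (- s) * L < \<kappa> / 2 \<and> (real k + 1)\<^sup>2 \<le> M) at_top"
    by (intro eventually_conj eventually_ge_at_top)
  then obtain M where M: "2 * ((real k + 1) * M powr (- s))\<^sup>2 * E < \<kappa> / 2" "(real k + 1) * M powr (- s) * L < \<kappa> / 2" "(real k + 1)\<^sup>2 \<le> M"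
    using eventually_happens[of _ at_top] by force
  have M1: "M \<ge> 1" using M(3) by (simp add: power2_sum) (smt (verit) of_nat_0_le_iff zero_le_power2)
  define a where "a = (real k + 1) * M powr (- s)"
  have "a > 0" using M1 by (simp add: a_def)
  \<comment> \<open>Multiplication of the plateau by \<open>M\<close> costs \<open>M\<^sup>2\<close>
    in the energy, and adding the perturbation costs a factor 2; this tolerance leaves the plateau
    half of \<kappa>.\<close>
  have "\<kappa> / (4 * M\<^sup>2) > 0" using \<open>\<kappa> > 0\<close> M1 by simp
  then obtain \<psi> r where r: "0 < r" "r \<le> 1" and \<psi>: "(\<lambda>x::'a. complex_of_real (\<psi> x)) \<in> test_functions UNIV"
    and v: "\<And>x. x \<in> cube r \<Longrightarrow> \<psi> x = 1" "\<And>x. x \<notin> cube 2 \<Longrightarrow> \<psi> x = 0"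
    and en: "energy (\<lambda>x. complex_of_real (\<psi> x)) \<le> \<kappa> / (4 * M\<^sup>2)" and L1: "(LINT x|lborel. \<bar>\<psi> x\<bar>) \<le> \<kappa> / (4 * M\<^sup>2)"
    using small_energy_plateau by metis
  define \<phi> where "\<phi> x = \<beta> (inverse r *\<^sub>R x)" for x
  have \<phi>: "(\<lambda>x. complex_of_real (\<phi> x)) \<in> test_functions UNIV"
    using test_functions_rescale[OF \<beta>(1), of r 0] r by (simp add: \<phi>_def)
  define f where "f x = M * \<psi> x + a * \<phi> x" for x
  have feq: "(\<lambda>x. complex_of_real (f x)) = (\<lambda>x. of_real M * complex_of_real (\<psi> x) + of_real a * complex_of_real (\<phi> x))"
    by (simp add: f_def)
  note t1 = test_functions_mult[OF \<psi> smooth_const, of "of_real M"]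
  note t2 = test_functions_mult[OF \<phi> smooth_const, of "of_real a"]
  show ?thesis
  proof (rule that[of M r f])
    show "(\<lambda>x. complex_of_real (f x)) \<in> test_functions UNIV" unfolding feq by (rule test_functions_add[OF t1 t2])
    show "f x = 0" if "x \<notin> cube 2" for x
    proof -
      have "x \<notin> cube (r * 1)" using that cube_mono[of "r * 1" 2 x] r by auto
      then have "inverse r *\<^sub>R x \<notin> cube 1" using cube_scale[OF r(1), of x 1] by simp
      then have "\<phi> x = 0" unfolding \<phi>_def by (rule \<beta>(2))
      then show ?thesis using v(2)[OF that] by (simp add: f_def)
    qed
    show "f (r *\<^sub>R y) = M + (real k + 1) * M powr (- s) * \<beta> y" if "y \<in> cube 1" for y
    proof -
      have "r *\<^sub>R y \<in> cube r" using cube_scale[OF r(1), of "r *\<^sub>R y" 1] that r by simp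
      then show ?thesis using v(1) r by (simp add: f_def \<phi>_def a_def)
    qed
    have "energy (\<lambda>x. complex_of_real (f x)) \<le> 2 * (M\<^sup>2 * energy (\<lambda>x. complex_of_real (\<psi> x))) + 2 * (a\<^sup>2 * energy (\<lambda>x. complex_of_real (\<phi> x)))"
      unfolding feq using energy_add_le_double[OF t1 t2] by (simp add: energy_cmult)
    also have "\<dots> \<le> 2 * (M\<^sup>2 * (\<kappa> / (4 * M\<^sup>2))) + 2 * (a\<^sup>2 * E)"
    proof (intro add_mono mult_left_mono en)
      show "energy (\<lambda>x. complex_of_real (\<phi> x)) \<le> E"
        using energy_rescale[OF \<beta>(1) r, of 0] by (simp add: \<phi>_def E_def)
    qed auto
    also have "\<dots> = \<kappa> / 2 + 2 * a\<^sup>2 * E" using M1 by simp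
    also have "\<dots> \<le> \<kappa>" using M(1) by (simp add: a_def)
    finally show "energy (\<lambda>x. complex_of_real (f x)) \<le> \<kappa>" .
    have i: "integrable lborel (\<lambda>x. \<bar>\<psi> x\<bar>)" "integrable lborel (\<lambda>x. \<bar>\<phi> x\<bar>)"
      using integrable_norm[OF test_functions_integrable[OF \<psi>]] integrable_norm[OF test_functions_integrable[OF \<phi>]] by simp_all
    have "(LINT x|lborel. \<bar>f x\<bar>) \<le> (LINT x|lborel. M * \<bar>\<psi> x\<bar> + a * \<bar>\<phi> x\<bar>)"
    proof (intro Bochner_Integration.integral_mono')
      fix x
      have "\<bar>f x\<bar> \<le> \<bar>M * \<psi> x\<bar> + \<bar>a * \<phi> x\<bar>" unfolding f_def by (rule abs_triangle_ineq)
      then show "\<bar>f x\<bar> \<le> M * \<bar>\<psi> x\<bar> + a * \<bar>\<phi> x\<bar>" using M1 \<open>a > 0\<close> by (simp add: abs_mult)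
    qed (use i M1 \<open>a > 0\<close> in auto)
    also have "\<dots> = M * (LINT x|lborel. \<bar>\<psi> x\<bar>) + a * (LINT x|lborel. \<bar>\<phi> x\<bar>)" using i by simp
    also have "(LINT x|lborel. \<bar>\<phi> x\<bar>) = r ^ DIM('a) * L"
      using integral_norm_rescale[OF \<beta>(1) r(1), of 0] by (simp add: \<phi>_def L_def)
    also have "M * (LINT x|lborel. \<bar>\<psi> x\<bar>) + a * (r ^ DIM('a) * L) \<le> M * (\<kappa> / (4 * M\<^sup>2)) + a * (1 * L)"
      using r nonneg M1 \<open>a > 0\<close> L1 by (intro add_mono mult_left_mono mult_right_mono power_le_one) auto
    also have "M * (\<kappa> / (4 * M\<^sup>2)) = \<kappa> / (4 * M)" using M1 by (simp add: power2_eq_square)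
    also have "\<kappa> / (4 * M) \<le> \<kappa> / 2" using M1 \<open>\<kappa> > 0\<close> by (intro divide_left_mono) auto
    finally show "(LINT x|lborel. \<bar>f x\<bar>) \<le> \<kappa>" using M(2) by (simp add: a_def)
  qed (use M r in auto)
qed

section \<open>The initial datum\<close>

text \<open>\<open>f\<close> is constant on lines parallel to \<open>v\<close>, and every such line
  leaves the support.\<close>

lemma test_function_zero_if_directional_derivative_zero:
  fixes f :: "'a::euclidean_space \<Rightarrow> complex"
  assumes f: "f \<in> test_functions UNIV" and "v \<noteq> 0" and zero: "\<And>x. frechet_derivative f (at x) v = 0"
  shows "f x = 0"
proof -
  obtain K where K: "compact K" "\<And>x. x \<notin> K \<Longrightarrow> f x = 0" using test_functionsE[OF f] by metis
  obtain R where R: "\<And>x. x \<in> K \<Longrightarrow> norm x \<le> R" using compact_imp_bounded[OF K(1)] unfolding bounded_iff by blast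
  have "((\<lambda>s. f (x + s *\<^sub>R v)) has_derivative (\<lambda>h. 0)) (at s within UNIV)" for s :: real
    using smooth_along_line[OF test_functions_smooth[OF f], of x v s] zero
    by (simp add: has_vector_derivative_def)
  then obtain c where c: "\<And>s. f (x + s *\<^sub>R v) = c"
    using has_derivative_zero_constant[of UNIV "\<lambda>s::real. f (x + s *\<^sub>R v)"] by auto
  \<comment> \<open>This multiple of \<open>v\<close> is long enough to carry \<open>x\<close> out
    of a ball containing the support.\<close>
  define s where "s = (\<bar>R\<bar> + norm x + 1) / norm v"
  have "norm (s *\<^sub>R v) = \<bar>R\<bar> + norm x + 1" using \<open>v \<noteq> 0\<close> by (simp add: s_def)
  then have "norm (x + s *\<^sub>R v) > R" using norm_diff_ineq[of "s *\<^sub>R v" x] by (simp add: add.commute)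
  then have "x + s *\<^sub>R v \<notin> K" using R by force
  then have "c = 0" using K(2) c by metis
  then show ?thesis using c[of 0] by simp
qed

lemma Im_pderivative_zero:
  assumes "smooth f" "\<And>x. Im (f x) = 0" shows "Im (frechet_derivative f (at x) v) = 0"
proof -
  have "((\<lambda>x. Im (f x)) has_derivative (\<lambda>h. Im (frechet_derivative f (at x) h))) (at x)"
    by (rule bounded_linear.has_derivative[OF bounded_linear_Im smooth_has_derivative[OF assms(1)]])
  moreover have "((\<lambda>x. Im (f x)) has_derivative (\<lambda>h. 0)) (at x)" by (simp add: assms(2))
  ultimately have "(\<lambda>h. Im (frechet_derivative f (at x) h)) = (\<lambda>h. 0)" by (rule has_derivative_unique)
  then show ?thesis by metis
qed

text \<open>Non-triviality survives each derivative, because a test function constant along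
  \<open>v\<close> vanishes; each derivative contributes one zero of the transform at the
  origin.\<close>

lemma iterated_derivative_bump:
  fixes v :: "'a::euclidean_space"
  assumes \<zeta>: "\<zeta> \<in> test_functions UNIV" "\<And>x. Im (\<zeta> x) = 0" "\<And>x. x \<notin> cube 1 \<Longrightarrow> \<zeta> x = 0" "\<exists>x. \<zeta> x \<noteq> 0"
    and "v \<noteq> 0"
  shows "partials (replicate n v) \<zeta> \<in> test_functions UNIV \<and> (\<forall>x. Im (partials (replicate n v) \<zeta> x) = 0) \<and>
    (\<forall>x. x \<notin> cube 1 \<longrightarrow> partials (replicate n v) \<zeta> x = 0) \<and> (\<exists>x. partials (replicate n v) \<zeta> x \<noteq> 0) \<and>
    (\<forall>\<xi>. cmod (fourier (partials (replicate n v) \<zeta>) \<xi>) = \<bar>v \<bullet> \<xi>\<bar> ^ n * cmod (fourier \<zeta> \<xi>))"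
proof (induction n)
  case 0
  then show ?case using \<zeta> by auto
next
  case (Suc n)
  define f where "f = partials (replicate n v) \<zeta>"
  have f: "f \<in> test_functions UNIV" "\<And>x. Im (f x) = 0" "\<And>x. x \<notin> cube 1 \<Longrightarrow> f x = 0" "\<exists>x. f x \<noteq> 0"
    "\<And>\<xi>. cmod (fourier f \<xi>) = \<bar>v \<bullet> \<xi>\<bar> ^ n * cmod (fourier \<zeta> \<xi>)"
    using Suc unfolding f_def by auto
  have S: "partials (replicate (Suc n) v) \<zeta> = pderivative f v" by (simp add: f_def)
  have "\<exists>x. frechet_derivative f (at x) v \<noteq> 0"
    using test_function_zero_if_directional_derivative_zero[OF f(1) \<open>v \<noteq> 0\<close>] f(4) by blast
  moreover have "frechet_derivative f (at x) v = 0" if "x \<notin> cube 1" for x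
    using f(3) that by (intro pderivative_zero_outside[of "cube 1"]) auto
  moreover have "cmod (fourier (pderivative f v) \<xi>) = \<bar>v \<bullet> \<xi>\<bar> ^ Suc n * cmod (fourier \<zeta> \<xi>)" for \<xi>
    unfolding fourier_pderivative[OF f(1)] by (simp add: norm_mult f(5))
  ultimately show ?case
    unfolding S using test_functions_pderivative[OF f(1)] Im_pderivative_zero[OF test_functions_smooth[OF f(1)] f(2)]
    by simp
qed

text \<open>
  The vanishing moments of the \<open>d\<close>-fold derivative make its homogeneous \<open>H\<^bsup>-d/2\<^esup>\<close> norm finite,
  uniformly under dilation.
\<close>

lemma exists_detection_bump:
  obtains \<beta> :: "'a::euclidean_space \<Rightarrow> real" and \<zeta> where
    "(\<lambda>x. complex_of_real (\<beta> x)) \<in> test_functions UNIV" "\<And>x. x \<notin> cube 1 \<Longrightarrow> \<beta> x = 0"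
    "(LINT x|lborel. \<beta> x) = 0" "0 < (LINT x|lborel. (\<beta> x)\<^sup>2)" "\<zeta> \<in> test_functions UNIV"
    "\<And>\<xi>. cmod (fourier (\<lambda>x. complex_of_real (\<beta> x)) \<xi>) \<le> norm \<xi> ^ DIM('a) * cmod (fourier \<zeta> \<xi>)"
proof -
  define \<zeta> where "\<zeta> x = complex_of_real (box_bump 1 (- One) One x)" for x :: 'a
  have \<zeta>: "\<zeta> \<in> test_functions UNIV"
    unfolding \<zeta>_def[abs_def] by (rule test_functions_box_bump) simp
  obtain v :: 'a where v: "v \<in> Basis" using nonempty_Basis by blast
  define f where "f = partials (replicate (DIM('a)) v) \<zeta>"
  have "v \<noteq> 0" using v by auto
  have z: "\<zeta> x = 0" if "x \<notin> cube 1" for x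
    using that box_subset_cbox[of "- One :: 'a" One] by (auto simp: \<zeta>_def intro!: box_bump_zero)
  have "\<zeta> 0 \<noteq> 0" using box_bump_pos[of 0 "- One :: 'a" One 1] by (auto simp: \<zeta>_def mem_box)
  then have ex: "\<exists>x. \<zeta> x \<noteq> 0" by blast
  have Im0: "Im (\<zeta> x) = 0" for x by (simp add: \<zeta>_def)
  have f: "f \<in> test_functions UNIV" "\<And>x. Im (f x) = 0" "\<And>x. x \<notin> cube 1 \<Longrightarrow> f x = 0" "\<exists>x. f x \<noteq> 0"
    "\<And>\<xi>. cmod (fourier f \<xi>) = \<bar>v \<bullet> \<xi>\<bar> ^ DIM('a) * cmod (fourier \<zeta> \<xi>)"
    using iterated_derivative_bump[OF \<zeta> Im0 z ex \<open>v \<noteq> 0\<close>, of "DIM('a)"] unfolding f_def by blast+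
  define \<beta> where "\<beta> x = Re (f x)" for x
  have \<beta>: "(\<lambda>x. complex_of_real (\<beta> x)) = f"
    using f(2) by (auto simp: \<beta>_def complex_eq_iff)
  have \<beta>c: "continuous_on UNIV \<beta>"
    unfolding \<beta>_def[abs_def] by (intro continuous_intros smooth_continuous test_functions_smooth[OF f(1)])
  show ?thesis
  proof (rule that[of \<beta> \<zeta>])
    show "(\<lambda>x. complex_of_real (\<beta> x)) \<in> test_functions UNIV" using f(1) by (simp add: \<beta>)
    show "\<beta> x = 0" if "x \<notin> cube 1" for x using f(3)[OF that] by (simp add: \<beta>_def)
    \<comment> \<open>The dimension is positive, so at least one derivative is taken and the mean is
      zero.\<close>
    obtain n where n: "DIM('a) = Suc n" using DIM_positive[where 'a='a] by (cases "DIM('a)") auto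
    have "(LINT x|lborel. f x) = 0"
      using test_functions_integral_pderivative[OF partials_test_functions[OF \<zeta>, of "replicate n v"], of v]
      by (simp add: f_def n)
    then have "complex_of_real (LINT x|lborel. \<beta> x) = 0"
      unfolding integral_complex_of_real[symmetric] \<beta> .
    then show "(LINT x|lborel. \<beta> x) = 0" by simp
    have "integrable lborel (\<lambda>x. f x * f x)"
      by (rule test_functions_integrable[OF test_functions_mult[OF f(1) test_functions_smooth[OF f(1)]]])
    then have i: "integrable lborel (\<lambda>x. (\<beta> x)\<^sup>2)"
      using integrable_Re[of lborel "\<lambda>x. f x * f x"] f(2) by (simp add: \<beta>_def power2_eq_square)
    have "(LINT x|lborel. (\<beta> x)\<^sup>2) \<noteq> 0"
    proof
      assume "(LINT x|lborel. (\<beta> x)\<^sup>2) = 0"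
      then have "AE x in lborel. (\<beta> x)\<^sup>2 = 0" using integral_nonneg_eq_0_iff_AE[OF i] by simp
      moreover have "open {x. \<beta> x \<noteq> 0}" using \<beta>c by (intro open_Collect_neq continuous_intros)
      moreover have "{x. \<beta> x \<noteq> 0} \<noteq> {}" using f(4) \<beta> by (metis (mono_tags, lifting) empty_iff mem_Collect_eq of_real_0)
      ultimately show False using AE_exists_in_open[of "\<lambda>x. (\<beta> x)\<^sup>2 = 0"] by auto
    qed
    moreover have "0 \<le> (LINT x|lborel. (\<beta> x)\<^sup>2)" by simp
    ultimately show "0 < (LINT x|lborel. (\<beta> x)\<^sup>2)" by linarith
    show "cmod (fourier (\<lambda>x. complex_of_real (\<beta> x)) \<xi>) \<le> norm \<xi> ^ DIM('a) * cmod (fourier \<zeta> \<xi>)" for \<xi>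
      unfolding \<beta> f(5) using Basis_le_norm[OF v, of \<xi>]
      by (intro mult_right_mono power_mono) (auto simp: inner_commute)
  qed (use \<zeta> in auto)
qed

section \<open>Summing the pieces in the Sobolev space\<close>

lemma sobolev_regular_dist:
  fixes u :: "'a::euclidean_space \<Rightarrow> complex"
  assumes u: "integrable lborel u" and en: "integrable lborel (\<lambda>\<xi>. weight \<xi> * (cmod (fourier u \<xi>))\<^sup>2)"
  shows "regular_dist u \<in> sobolev_space (real DIM('a) / 2)"
    and "sobolev_norm (real DIM('a) / 2) (regular_dist u) = sqrt (energy u)"
proof -
  have [measurable]: "u \<in> borel_measurable borel" using borel_measurable_integrable[OF u] by simp
  have Fu: "integrable lborel (\<lambda>\<xi>. fourier u \<xi> * \<phi> \<xi>)" if "\<phi> \<in> schwartz_functions" for \<phi>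
    using integrable_mult_bounded[OF schwartz_integrable[OF that] fourier_measurable fourier_norm_le, of u]
    by (simp add: mult.commute)
  have F: "fourier_is_function (regular_dist u) (fourier u)"
    unfolding fourier_is_function_def dist_fourier_def regular_dist_def
    using Fu fourier_duality[OF u schwartz_integrable] by auto
  then show "regular_dist u \<in> sobolev_space (real DIM('a) / 2)"
    unfolding sobolev_space_def using tempered_regular_dist[OF u] en
      ext[of "sobolev_weighted_sq (real DIM('a) / 2) (fourier u)", OF weight_sobolev] by auto
  \<comment> \<open>\<open>sobolev_norm\<close> chooses some representative of the Fourier
    transform; all of them agree almost everywhere.\<close>
  define g where "g = (SOME g. fourier_is_function (regular_dist u) g)"
  have g: "fourier_is_function (regular_dist u) g" unfolding g_def using F by (rule someI[of "fourier_is_function (regular_dist u)"])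
  have [measurable]: "g \<in> borel_measurable borel" using g by (simp add: fourier_is_function_def)
  have "AE \<xi> in lborel. g \<xi> = fourier u \<xi>"
    using g F by (intro AE_eq_if_equal_integrals)
      (auto simp: fourier_is_function_def regular_dist_def dest!: test_functions_schwartz)
  then have "(LINT \<xi>|lborel. weight \<xi> * (cmod (g \<xi>))\<^sup>2) = energy u"
    unfolding energy_def by (intro integral_cong_AE) auto
  then show "sobolev_norm (real DIM('a) / 2) (regular_dist u) = sqrt (energy u)"
    unfolding sobolev_norm_def g_def[symmetric] weight_sobolev by simp
qed

text \<open>Iterates |z + w|^2 <= 2 |z|^2 + 2 |w|^2. The weights do not depend on \<open>n\<close>,
  unlike the factor from Cauchy-Schwarz, and geometrically decaying energies compensate
  them.\<close>

lemma norm_sum_sq_le: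
  fixes z :: "nat \<Rightarrow> complex"
  shows "(cmod (\<Sum>k<n. z k))\<^sup>2 \<le> (\<Sum>k<n. 2 ^ Suc k * (cmod (z k))\<^sup>2)"
proof (induction n arbitrary: z)
  case (Suc n)
  have "(cmod (\<Sum>k<Suc n. z k))\<^sup>2 = (cmod (z 0 + (\<Sum>k<n. z (Suc k))))\<^sup>2"
    by (simp only: sum.lessThan_Suc_shift)
  also have "\<dots> \<le> (cmod (z 0) + cmod (\<Sum>k<n. z (Suc k)))\<^sup>2"
    by (intro power_mono norm_triangle_ineq) auto
  also have "\<dots> \<le> 2 * (cmod (z 0))\<^sup>2 + 2 * (cmod (\<Sum>k<n. z (Suc k)))\<^sup>2"
    using sum_squares_bound[of "cmod (z 0)" "cmod (\<Sum>k<n. z (Suc k))"] by (simp add: power2_sum)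
  also have "\<dots> \<le> 2 * (cmod (z 0))\<^sup>2 + 2 * (\<Sum>k<n. 2 ^ Suc k * (cmod (z (Suc k)))\<^sup>2)"
    using Suc.IH[of "\<lambda>k. z (Suc k)"] by simp
  also have "\<dots> = (\<Sum>k<Suc n. 2 ^ Suc k * (cmod (z k))\<^sup>2)"
    by (simp only: sum.lessThan_Suc_shift) (simp add: sum_distrib_left mult.assoc)
  finally show ?case .
qed simp

text \<open>The bounds \<open>\<delta>\<^sup>2 * (1 / 4) ^ Suc k\<close> against the weights
  \<open>2 ^ Suc k\<close> of \<open>norm_sum_sq_le\<close> sum to at most
  \<open>\<delta>\<^sup>2\<close>, uniformly in the number of terms; Fatou's lemma passes to the
  limit.\<close>

lemma energy_series:
  fixes w :: "nat \<Rightarrow> 'a::euclidean_space \<Rightarrow> complex"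
  assumes w: "\<And>k. w k \<in> test_functions UNIV"
    and en: "\<And>k. energy (w k) \<le> \<delta>\<^sup>2 * (1 / 4) ^ Suc k"
    and lim: "\<And>\<xi>. (\<lambda>n. \<Sum>k<n. fourier (w k) \<xi>) \<longlonglongrightarrow> fourier u \<xi>"
    and [measurable]: "u \<in> borel_measurable borel"
  shows "integrable lborel (\<lambda>\<xi>. weight \<xi> * (cmod (fourier u \<xi>))\<^sup>2)" "energy u \<le> \<delta>\<^sup>2"
proof -
  have [measurable]: "w k \<in> borel_measurable borel" for k using w by (rule test_functions_measurable)
  let ?I = "\<lambda>n \<xi>. ennreal (weight \<xi> * (cmod (\<Sum>k<n. fourier (w k) \<xi>))\<^sup>2)"
  have bound: "(\<integral>\<^sup>+\<xi>. ?I n \<xi> \<partial>lborel) \<le> ennreal (\<delta>\<^sup>2)" for n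
  proof -
    let ?J = "\<lambda>\<xi>. \<Sum>k<n. 2 ^ Suc k * (weight \<xi> * (cmod (fourier (w k) \<xi>))\<^sup>2)"
    have J: "integrable lborel ?J" by (intro Bochner_Integration.integrable_sum integrable_mult_right integrable_energy w)
    have "(\<integral>\<^sup>+\<xi>. ?I n \<xi> \<partial>lborel) \<le> (\<integral>\<^sup>+\<xi>. ennreal (?J \<xi>) \<partial>lborel)"
    proof (intro nn_integral_mono ennreal_leI)
      fix \<xi> :: 'a
      have "weight \<xi> * (cmod (\<Sum>k<n. fourier (w k) \<xi>))\<^sup>2 \<le> weight \<xi> * (\<Sum>k<n. 2 ^ Suc k * (cmod (fourier (w k) \<xi>))\<^sup>2)"
        by (intro mult_left_mono norm_sum_sq_le) simp
      also have "\<dots> = ?J \<xi>" by (simp only: sum_distrib_left mult.left_commute)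
      finally show "weight \<xi> * (cmod (\<Sum>k<n. fourier (w k) \<xi>))\<^sup>2 \<le> ?J \<xi>" .
    qed
    also have "\<dots> = ennreal (LINT \<xi>|lborel. ?J \<xi>)"
      by (intro nn_integral_eq_integral J AE_I2 sum_nonneg mult_nonneg_nonneg) auto
    also have "(LINT \<xi>|lborel. ?J \<xi>) = (\<Sum>k<n. 2 ^ Suc k * energy (w k))"
      unfolding energy_def by (subst Bochner_Integration.integral_sum) (auto intro!: integrable_mult_right integrable_energy w)
    also have "\<dots> \<le> (\<Sum>k<n. 2 ^ Suc k * (\<delta>\<^sup>2 * (1 / 4) ^ Suc k))"
      by (intro sum_mono mult_left_mono en) auto
    also have "\<dots> = \<delta>\<^sup>2 / 2 * (\<Sum>k<n. (1 / 2) ^ k)"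
      unfolding sum_distrib_left
      by (intro sum.cong refl) (simp add: power_divide field_simps flip: power_mult_distrib)
    also have "(\<Sum>k<n. (1 / 2 :: real) ^ k) \<le> 2"
      using sum_gp_strict[of "1/2::real" n] by simp
    finally show ?thesis by (simp add: ennreal_leI mult_left_mono)
  qed
  have fatou: "(\<integral>\<^sup>+\<xi>. ennreal (weight \<xi> * (cmod (fourier u \<xi>))\<^sup>2) \<partial>lborel) \<le> ennreal (\<delta>\<^sup>2)"
  proof -
    have "(\<lambda>n. ?I n \<xi>) \<longlonglongrightarrow> ennreal (weight \<xi> * (cmod (fourier u \<xi>))\<^sup>2)" for \<xi>
      by (intro tendsto_ennrealI tendsto_mult tendsto_const tendsto_power tendsto_norm lim)
    then have "ennreal (weight \<xi> * (cmod (fourier u \<xi>))\<^sup>2) = liminf (\<lambda>n. ?I n \<xi>)" for \<xi>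
      by (intro lim_imp_Liminf[symmetric]) auto
    then have "(\<integral>\<^sup>+\<xi>. ennreal (weight \<xi> * (cmod (fourier u \<xi>))\<^sup>2) \<partial>lborel) = (\<integral>\<^sup>+\<xi>. liminf (\<lambda>n. ?I n \<xi>) \<partial>lborel)"
      by simp
    also have "\<dots> \<le> liminf (\<lambda>n. (\<integral>\<^sup>+\<xi>. ?I n \<xi> \<partial>lborel))" by (intro nn_integral_liminf) measurable
    also have "\<dots> \<le> liminf (\<lambda>n::nat. ennreal (\<delta>\<^sup>2))" by (intro Liminf_mono always_eventually allI bound)
    also have "\<dots> = ennreal (\<delta>\<^sup>2)" by (simp add: Liminf_const)
    finally show ?thesis .
  qed
  show i: "integrable lborel (\<lambda>\<xi>. weight \<xi> * (cmod (fourier u \<xi>))\<^sup>2)"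
    using fatou by (intro integrableI_bounded) (auto simp: le_less_trans[OF fatou])
  have "ennreal (energy u) \<le> ennreal (\<delta>\<^sup>2)"
    unfolding energy_def using fatou by (subst nn_integral_eq_integral[OF i, symmetric]) auto
  then show "energy u \<le> \<delta>\<^sup>2" by simp
qed

lemma exists_initial_datum:
  fixes \<beta> :: "'a::euclidean_space \<Rightarrow> real"
  assumes \<beta>: "(\<lambda>x. complex_of_real (\<beta> x)) \<in> test_functions UNIV" "\<And>x. x \<notin> cube 1 \<Longrightarrow> \<beta> x = 0"
    and "s > 0" "\<delta> > 0"
  obtains u X M r where "integrable lborel u" "\<And>R. \<exists>B. \<forall>x. norm x \<le> R \<longrightarrow> cmod (u x) \<le> B"
    "integrable lborel (\<lambda>\<xi>. weight \<xi> * (cmod (fourier u \<xi>))\<^sup>2)" "energy u \<le> \<delta>\<^sup>2"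
    "\<And>k. M k \<ge> (real k + 1)\<^sup>2" "\<And>k. 0 < r k" "\<And>k. r k \<le> 1"
    "\<And>k y. y \<in> cube 1 \<Longrightarrow> u (X k + r k *\<^sub>R y) = complex_of_real (M k + (real k + 1) * M k powr (- s) * \<beta> y)"
proof -
  \<comment> \<open>The first bound controls the energy of the sum, the second makes the series
    converge in L^1.\<close>
  define \<kappa> where "\<kappa> k = min (\<delta>\<^sup>2 * (1 / 4) ^ Suc k) ((1 / 2) ^ k)" for k :: nat
  have \<kappa>: "\<kappa> k > 0" for k using \<open>\<delta> > 0\<close> by (simp add: \<kappa>_def)
  have "\<forall>k::nat. \<exists>M r f. M \<ge> (real k + 1)\<^sup>2 \<and> 0 < r \<and> r \<le> 1 \<and>
    (\<lambda>x. complex_of_real (f x)) \<in> test_functions UNIV \<and> (\<forall>x. x \<notin> cube 2 \<longrightarrow> f x = 0) \<and>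
    (\<forall>y\<in>cube 1. f (r *\<^sub>R y) = M + (real k + 1) * M powr (- s) * \<beta> y) \<and>
    energy (\<lambda>x. complex_of_real (f x)) \<le> \<kappa> k \<and> (LINT x|lborel. \<bar>f x\<bar>) \<le> \<kappa> k"
  proof
    fix k :: nat
    show "\<exists>M r f. M \<ge> (real k + 1)\<^sup>2 \<and> 0 < r \<and> r \<le> 1 \<and>
      (\<lambda>x. complex_of_real (f x)) \<in> test_functions UNIV \<and> (\<forall>x. x \<notin> cube 2 \<longrightarrow> f x = 0) \<and>
      (\<forall>y\<in>cube 1. f (r *\<^sub>R y) = M + (real k + 1) * M powr (- s) * \<beta> y) \<and>
      energy (\<lambda>x. complex_of_real (f x)) \<le> \<kappa> k \<and> (LINT x|lborel. \<bar>f x\<bar>) \<le> \<kappa> k"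
      by (rule perturbed_plateau[OF \<beta> \<open>s > 0\<close> \<kappa>, of k k]) blast+
  qed
  then obtain M r f where MR: "\<And>k. M k \<ge> (real k + 1)\<^sup>2" "\<And>k. 0 < r k" "\<And>k. r k \<le> 1"
    and f: "\<And>k. (\<lambda>x. complex_of_real (f k x)) \<in> test_functions UNIV" "\<And>k x. x \<notin> cube 2 \<Longrightarrow> f k x = 0"
      "\<And>k y. y \<in> cube 1 \<Longrightarrow> f k (r k *\<^sub>R y) = M k + (real k + 1) * M k powr (- s) * \<beta> y"
      "\<And>k. energy (\<lambda>x. complex_of_real (f k x)) \<le> \<kappa> k" "\<And>k. (LINT x|lborel. \<bar>f k x\<bar>) \<le> \<kappa> k"
    by metis
  obtain b :: 'a where b: "b \<in> Basis" using nonempty_Basis by blast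
  \<comment> \<open>The pieces live in slabs of half-width 2, so centres at distance 5 keep them
    disjoint.\<close>
  define X where "X k = (5 * real k) *\<^sub>R b" for k :: nat
  define w where "w k x = complex_of_real (f k (x - X k))" for k x
  have weq: "w k = (\<lambda>x. complex_of_real (f k (inverse 1 *\<^sub>R (x - X k))))" for k by (simp add: w_def[abs_def])
  have w: "w k \<in> test_functions UNIV" for k unfolding weq by (rule test_functions_rescale[OF f(1)]) simp
  have wen: "energy (w k) \<le> \<delta>\<^sup>2 * (1 / 4) ^ Suc k" for k
    unfolding weq using order_trans[OF energy_rescale[OF f(1), of 1 k "X k"] f(4)[of k]] by (simp add: \<kappa>_def)
  have wL1: "(LINT x|lborel. cmod (w k x)) \<le> (1 / 2) ^ k" for k
    using integral_norm_rescale[OF f(1), of 1 k "X k"] f(5)[of k] unfolding weq by (simp add: \<kappa>_def)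
  have [measurable]: "w k \<in> borel_measurable borel" for k using w by (rule test_functions_measurable)
  have w0: "w k x = 0" if "\<bar>x \<bullet> b - 5 * real k\<bar> > 2" for k x
  proof -
    have "(x - X k) \<bullet> b = x \<bullet> b - 5 * real k" using b by (simp add: X_def inner_diff_left)
    then have "x - X k \<notin> cube 2" using that b unfolding mem_cube by (metis not_less)
    then show ?thesis using f(2) by (simp add: w_def)
  qed
  define u where "u x = (\<Sum>k. w k x)" for x
  \<comment> \<open>Only finitely many pieces meet a given ball; hence the datum is locally bounded
    although the heights are not bounded.\<close>
  have finite_sum: "\<exists>N. \<forall>x. norm x \<le> R \<longrightarrow> (\<forall>k\<ge>N. w k x = 0)" for R
  proof -
    obtain N :: nat where N: "R + 2 < real N" using reals_Archimedean2 by blast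
    have "w k x = 0" if "norm x \<le> R" "k \<ge> N" for k x
    proof (rule w0)
      have "x \<bullet> b \<le> R" using Basis_le_norm[OF b, of x] that by simp
      moreover have "real N \<le> real k" using that by simp
      ultimately show "2 < \<bar>x \<bullet> b - 5 * real k\<bar>" using N by linarith
    qed
    then show ?thesis by blast
  qed
  have summ: "summable (\<lambda>k. norm (w k x))" for x
  proof -
    obtain N where "\<And>k. k \<ge> N \<Longrightarrow> w k x = 0" using finite_sum[of "norm x"] by blast
    then show ?thesis by (intro summable_finite[of "{..<N}"]) (auto simp: not_less)
  qed
  have sumL1: "summable (\<lambda>k. LINT x|lborel. norm (w k x))"
    by (rule summable_comparison_test[of _ "\<lambda>k. (1 / 2) ^ k"]) (use wL1 in \<open>auto intro!: summable_geometric exI[of _ 0]\<close>)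
  have u: "integrable lborel u"
    unfolding u_def[abs_def] by (rule integrable_suminf[OF test_functions_integrable[OF w]]) (use summ sumL1 in auto)
  have um [measurable]: "u \<in> borel_measurable borel" using borel_measurable_integrable[OF u] by simp
  \<comment> \<open>Convergence in L^1 gives pointwise convergence of the transforms, the form in
    which \<open>energy_series\<close> needs it.\<close>
  have lim: "(\<lambda>n. \<Sum>k<n. fourier (w k) \<xi>) \<longlonglongrightarrow> fourier u \<xi>" for \<xi>
  proof -
    let ?e = "\<lambda>x. exp (- \<i> * complex_of_real (x \<bullet> \<xi>))"
    have "(\<lambda>k. LINT x|lborel. ?e x * w k x) sums (LINT x|lborel. (\<Sum>k. ?e x * w k x))"
      by (rule sums_integral[OF integrable_exp_mult[OF test_functions_integrable[OF w]]]) (use summ sumL1 in \<open>auto simp: norm_mult\<close>)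
    also have "(\<lambda>x. \<Sum>k. ?e x * w k x) = (\<lambda>x. ?e x * u x)"
      unfolding u_def by (intro ext suminf_mult summable_norm_cancel[OF summ])
    finally show ?thesis
      unfolding fourier_eq sum_distrib_left[symmetric] by (intro tendsto_mult tendsto_const) (simp add: sums_def)
  qed
  show ?thesis
  proof (rule that[of u M r X])
    show "\<exists>B. \<forall>x. norm x \<le> R \<longrightarrow> cmod (u x) \<le> B" for R
    proof -
      obtain N where N: "\<And>x k. norm x \<le> R \<Longrightarrow> k \<ge> N \<Longrightarrow> w k x = 0" using finite_sum[of R] by blast
      have "\<forall>k. \<exists>C. \<forall>x. cmod (w k x) \<le> C" using test_functions_bounded'[OF w] by blast
      then obtain C where C: "\<And>k x. cmod (w k x) \<le> C k" by metis
      have "cmod (u x) \<le> (\<Sum>k<N. C k)" if "norm x \<le> R" for x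
      proof -
        have "u x = (\<Sum>k<N. w k x)"
          unfolding u_def using N[OF that] by (intro suminf_finite) (auto simp: not_less)
        then show ?thesis using C by (auto intro!: order_trans[OF norm_sum] sum_mono)
      qed
      then show ?thesis by blast
    qed
    show "u (X k + r k *\<^sub>R y) = complex_of_real (M k + (real k + 1) * M k powr (- s) * \<beta> y)" if "y \<in> cube 1" for k y
    proof -
      have zero: "w j (X k + r k *\<^sub>R y) = 0" if "j \<noteq> k" for j
      proof (rule w0)
        have "\<bar>y \<bullet> b\<bar> \<le> 1" using \<open>y \<in> cube 1\<close>[unfolded mem_cube] b by blast
        then have "\<bar>r k * (y \<bullet> b)\<bar> \<le> 1 * 1"
          unfolding abs_mult using MR(2,3)[of k] by (intro mult_mono) auto
        moreover have "(X k + r k *\<^sub>R y) \<bullet> b = 5 * real k + r k * (y \<bullet> b)"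
          using b by (simp add: X_def inner_add_left)
        moreover have "\<bar>real k - real j\<bar> \<ge> 1" using that by linarith
        ultimately show "2 < \<bar>(X k + r k *\<^sub>R y) \<bullet> b - 5 * real j\<bar>" by linarith
      qed
      have "u (X k + r k *\<^sub>R y) = (\<Sum>j\<in>{k}. w j (X k + r k *\<^sub>R y))"
        unfolding u_def using zero by (intro suminf_finite) auto
      then show ?thesis using f(3)[OF that, of k] by (simp add: w_def)
    qed
  qed (use u MR energy_series[OF w wen lim um] in auto)
qed

section \<open>Loss of regularity\<close>

lemma powr_second_order:
  fixes s :: real
  obtains C where "0 \<le> C" "\<And>v. \<bar>v\<bar> \<le> 1/2 \<Longrightarrow> \<bar>(1 + v) powr s - 1 - s * v\<bar> \<le> C * v\<^sup>2"
proof -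
  define diff where "diff m u = (if m = 0 then u powr s else if m = 1 then s * u powr (s - 1) else s * (s - 1) * u powr (s - 2))" for m :: nat and u :: real
  \<comment> \<open>The power with exponent \<open>s - 2\<close> increases or decreases between 1/2
    and 3/2 according to the sign of the exponent; the sum of its endpoint values covers both
    cases.\<close>
  define C where "C = \<bar>s * (s - 1)\<bar> * ((1/2) powr (s - 2) + (3/2) powr (s - 2))"
  have C: "0 \<le> C" by (simp add: C_def)
  show ?thesis
  proof (rule that[OF C])
    fix v :: real assume v: "\<bar>v\<bar> \<le> 1/2"
    show "\<bar>(1 + v) powr s - 1 - s * v\<bar> \<le> C * v\<^sup>2"
    proof (cases "v = 0")
      case False
      have "\<exists>t. (if 1 + v < 1 then 1 + v < t \<and> t < 1 else 1 < t \<and> t < 1 + v) \<and>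
        (1 + v) powr s = (\<Sum>m<2. diff m 1 / fact m * (1 + v - 1) ^ m) + diff 2 t / fact 2 * (1 + v - 1) ^ 2"
      proof (rule Taylor[where a = "1/2" and b = "3/2"])
        show "diff 0 = (\<lambda>u. u powr s)" by (rule ext) (simp add: diff_def)
        show "\<forall>m t. m < 2 \<and> 1/2 \<le> t \<and> t \<le> 3/2 \<longrightarrow> (diff m has_real_derivative diff (Suc m) t) (at t)"
        proof (intro allI impI, elim conjE)
          fix m :: nat and t :: real assume "m < 2" "1/2 \<le> t"
          then consider "m = 0" | "m = 1" by linarith
          then show "(diff m has_real_derivative diff (Suc m) t) (at t)"
          proof cases
            case 1
            show ?thesis unfolding 1 diff_def
              using \<open>1/2 \<le> t\<close> by (auto intro!: derivative_eq_intros)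
          next
            case 2
            show ?thesis unfolding 2 diff_def
              using \<open>1/2 \<le> t\<close> by (auto intro!: derivative_eq_intros simp: diff_diff_eq)
          qed
        qed
      qed (use v False in \<open>auto simp: abs_le_iff\<close>)
      then obtain t where t: "if 1 + v < 1 then 1 + v < t \<and> t < 1 else 1 < t \<and> t < 1 + v"
        and eq: "(1 + v) powr s = (\<Sum>m<2. diff m 1 / fact m * (1 + v - 1) ^ m) + diff 2 t / fact 2 * (1 + v - 1) ^ 2" by blast
      have t': "1/2 \<le> t" "t \<le> 3/2" using t v by (auto simp: abs_le_iff split: if_splits)
      have "t powr (s - 2) \<le> (1/2) powr (s - 2) + (3/2) powr (s - 2)"
      proof (cases "s - 2 \<ge> 0")
        case True
        then have "t powr (s - 2) \<le> (3/2) powr (s - 2)" using t' by (intro powr_mono2) auto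
        then show ?thesis by (simp add: add_increasing)
      next
        case False
        then have "t powr (s - 2) \<le> (1/2) powr (s - 2)" using t' by (intro powr_mono2') auto
        then show ?thesis by (simp add: add_increasing2)
      qed
      then have "\<bar>diff 2 t\<bar> \<le> C"
        unfolding diff_def C_def by (simp add: abs_mult mult_left_mono)
      have rem: "(1 + v) powr s - 1 - s * v = diff 2 t / 2 * v\<^sup>2"
        using eq by (simp add: numeral_2_eq_2 diff_def)
      have "\<bar>(1 + v) powr s - 1 - s * v\<bar> = \<bar>diff 2 t\<bar> / 2 * v\<^sup>2" unfolding rem by (simp add: abs_mult)
      also have "\<dots> \<le> C * v\<^sup>2" using \<open>\<bar>diff 2 t\<bar> \<le> C\<close> C by (intro mult_right_mono) auto
      finally show ?thesis .
    qed simp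
  qed
qed

text \<open>
  On a plateau of height \<open>m\<close>, a perturbation of size \<open>n m\<^bsup>-2\<sigma>\<^esup>\<close> produces a phase difference that,
  multiplied by \<open>m\<close>, has size \<open>n\<close>.
\<close>

lemma evolve_expansion:
  fixes m n b N C A lam \<sigma> t :: real
  defines "s \<equiv> 2 * \<sigma>" and "\<mu> \<equiv> lam * t"
  assumes "\<sigma> > 0" and C: "0 \<le> C" "\<And>v. \<bar>v\<bar> \<le> 1/2 \<Longrightarrow> \<bar>(1 + v) powr s - 1 - s * v\<bar> \<le> C * v\<^sup>2"
    and b: "\<bar>b\<bar> \<le> N" and n: "1 \<le> n" "2 * N \<le> n" and m: "n\<^sup>2 \<le> m"
  shows "cmod (exp (- \<i> * of_real ((A - lam * m powr s) * t)) * evolve A lam \<sigma> t (of_real (m + n * m powr (- s) * b))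
      - of_real m + \<i> * of_real (\<mu> * s * n * b))
    \<le> n * (\<bar>\<mu>\<bar> * C * N\<^sup>2 / n + \<mu>\<^sup>2 * (s * N + C * N\<^sup>2)\<^sup>2 / n + N * n powr (- s))"
proof -
  have s: "s > 0" using \<open>\<sigma> > 0\<close> by (simp add: s_def)
  have N: "0 \<le> N" using b by linarith
  have "n \<le> n\<^sup>2" using n mult_left_mono[of 1 n n] by (simp add: power2_eq_square)
  then have mn: "n \<le> m" "1 \<le> m" using n m by linarith+
  \<comment> \<open>The perturbation relative to the plateau, so that the value is
    \<open>m * (1 + \<tau> * b)\<close>. By \<open>n\<^sup>2 \<le> m\<close> it is at most
    \<open>1 / n\<close>, and \<open>2 * N \<le> n\<close> then keeps \<open>v\<close> in the range
    of the Taylor bound.\<close>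
  define \<tau> where "\<tau> = n * m powr (- s) / m"
  have \<tau>0: "0 < \<tau>" using mn n by (simp add: \<tau>_def)
  have ms: "m powr (- s) \<le> 1" using mn s by (simp add: powr_minus inverse_le_1_iff ge_one_powr_ge_zero)
  have "n * m powr (- s) / m \<le> n * 1 / n\<^sup>2"
    using n mn ms m by (intro frac_le mult_left_mono) (auto simp: power2_eq_square)
  then have \<tau>: "\<tau> \<le> 1 / n" using n by (simp add: \<tau>_def power2_eq_square)
  define v where "v = \<tau> * b"
  have "\<bar>v\<bar> \<le> 1 / n * N" unfolding v_def abs_mult using \<tau>0 \<tau> b N n by (intro mult_mono) auto
  also have "\<dots> \<le> 1/2" using n by (simp add: field_simps)
  finally have v: "\<bar>v\<bar> \<le> 1/2" .
  define z where "z = m + n * m powr (- s) * b"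
  have z: "z = m * (1 + v)" using mn by (simp add: z_def v_def \<tau>_def field_simps)
  have zpos: "0 < z" unfolding z using v mn by (intro mult_pos_pos) (auto simp: abs_le_iff)
  define \<theta> where "\<theta> = z powr s - m powr s"
  \<comment> \<open>A difference quotient approximating \<open>s * b\<close>. Since
    \<open>m powr s * \<tau> = n / m\<close>, the phase difference satisfies
    \<open>m * \<theta> = n * q\<close> exactly.\<close>
  define q where "q = ((1 + v) powr s - 1) / \<tau>"
  have m\<tau>: "m powr s * \<tau> = n / m" using mn by (simp add: \<tau>_def powr_minus field_simps)
  have "\<theta> = m powr s * ((1 + v) powr s - 1)"
    unfolding \<theta>_def z using mn v by (subst powr_mult) (auto simp: algebra_simps abs_le_iff)
  also have "\<dots> = (m powr s * \<tau>) * q" using \<tau>0 by (simp add: q_def)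
  finally have \<theta>: "m * \<theta> = n * q" unfolding m\<tau> using mn by simp
  have "q - s * b = ((1 + v) powr s - 1 - s * v) / \<tau>" using \<tau>0 by (simp add: q_def v_def diff_divide_distrib)
  then have "\<bar>q - s * b\<bar> \<le> C * v\<^sup>2 / \<tau>" using C(2)[OF v] \<tau>0 by (simp add: abs_divide divide_right_mono)
  also have "\<dots> = C * b\<^sup>2 * \<tau>" using \<tau>0 by (simp add: v_def power2_eq_square)
  also have "\<dots> \<le> C * N\<^sup>2 * (1 / n)"
    using \<tau> \<tau>0 b C(1) by (intro mult_mono mult_left_mono) (auto simp: abs_le_square_iff[symmetric] N)
  finally have q1: "\<bar>q - s * b\<bar> \<le> C * N\<^sup>2 / n" by simp
  have "C * N\<^sup>2 / n \<le> C * N\<^sup>2 / 1" using n C(1) by (intro divide_left_mono) auto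
  then have "C * N\<^sup>2 / n \<le> C * N\<^sup>2" by simp
  moreover have "\<bar>s * b\<bar> \<le> s * N" using b s by (simp add: abs_mult mult_left_mono)
  ultimately have q2: "\<bar>q\<bar> \<le> s * N + C * N\<^sup>2" using q1 by linarith
  have ev: "exp (- \<i> * of_real ((A - lam * m powr s) * t)) * evolve A lam \<sigma> t (of_real z) = of_real z * exp (\<i> * of_real (- \<mu> * \<theta>))"
  proof -
    have "evolve A lam \<sigma> t (of_real z) = of_real z * exp (\<i> * of_real ((A - lam * z powr s) * t))"
      using zpos by (simp add: evolve_def s_def)
    moreover have "exp (- \<i> * complex_of_real ((A - lam * m powr s) * t)) * exp (\<i> * of_real ((A - lam * z powr s) * t)) = exp (\<i> * of_real (- \<mu> * \<theta>))"
      unfolding mult_exp_exp by (rule arg_cong[where f = exp]) (simp add: \<mu>_def \<theta>_def algebra_simps)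
    ultimately show ?thesis by (metis mult.left_commute)
  qed
  \<comment> \<open>The three errors are the quadratic remainder of the exponential, the
    perturbation itself, and the deviation of \<open>q\<close> from \<open>s * b\<close>.\<close>
  have "of_real z * exp (\<i> * of_real (- \<mu> * \<theta>)) - of_real m + \<i> * of_real (\<mu> * s * n * b)
     = of_real m * (exp (\<i> * of_real (- \<mu> * \<theta>)) - 1 - \<i> * of_real (- \<mu> * \<theta>))
       + of_real (z - m) * exp (\<i> * of_real (- \<mu> * \<theta>)) - \<i> * of_real (\<mu> * (m * \<theta> - s * n * b))"
    by (simp add: algebra_simps)
  also have "cmod \<dots> \<le> cmod (of_real m * (exp (\<i> * of_real (- \<mu> * \<theta>)) - 1 - \<i> * of_real (- \<mu> * \<theta>)))
     + cmod (of_real (z - m) * exp (\<i> * of_real (- \<mu> * \<theta>))) + cmod (\<i> * of_real (\<mu> * (m * \<theta> - s * n * b)))"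
    by (intro order_trans[OF norm_triangle_ineq4] add_right_mono norm_triangle_ineq)
  also have "\<dots> \<le> \<mu>\<^sup>2 * (s * N + C * N\<^sup>2)\<^sup>2 + n * (N * n powr (- s)) + \<bar>\<mu>\<bar> * C * N\<^sup>2"
  proof (intro add_mono)
    have "cmod (of_real m * (exp (\<i> * of_real (- \<mu> * \<theta>)) - 1 - \<i> * of_real (- \<mu> * \<theta>)))
      = \<bar>m\<bar> * cmod (exp (\<i> * of_real (- \<mu> * \<theta>)) - 1 - \<i> * of_real (- \<mu> * \<theta>))"
      by (simp only: norm_mult norm_of_real)
    also have "\<dots> \<le> \<bar>m\<bar> * (- \<mu> * \<theta>)\<^sup>2" by (intro mult_left_mono exp_i_second_order) auto
    also have "\<dots> = m * (- \<mu> * \<theta>)\<^sup>2" using mn by simp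
    also have "\<dots> = \<mu>\<^sup>2 * (m * \<theta>)\<^sup>2 / m" using mn by (simp add: power2_eq_square)
    also have "\<dots> = \<mu>\<^sup>2 * q\<^sup>2 * (n\<^sup>2 / m)" unfolding \<theta> by (simp add: power_mult_distrib)
    also have "\<dots> \<le> \<mu>\<^sup>2 * (s * N + C * N\<^sup>2)\<^sup>2 * 1"
    proof (intro mult_mono mult_left_mono)
      show "q\<^sup>2 \<le> (s * N + C * N\<^sup>2)\<^sup>2" using power_mono[OF q2, of 2] by simp
      show "n\<^sup>2 / m \<le> 1" using m mn by simp
    qed (use mn in auto)
    finally show "cmod (of_real m * (exp (\<i> * of_real (- \<mu> * \<theta>)) - 1 - \<i> * of_real (- \<mu> * \<theta>))) \<le> \<mu>\<^sup>2 * (s * N + C * N\<^sup>2)\<^sup>2" by simp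
    have "m powr (- s) \<le> n powr (- s)" using mn n s by (intro powr_mono2') auto
    have "cmod (of_real (z - m) * exp (\<i> * of_real (- \<mu> * \<theta>))) = \<bar>z - m\<bar>"
      unfolding norm_mult norm_exp_i norm_of_real by simp
    also have "\<dots> = n * (\<bar>b\<bar> * m powr (- s))"
      using n by (simp add: z_def abs_mult)
    also have "\<dots> \<le> n * (N * n powr (- s))"
      using n b N \<open>m powr (- s) \<le> n powr (- s)\<close> by (intro mult_left_mono mult_mono) auto
    finally show "cmod (of_real (z - m) * exp (\<i> * of_real (- \<mu> * \<theta>))) \<le> n * (N * n powr (- s))" .
    have "cmod (\<i> * of_real (\<mu> * (m * \<theta> - s * n * b))) = \<bar>\<mu>\<bar> * (n * \<bar>q - s * b\<bar>)"
    proof -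
      have "m * \<theta> - s * n * b = n * (q - s * b)" unfolding \<theta> by (simp add: algebra_simps)
      then show ?thesis using n by (simp add: norm_mult abs_mult del: of_real_mult of_real_diff)
    qed
    also have "\<dots> \<le> \<bar>\<mu>\<bar> * (n * (C * N\<^sup>2 / n))" using q1 n by (intro mult_left_mono) auto
    finally show "cmod (\<i> * of_real (\<mu> * (m * \<theta> - s * n * b))) \<le> \<bar>\<mu>\<bar> * C * N\<^sup>2" using n by simp
  qed
  also have "\<dots> = n * (\<bar>\<mu>\<bar> * C * N\<^sup>2 / n + \<mu>\<^sup>2 * (s * N + C * N\<^sup>2)\<^sup>2 / n + N * n powr (- s))"
    using n by (simp add: distrib_left)
  finally show ?thesis unfolding ev[unfolded z_def] z_def .
qed

text \<open>The mean of \<beta> is zero, so the height \<open>M k\<close> contributes nothing, while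
  the linear term of the phase contributes the integral of the square of \<beta> times a factor that
  grows like \<open>real k + 1\<close>. The errors in \<open>evolve_expansion\<close> are of smaller
  order.\<close>

lemma pairing_unbounded:
  fixes \<beta> :: "'a::euclidean_space \<Rightarrow> real" and M :: "nat \<Rightarrow> real"
  assumes \<beta>: "(\<lambda>x. complex_of_real (\<beta> x)) \<in> test_functions UNIV" "(LINT x|lborel. \<beta> x) = 0" "0 < (LINT x|lborel. (\<beta> x)\<^sup>2)"
    and M: "\<And>k. (real k + 1)\<^sup>2 \<le> M k" and "\<sigma> > 0" "lam \<noteq> 0" "t > 0"
  shows "\<exists>k. G < cmod (LINT y|lborel. evolve A lam \<sigma> t (of_real (M k + (real k + 1) * M k powr (- (2 * \<sigma>)) * \<beta> y)) * of_real (\<beta> y))"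
proof -
  define s where "s = 2 * \<sigma>"
  define \<mu> where "\<mu> = lam * t"
  have "\<mu> \<noteq> 0" "s > 0" using assms by (auto simp: \<mu>_def s_def)
  obtain C where C: "0 \<le> C" "\<And>v. \<bar>v\<bar> \<le> 1/2 \<Longrightarrow> \<bar>(1 + v) powr s - 1 - s * v\<bar> \<le> C * v\<^sup>2"
    using powr_second_order[of s] by blast
  obtain N where N: "N > 0" "\<And>y. \<bar>\<beta> y\<bar> \<le> N" using test_functions_bounded[OF \<beta>(1)] by auto
  define J where "J = (LINT x|lborel. (\<beta> x)\<^sup>2)"
  define L where "L = (LINT x|lborel. \<bar>\<beta> x\<bar>)"
  \<comment> \<open>The error bound of \<open>evolve_expansion\<close> relative to \<open>n\<close>;
    it tends to 0.\<close>
  define \<epsilon> where "\<epsilon> n = \<bar>\<mu>\<bar> * C * N\<^sup>2 / n + \<mu>\<^sup>2 * (s * N + C * N\<^sup>2)\<^sup>2 / n + N * n powr (- s)" for n :: real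
  have bi: "integrable lborel \<beta>"
    using integrable_Re[OF test_functions_integrable[OF \<beta>(1)]] by simp
  have [measurable]: "\<beta> \<in> borel_measurable borel" using borel_measurable_integrable[OF bi] by simp
  have b2: "integrable lborel (\<lambda>y. (\<beta> y)\<^sup>2)"
    using integrable_Re[OF test_functions_integrable[OF test_functions_mult[OF \<beta>(1) test_functions_smooth[OF \<beta>(1)]]]]
    by (simp add: power2_eq_square)
  have at_top: "filterlim (\<lambda>k. real k + 1) at_top sequentially"
    using filterlim_tendsto_add_at_top[OF tendsto_const filterlim_real_sequentially, of 1] by (simp add: add.commute)
  have "(\<lambda>k. \<epsilon> (real k + 1)) \<longlonglongrightarrow> 0 + 0 + N * 0"
    unfolding \<epsilon>_def
    by (intro tendsto_add tendsto_mult tendsto_const real_tendsto_divide_at_top[OF tendsto_const at_top] tendsto_neg_powr at_top)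
       (use \<open>s > 0\<close> in auto)
  then have "(\<lambda>k. \<bar>\<mu>\<bar> * s * J - \<epsilon> (real k + 1) * L) \<longlonglongrightarrow> \<bar>\<mu>\<bar> * s * J - 0 * L"
    by (intro tendsto_diff tendsto_mult tendsto_const) simp
  moreover have "0 < \<bar>\<mu>\<bar> * s * J" using \<open>\<mu> \<noteq> 0\<close> \<open>s > 0\<close> \<beta>(3) by (simp add: J_def)
  ultimately have "filterlim (\<lambda>k. (\<bar>\<mu>\<bar> * s * J - \<epsilon> (real k + 1) * L) * (real k + 1)) at_top sequentially"
    by (intro filterlim_tendsto_pos_mult_at_top[OF _ _ at_top]) auto
  then have "eventually (\<lambda>k. G < (\<bar>\<mu>\<bar> * s * J - \<epsilon> (real k + 1) * L) * (real k + 1)) sequentially"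
    by (simp add: filterlim_at_top_dense)
  moreover have "eventually (\<lambda>k. 2 * N \<le> real k + 1) sequentially"
    using at_top by (simp add: filterlim_at_top)
  ultimately have "eventually (\<lambda>k. G < (\<bar>\<mu>\<bar> * s * J - \<epsilon> (real k + 1) * L) * (real k + 1) \<and> 2 * N \<le> real k + 1) sequentially"
    by (rule eventually_conj)
  then obtain k where k: "G < (\<bar>\<mu>\<bar> * s * J - \<epsilon> (real k + 1) * L) * (real k + 1)" "2 * N \<le> real k + 1"
    using eventually_happens[of _ sequentially] by force
  define n where "n = real k + 1"
  have n: "1 \<le> n" by (simp add: n_def)
  define E where "E y = evolve A lam \<sigma> t (of_real (M k + n * M k powr (- s) * \<beta> y))" for y
  \<comment> \<open>A phase common to the whole plateau; it has modulus 1, so removing it does not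
    change the size of the pairing.\<close>
  define e where "e = exp (- \<i> * complex_of_real ((A - lam * M k powr s) * t))"
  have e1: "cmod e = 1" unfolding e_def by simp
  have [measurable]: "E \<in> borel_measurable borel" unfolding E_def[abs_def] by measurable
  have cE: "cmod (E y) \<le> M k + n * M k powr (- s) * N" for y
  proof -
    have "\<bar>M k + n * M k powr (- s) * \<beta> y\<bar> \<le> \<bar>M k\<bar> + n * M k powr (- s) * \<bar>\<beta> y\<bar>"
      using n by (intro order_trans[OF abs_triangle_ineq]) (simp add: abs_mult)
    also have "\<dots> \<le> M k + n * M k powr (- s) * N"
      using N(2)[of y] n M[of k] by (intro add_mono mult_left_mono) (auto intro: order_trans[OF zero_le_power2])
    finally show ?thesis unfolding E_def cmod_evolve norm_of_real .
  qed
  have iE: "integrable lborel (\<lambda>y. E y * of_real (\<beta> y))"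
    using integrable_mult_bounded[OF test_functions_integrable[OF \<beta>(1)] _ cE] by (simp add: mult.commute)
  let ?d = "\<lambda>y. (e * E y - of_real (M k) + \<i> * of_real (\<mu> * s * n * \<beta> y)) * of_real (\<beta> y)"
  have dec: "?d y = e * (E y * of_real (\<beta> y)) - of_real (M k) * of_real (\<beta> y) + \<i> * of_real (\<mu> * s * n) * of_real ((\<beta> y)\<^sup>2)" for y
    by (simp add: algebra_simps power2_eq_square)
  have i1: "integrable lborel (\<lambda>y. e * (E y * of_real (\<beta> y)))" by (intro integrable_mult_right iE)
  have i2: "integrable lborel (\<lambda>y. complex_of_real (M k) * of_real (\<beta> y))" by (intro integrable_mult_right integrable_of_real bi)
  have i3: "integrable lborel (\<lambda>y. \<i> * of_real (\<mu> * s * n) * complex_of_real ((\<beta> y)\<^sup>2))"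
    by (intro integrable_mult_right integrable_of_real b2)
  have id: "integrable lborel ?d"
    unfolding dec by (intro Bochner_Integration.integrable_add Bochner_Integration.integrable_diff i1 i2 i3)
  have "(LINT y|lborel. ?d y) = (LINT y|lborel. e * (E y * of_real (\<beta> y))) - (LINT y|lborel. complex_of_real (M k) * of_real (\<beta> y))
      + (LINT y|lborel. \<i> * of_real (\<mu> * s * n) * complex_of_real ((\<beta> y)\<^sup>2))"
    unfolding dec Bochner_Integration.integral_add[OF Bochner_Integration.integrable_diff[OF i1 i2] i3]
      Bochner_Integration.integral_diff[OF i1 i2] ..
  also have "\<dots> = e * (LINT y|lborel. E y * of_real (\<beta> y)) + \<i> * of_real (\<mu> * s * n) * of_real J"
    unfolding integral_mult_right_zero integral_complex_of_real by (simp add: \<beta>(2) J_def)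
  finally have "(LINT y|lborel. ?d y) = e * (LINT y|lborel. E y * of_real (\<beta> y)) + \<i> * of_real (\<mu> * s * n) * of_real J" .
  moreover have "cmod (LINT y|lborel. ?d y) \<le> (LINT y|lborel. n * \<epsilon> n * \<bar>\<beta> y\<bar>)"
  proof (rule Bochner_Integration.integral_norm_bound_integral[OF id])
    show "integrable lborel (\<lambda>y. n * \<epsilon> n * \<bar>\<beta> y\<bar>)" using bi by auto
    fix y :: 'a
    have "cmod (e * E y - of_real (M k) + \<i> * of_real (\<mu> * s * n * \<beta> y)) \<le> n * \<epsilon> n"
      unfolding e_def E_def \<epsilon>_def \<mu>_def s_def
      by (rule evolve_expansion[OF \<open>\<sigma> > 0\<close> C[unfolded s_def] N(2) n]) (use k(2) M[of k] in \<open>auto simp: n_def\<close>)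
    then show "cmod (?d y) \<le> n * \<epsilon> n * \<bar>\<beta> y\<bar>" unfolding norm_mult by (simp add: mult_right_mono)
  qed
  ultimately have "cmod (e * (LINT y|lborel. E y * of_real (\<beta> y)) + \<i> * of_real (\<mu> * s * n) * of_real J) \<le> n * \<epsilon> n * L"
    by (simp add: L_def)
  moreover have "cmod (\<i> * of_real (\<mu> * s * n) * of_real J) = \<bar>\<mu>\<bar> * s * n * J"
    using \<open>s > 0\<close> n \<beta>(3) by (simp add: norm_mult abs_mult J_def)
  moreover have "cmod (\<i> * of_real (\<mu> * s * n) * of_real J) \<le> cmod (e * (LINT y|lborel. E y * of_real (\<beta> y)) + \<i> * of_real (\<mu> * s * n) * of_real J)
      + cmod (e * (LINT y|lborel. E y * of_real (\<beta> y)))"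
  proof -
    have "cmod y \<le> cmod (x + y) + cmod x" for x y using norm_triangle_ineq4[of "x + y" x] by simp
    then show ?thesis .
  qed
  moreover have "cmod (e * (LINT y|lborel. E y * of_real (\<beta> y))) = cmod (LINT y|lborel. E y * of_real (\<beta> y))"
    by (simp add: norm_mult e1)
  ultimately have "\<bar>\<mu>\<bar> * s * n * J - n * \<epsilon> n * L \<le> cmod (LINT y|lborel. E y * of_real (\<beta> y))" by linarith
  moreover have "(\<bar>\<mu>\<bar> * s * J - \<epsilon> n * L) * n = \<bar>\<mu>\<bar> * s * n * J - n * \<epsilon> n * L" by (simp add: algebra_simps)
  ultimately show ?thesis
    using k(1) by (intro exI[of _ k]) (simp add: E_def n_def s_def)
qed

section \<open>Pairing with rescaled bumps in the Sobolev space\<close>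

lemma norm_power_le_weight: "norm (\<xi>::'a::euclidean_space) ^ DIM('a) \<le> weight \<xi>"
proof (cases "\<xi> = 0")
  case False
  then have "norm \<xi> ^ DIM('a) = ((norm \<xi>)\<^sup>2) powr (real DIM('a) / 2)" by (simp add: powr_half_DIM)
  also have "\<dots> \<le> weight \<xi>" unfolding weight_def by (intro powr_mono2) auto
  finally show ?thesis .
qed (simp add: power_0_left)

text \<open>On the Fourier side the pairing is bounded by the weighted square of \<open>g\<close>
  plus the dual one of the bump. The factor \<open>norm \<xi> ^ DIM('a)\<close> makes the latter
  uniform in the scale: it is dominated by the integral of
  \<open>r ^ DIM('a) * k (r *\<^sub>R \<xi>)\<close>, which does not depend on
  \<open>r\<close>.\<close>

lemma sobolev_pairing_bounded:
  fixes \<beta> :: "'a::euclidean_space \<Rightarrow> complex"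
  assumes T: "dist_in_sobolev (real DIM('a) / 2) T"
    and \<beta>: "\<beta> \<in> test_functions UNIV" and \<zeta>: "\<zeta> \<in> test_functions UNIV"
    and le: "\<And>\<xi>. cmod (fourier \<beta> \<xi>) \<le> norm \<xi> ^ DIM('a) * cmod (fourier \<zeta> \<xi>)"
  obtains G where "\<And>p r. 0 < r \<Longrightarrow> r \<le> 1 \<Longrightarrow> cmod (T (\<lambda>x. of_real (inverse (r ^ DIM('a))) * \<beta> (inverse r *\<^sub>R (x - p)))) \<le> G"
proof -
  obtain S g where TS: "dist_eq UNIV T S" and g: "fourier_is_function S g"
    and gi': "integrable lborel (sobolev_weighted_sq (real DIM('a) / 2) g)"
    using T unfolding dist_in_sobolev_def sobolev_space_def by auto
  have gi: "integrable lborel (\<lambda>\<xi>. weight \<xi> * (cmod (g \<xi>))\<^sup>2)"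
    using gi' ext[of "sobolev_weighted_sq (real DIM('a) / 2) g", OF weight_sobolev] by simp
  \<comment> \<open>Reflected because \<open>inv_fourier\<close> evaluates the transform at the
    opposite frequency.\<close>
  define k where "k \<eta> = weight \<eta> * (cmod (fourier (\<lambda>x. \<zeta> (- x)) \<eta>))\<^sup>2" for \<eta>
  have k: "integrable lborel k" unfolding k_def[abs_def] by (rule integrable_energy[OF test_functions_reflect[OF \<zeta>]])
  have [measurable]: "k \<in> borel_measurable borel" using borel_measurable_integrable[OF k] by simp
  have reflect: "fourier (\<lambda>x. \<zeta> (- x)) \<eta> = fourier \<zeta> (- \<eta>)" for \<eta>
    using inv_fourier_eq_fourier_reflect[OF test_functions_measurable[OF \<zeta>]] inv_fourier_eq_fourier by metis
  show ?thesis
  proof (rule that)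
    fix p :: 'a and r :: real assume r: "0 < r" "r \<le> 1"
    define \<phi> where "\<phi> = (\<lambda>x. of_real (inverse (r ^ DIM('a))) * \<beta> (inverse r *\<^sub>R (x - p)))"
    have \<phi>: "\<phi> \<in> test_functions UNIV"
      unfolding \<phi>_def using r by (intro test_functions_mult[OF test_functions_rescale[OF \<beta>] smooth_const]) auto
    \<comment> \<open>\<open>S\<close> is controlled through its Fourier transform, so the test
      function is written as the transform of \<psi>.\<close>
    define \<psi> where "\<psi> = inv_fourier \<phi>"
    have \<psi>: "\<psi> \<in> schwartz_functions" unfolding \<psi>_def by (rule inv_fourier_schwartz[OF \<phi>])
    have "T \<phi> = S (fourier \<psi>)"
      using TS \<phi> unfolding \<psi>_def fourier_inv_fourier[OF \<phi>] by (simp add: dist_eq_def)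
    also have "\<dots> = (LINT \<xi>|lborel. g \<xi> * \<psi> \<xi>)"
      using g \<psi> by (simp add: fourier_is_function_def dist_fourier_def regular_dist_def)
    finally have eq: "T \<phi> = (LINT \<xi>|lborel. g \<xi> * \<psi> \<xi>)" .
    have g\<psi>: "integrable lborel (\<lambda>\<xi>. g \<xi> * \<psi> \<xi>)" using g \<psi> by (simp add: fourier_is_function_def)
    have kr: "integrable lborel (\<lambda>\<xi>. k (0 + r *\<^sub>R \<xi>))"
      using lborel_affine_integral(2)[of r k 0] k r by simp
    have "cmod (T \<phi>) \<le> (LINT \<xi>|lborel. weight \<xi> * (cmod (g \<xi>))\<^sup>2 + r ^ DIM('a) * k (0 + r *\<^sub>R \<xi>))"
      unfolding eq
    proof (rule Bochner_Integration.integral_norm_bound_integral[OF g\<psi>])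
      show "integrable lborel (\<lambda>\<xi>. weight \<xi> * (cmod (g \<xi>))\<^sup>2 + r ^ DIM('a) * k (0 + r *\<^sub>R \<xi>))"
        by (intro Bochner_Integration.integrable_add gi integrable_mult_right kr)
      fix \<xi> :: 'a
      define w where "w = weight \<xi>"
      have w: "w \<ge> 1" unfolding w_def by (rule weight_ge_1)
      define Z where "Z = cmod (fourier \<zeta> (- (r *\<^sub>R \<xi>)))"
      have "cmod (\<psi> \<xi>) = cmod (fourier \<beta> (- (r *\<^sub>R \<xi>)))"
        unfolding \<psi>_def \<phi>_def inv_fourier_eq_fourier fourier_cmult
        using r by (subst fourier_affine[OF test_functions_measurable[OF \<beta>]]) (auto simp: norm_mult norm_power norm_inverse)
      also have "\<dots> \<le> norm (r *\<^sub>R \<xi>) ^ DIM('a) * Z" using le[of "- (r *\<^sub>R \<xi>)"] by (simp add: Z_def)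
      finally have "(cmod (\<psi> \<xi>))\<^sup>2 \<le> (norm (r *\<^sub>R \<xi>) ^ DIM('a) * Z)\<^sup>2" by (intro power_mono) auto
      \<comment> \<open>Of the two powers of \<open>norm (r *\<^sub>R \<xi>)\<close>, one is
        absorbed by the weight at \<xi> and leaves the Jacobian \<open>r ^ DIM('a)\<close>; the
        other stays at the scale of \<open>k\<close>.\<close>
      also have "\<dots> = r ^ DIM('a) * norm \<xi> ^ DIM('a) * (norm (r *\<^sub>R \<xi>) ^ DIM('a) * Z\<^sup>2)"
        using r by (simp add: power2_eq_square power_mult_distrib)
      also have "\<dots> \<le> r ^ DIM('a) * w * (weight (r *\<^sub>R \<xi>) * Z\<^sup>2)"
        unfolding w_def using r by (intro mult_mono mult_left_mono mult_right_mono norm_power_le_weight) auto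
      also have "\<dots> = w * (r ^ DIM('a) * k (0 + r *\<^sub>R \<xi>))"
        by (simp add: k_def Z_def reflect)
      finally have \<psi>2: "(cmod (\<psi> \<xi>))\<^sup>2 \<le> w * (r ^ DIM('a) * k (0 + r *\<^sub>R \<xi>))" .
      \<comment> \<open>Splitting the product by means of the weight gives two terms that are
        integrable separately.\<close>
      have "cmod (g \<xi>) * cmod (\<psi> \<xi>) \<le> w * (cmod (g \<xi>))\<^sup>2 + (cmod (\<psi> \<xi>))\<^sup>2 / w"
      proof -
        have "0 \<le> (sqrt w * cmod (g \<xi>) - cmod (\<psi> \<xi>) / sqrt w)\<^sup>2" by simp
        also have "\<dots> = w * (cmod (g \<xi>))\<^sup>2 + (cmod (\<psi> \<xi>))\<^sup>2 / w - 2 * (cmod (g \<xi>) * cmod (\<psi> \<xi>))"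
          using w by (simp add: power2_diff power_mult_distrib power_divide)
        finally show ?thesis using mult_nonneg_nonneg[OF norm_ge_zero norm_ge_zero, of "g \<xi>" "\<psi> \<xi>"] by linarith
      qed
      also have "(cmod (\<psi> \<xi>))\<^sup>2 / w \<le> r ^ DIM('a) * k (0 + r *\<^sub>R \<xi>)"
        using \<psi>2 w by (simp add: divide_le_eq mult.commute)
      finally show "norm (g \<xi> * \<psi> \<xi>) \<le> weight \<xi> * (cmod (g \<xi>))\<^sup>2 + r ^ DIM('a) * k (0 + r *\<^sub>R \<xi>)"
        by (simp add: norm_mult w_def)
    qed
    also have "\<dots> = (LINT \<xi>|lborel. weight \<xi> * (cmod (g \<xi>))\<^sup>2) + r ^ DIM('a) * (LINT \<xi>|lborel. k (0 + r *\<^sub>R \<xi>))"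
      using gi kr by simp
    also have "r ^ DIM('a) * (LINT \<xi>|lborel. k (0 + r *\<^sub>R \<xi>)) = (LINT \<xi>|lborel. k \<xi>)"
      using r by (subst lborel_affine_integral(1)) auto
    finally show "cmod (T (\<lambda>x. of_real (inverse (r ^ DIM('a))) * \<beta> (inverse r *\<^sub>R (x - p))))
      \<le> (LINT \<xi>|lborel. weight \<xi> * (cmod (g \<xi>))\<^sup>2) + (LINT \<xi>|lborel. k \<xi>)"
      by (simp add: \<phi>_def)
  qed
qed

text \<open>If \<open>u t\<close> were in the space, its pairings with all rescaled bumps would have
  a common bound \<open>G\<close>. The scale and the place of the bump are matched to the k-th
  plateau, and for some \<open>k\<close> the pairing exceeds \<open>G\<close>.\<close>

theorem instantaneous_loss_of_regularity:
  fixes c :: "'a::euclidean_space" and A lam \<sigma> \<delta> :: real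
  assumes "lam \<noteq> 0" "\<sigma> > 0" "\<delta> > 0"
  shows "\<exists>u0 \<in> sobolev_space (real DIM('a) / 2).
           sobolev_norm (real DIM('a) / 2) u0 \<le> \<delta> \<and>
           (\<exists>u. solves_cauchy_problem (\<lambda>\<xi>. A + c \<bullet> \<xi>) lam \<sigma> u0 u \<and>
                (\<forall>v. solves_cauchy_problem (\<lambda>\<xi>. A + c \<bullet> \<xi>) lam \<sigma> u0 v \<longrightarrow> (\<forall>t\<ge>0. dist_eq UNIV (v t) (u t))) \<and>
                (\<forall>t>0. \<not> dist_in_sobolev (real DIM('a) / 2) (u t)))"
proof -
  obtain \<beta> :: "'a \<Rightarrow> real" and \<zeta> where \<beta>: "(\<lambda>x. complex_of_real (\<beta> x)) \<in> test_functions UNIV" "\<And>x. x \<notin> cube 1 \<Longrightarrow> \<beta> x = 0"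
    "(LINT x|lborel. \<beta> x) = 0" "0 < (LINT x|lborel. (\<beta> x)\<^sup>2)" and \<zeta>: "\<zeta> \<in> test_functions UNIV"
    "\<And>\<xi>. cmod (fourier (\<lambda>x. complex_of_real (\<beta> x)) \<xi>) \<le> norm \<xi> ^ DIM('a) * cmod (fourier \<zeta> \<xi>)"
    using exists_detection_bump by blast
  have \<sigma>2: "2 * \<sigma> > 0" using assms by simp
  obtain u0 :: "'a \<Rightarrow> complex" and X M r where u0: "integrable lborel u0" "\<And>R. \<exists>B. \<forall>x. norm x \<le> R \<longrightarrow> cmod (u0 x) \<le> B"
    "integrable lborel (\<lambda>\<xi>. weight \<xi> * (cmod (fourier u0 \<xi>))\<^sup>2)" "energy u0 \<le> \<delta>\<^sup>2"
    and MR: "\<And>k. M k \<ge> (real k + 1)\<^sup>2" "\<And>k. 0 < r k" "\<And>k. r k \<le> 1"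
    and val: "\<And>k y. y \<in> cube 1 \<Longrightarrow> u0 (X k + r k *\<^sub>R y) = complex_of_real (M k + (real k + 1) * M k powr (- (2 * \<sigma>)) * \<beta> y)"
    apply (rule exists_initial_datum[OF \<beta>(1) _ \<sigma>2 \<open>\<delta> > 0\<close>])
    subgoal by (rule \<beta>(2))
    subgoal premises p for u X M r using p(1)[OF p(2-9)] .
    done
  have [measurable]: "u0 \<in> borel_measurable borel" using borel_measurable_integrable[OF u0(1)] by simp
  have [measurable]: "\<beta> \<in> borel_measurable borel"
    using measurable_compose[OF test_functions_measurable[OF \<beta>(1)] borel_measurable_Re] by simp
  define u where "u t = regular_dist (\<lambda>x. evolve A lam \<sigma> t (u0 (x + t *\<^sub>R c)))" for t
  have "\<not> dist_in_sobolev (real DIM('a) / 2) (u t)" if "t > 0" for t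
  proof
    assume "dist_in_sobolev (real DIM('a) / 2) (u t)"
    then obtain G where G: "\<And>p r. 0 < r \<Longrightarrow> r \<le> 1 \<Longrightarrow>
        cmod (u t (\<lambda>x. of_real (inverse (r ^ DIM('a))) * complex_of_real (\<beta> (inverse r *\<^sub>R (x - p))))) \<le> G"
      using sobolev_pairing_bounded[OF _ \<beta>(1) \<zeta>, of "u t"] by blast
    obtain k where k: "G < cmod (LINT y|lborel. evolve A lam \<sigma> t (of_real (M k + (real k + 1) * M k powr (- (2 * \<sigma>)) * \<beta> y)) * of_real (\<beta> y))"
      using pairing_unbounded[OF \<beta>(1,3,4) MR(1) \<open>\<sigma> > 0\<close> \<open>lam \<noteq> 0\<close> \<open>t > 0\<close>] by blast
    \<comment> \<open>By time \<open>t\<close> the k-th plateau has been carried from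
      \<open>X k\<close> to this point.\<close>
    define p where "p = X k - t *\<^sub>R c"
    define F where "F x = evolve A lam \<sigma> t (u0 (x + t *\<^sub>R c)) * complex_of_real (\<beta> (inverse (r k) *\<^sub>R (x - p)))" for x
    have Fm: "F \<in> borel_measurable borel" unfolding F_def[abs_def] by measurable
    have "u t (\<lambda>x. of_real (inverse (r k ^ DIM('a))) * complex_of_real (\<beta> (inverse (r k) *\<^sub>R (x - p))))
      = of_real (inverse (r k ^ DIM('a))) * (LINT x|lborel. F x)"
      unfolding u_def regular_dist_def F_def integral_mult_right_zero[symmetric] by (simp only: mult.left_commute)
    also have "\<dots> = (LINT y|lborel. F (p + r k *\<^sub>R y))"
      using lborel_affine_integral(1)[OF _ Fm, of "r k" p] MR(2)[of k] by (simp add: scaleR_conv_of_real)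
    also have "\<dots> = (LINT y|lborel. evolve A lam \<sigma> t (of_real (M k + (real k + 1) * M k powr (- (2 * \<sigma>)) * \<beta> y)) * of_real (\<beta> y))"
    proof (rule Bochner_Integration.integral_cong[OF refl])
      fix y
      have p1: "p + r k *\<^sub>R y + t *\<^sub>R c = X k + r k *\<^sub>R y" and p2: "inverse (r k) *\<^sub>R (p + r k *\<^sub>R y - p) = y"
        using MR(2)[of k] by (auto simp: p_def)
      have "F (p + r k *\<^sub>R y) = evolve A lam \<sigma> t (u0 (X k + r k *\<^sub>R y)) * of_real (\<beta> y)"
        unfolding F_def p1 p2 ..
      \<comment> \<open>Outside \<open>cube 1\<close> both sides vanish with \<beta>, so only the
        prescribed values of \<open>u0\<close> enter.\<close>
      then show "F (p + r k *\<^sub>R y) = evolve A lam \<sigma> t (of_real (M k + (real k + 1) * M k powr (- (2 * \<sigma>)) * \<beta> y)) * of_real (\<beta> y)"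
        using val[of y k] \<beta>(2)[of y] by (cases "y \<in> cube 1") simp_all
    qed
    finally show False using G[OF MR(2,3), of k p] k by simp
  qed
  moreover have "solves_cauchy_problem (\<lambda>\<xi>. A + c \<bullet> \<xi>) lam \<sigma> (regular_dist u0) u"
    unfolding u_def[abs_def] by (rule evolve_solves_cauchy_problem[OF u0(1,2) \<open>\<sigma> > 0\<close>])
  moreover have "dist_eq UNIV (v t) (u t)" if "solves_cauchy_problem (\<lambda>\<xi>. A + c \<bullet> \<xi>) lam \<sigma> (regular_dist u0) v" "0 \<le> t" for v t
    unfolding u_def by (rule evolve_unique[OF u0(1) \<open>\<sigma> > 0\<close> that])
  moreover have "sobolev_norm (real DIM('a) / 2) (regular_dist u0) \<le> \<delta>"
    unfolding sobolev_regular_dist(2)[OF u0(1,3)] using u0(4) \<open>\<delta> > 0\<close> by (intro real_le_lsqrt) auto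
  ultimately show ?thesis using sobolev_regular_dist(1)[OF u0(1,3)] by blast
qed

theorem proposition1p4:
  fixes P :: "real ^ 'n \<Rightarrow> real" and lam \<sigma> \<delta> :: real
  assumes "lam \<noteq> 0" and "\<sigma> > 0"
    and "\<sigma> \<in> \<int> \<or> (\<exists>r::int. 2 * \<sigma> \<ge> of_int r \<and> of_int r > real CARD('n) / 2)"
    and "(\<exists>c. P = (\<lambda>\<xi>. c \<bullet> \<xi>)) \<or> (\<exists>a. P = (\<lambda>\<xi>. a))"
    and "\<delta> > 0"
  shows "\<exists>u0 \<in> sobolev_space (real CARD('n) / 2).
           sobolev_norm (real CARD('n) / 2) u0 \<le> \<delta> \<and>
           (\<exists>u. solves_cauchy_problem P lam \<sigma> u0 u \<and>
                (\<forall>v. solves_cauchy_problem P lam \<sigma> u0 v \<longrightarrow> (\<forall>t\<ge>0. dist_eq UNIV (v t) (u t))) \<and>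
                (\<forall>t>0. \<not> dist_in_sobolev (real CARD('n) / 2) (u t)))"
proof -
  obtain A c where P: "P = (\<lambda>\<xi>. A + c \<bullet> \<xi>)"
  proof -
    consider c where "P = (\<lambda>\<xi>. c \<bullet> \<xi>)" | a where "P = (\<lambda>\<xi>. a)" using assms(4) by blast
    then show ?thesis
    proof cases
      case (1 c)
      then show ?thesis by (intro that[of 0 c]) simp
    next
      case (2 a)
      then show ?thesis by (intro that[of a 0]) simp
    qed
  qed
  show ?thesis
    using instantaneous_loss_of_regularity[OF assms(1,2,5), of A c] unfolding P by simp
qed

end
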